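(* Let $M$ be a monoid and $\phi:M\to M$ an endomorphism. Then $\mathrm{BR}(M,\phi)$ is $U(\mathrm{CF})$ if and only if $M$ is $U(\mathrm{CF})$ and $\operatorname{im}\phi^n$ is finite for some $n\in\mathbb{N}$.
   Context: For a monoid $M$ generated by a finite set $A$, $\mathrm{WP}(M,A)=\{u\#v^{\mathrm{rev}} : u,v\in A^*,\ u=_M v\}$, where $\#\notin A$ and $v^{\mathrm{rev}}$ is the reversal of $v$. A monoid is $U(\mathrm{CF})$ if it is finitely generated and its word problem with respect to some (equivalently any) finite generating set is context-free. If $M$ has monoid presentation $\langle A\mid \mathcal{R}\rangle$ ($A$ possibly infinite) and $\phi$ is an endomorphism of $M$ (maps written on the right), the Bruck--Reilly extension $\mathrm{BR}(M,\phi)$ is the monoid presented by $\langle A,b,c\mid \mathcal{R},\ bc=1,\ ba=(a\phi)b,\ ac=c(a\phi)\ (a\in A)\rangle$ (with $a\phi$ written as a word over $A$); it does not depend on the choice of presentation. *)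

theory Defs
  imports "HOL-Algebra.Group"
begin

inductive cfg_step :: "(nat \<times> (nat + 't) list) set \<Rightarrow> (nat + 't) list \<Rightarrow> (nat + 't) list \<Rightarrow> bool"
  for P where
  "(A, rhs) \<in> P \<Longrightarrow> cfg_step P (u @ [Inl A] @ v) (u @ rhs @ v)"

definition cfg_lang :: "(nat \<times> (nat + 't) list) set \<Rightarrow> nat \<Rightarrow> 't list set" where
  "cfg_lang P S = {w. (cfg_step P)\<^sup>*\<^sup>* [Inl S] (map Inr w)}"

definition context_free :: "'t list set \<Rightarrow> bool" where
  "context_free L \<longleftrightarrow> (\<exists>(P :: (nat \<times> (nat + 't) list) set) S. finite P \<and> L = cfg_lang P S)"

definition word_prod :: "('a, 'b) monoid_scheme \<Rightarrow> 'a list \<Rightarrow> 'a" where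
  "word_prod G w = foldr (\<lambda>x y. x \<otimes>\<^bsub>G\<^esub> y) w \<one>\<^bsub>G\<^esub>"

text \<open>The separator \# is None; letters of A are Some a.\<close>
definition word_problem :: "('a, 'b) monoid_scheme \<Rightarrow> 'a set \<Rightarrow> 'a option list set" where
  "word_problem G A = {map Some u @ [None] @ rev (map Some v) | u v.
      u \<in> lists A \<and> v \<in> lists A \<and> word_prod G u = word_prod G v}"

definition generates :: "('a, 'b) monoid_scheme \<Rightarrow> 'a set \<Rightarrow> bool" where
  "generates G A \<longleftrightarrow> A \<subseteq> carrier G \<and> carrier G = word_prod G ` lists A"

definition UCF :: "('a, 'b) monoid_scheme \<Rightarrow> bool" where
  "UCF G \<longleftrightarrow> (\<exists>A. finite A \<and> generates G A \<and> context_free (word_problem G A))"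

datatype 'a brgen = Gen 'a | B | C

text \<open>Presentation of M: generators all elements of M, relations all pairs of words with
  equal product (the full kernel).  Then add b, c with bc = 1, ba = (a phi) b, ac = c (a phi).\<close>
definition br_rels :: "('a, 'b) monoid_scheme \<Rightarrow> ('a \<Rightarrow> 'a) \<Rightarrow> ('a brgen list \<times> 'a brgen list) set" where
  "br_rels M \<phi> =
     {(map Gen u, map Gen v) | u v. u \<in> lists (carrier M) \<and> v \<in> lists (carrier M)
                                   \<and> word_prod M u = word_prod M v}
   \<union> {([B, C], [])}
   \<union> {([B, Gen a], [Gen (\<phi> a), B]) | a. a \<in> carrier M}
   \<union> {([Gen a, C], [C, Gen (\<phi> a)]) | a. a \<in> carrier M}"

inductive pres_cong :: "('g list \<times> 'g list) set \<Rightarrow> 'g list \<Rightarrow> 'g list \<Rightarrow> bool" for R where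
  base: "(u, v) \<in> R \<Longrightarrow> pres_cong R u v"
| refl: "pres_cong R u u"
| sym: "pres_cong R u v \<Longrightarrow> pres_cong R v u"
| trans: "pres_cong R u v \<Longrightarrow> pres_cong R v w \<Longrightarrow> pres_cong R u w"
| ctxt: "pres_cong R u v \<Longrightarrow> pres_cong R (x @ u @ y) (x @ v @ y)"

definition pres_class :: "('g list \<times> 'g list) set \<Rightarrow> 'g list \<Rightarrow> 'g list set" where
  "pres_class R w = {v. pres_cong R w v}"

definition presented_monoid :: "'g set \<Rightarrow> ('g list \<times> 'g list) set \<Rightarrow> 'g list set monoid" where
  "presented_monoid X R =
     \<lparr> carrier = pres_class R ` lists X,
       mult = (\<lambda>P Q. pres_class R ((SOME u. u \<in> P) @ (SOME v. v \<in> Q))),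
       one = pres_class R [] \<rparr>"

definition BR :: "('a, 'b) monoid_scheme \<Rightarrow> ('a \<Rightarrow> 'a) \<Rightarrow> 'a brgen list set monoid" where
  "BR M \<phi> = presented_monoid (Gen ` carrier M \<union> {B, C}) (br_rels M \<phi>)"

end

(* Idea.  Write the elements of BR(M, phi) as c^i m b^j.

   If BR(M, phi) is U(CF) but every im(phi^n) is infinite, compare w c^n with c^n b^n w c^n, where w is
   a word over the generators of BR(M, phi) with value in M.  In a derivation tree of the corresponding
   word of the word problem, follow the path to the letter #.  Either some node on it covers the second w
   but nothing of the first; it transmits the class of w modulo phi^n, which for a fixed n can happen
   only for finitely many classes.  Or some node reaches into the first w but does not cover the second;
   it determines a number that is at least n, which can happen only for finitely many n.  Hence some
   im(phi^n) is finite, M is finitely generated and inherits the context-free word problem.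

   Conversely let F = im(phi^n) be finite and Y a finite phi-stable generating set of M containing F.  In a
   word with value c^i m b^j a letter a of Y contributes a phi^e to m, where e is the larger of the number of
   b's pending before it and the number of c's after it that have no partner.  Positions with e < n are
   handled by a finite transducer applied to the word problem of M; a maximal balanced factor at level n
   contributes just one element of F.  In u # v^rev the unmatched letters nest as c^i b^j # b^j c^i, so
   the first i - n of the c's and the last j - n of the b's can be generated in matching pairs, with the
   contributions to m of the stretches between them recorded as elements of F in the nonterminals. *)

theory Submission
  imports Defs
begin

section \<open>Context-free grammars\<close>

text \<open>The two compared words have equal values because w c^n = c^n \<phi>^n(w) and b^n w c^n =
  \<phi>^n(w). The leading c^n of the second one forces at least n unmatched c's into its value
  whatever follows; the second alternative plays this against a first word that is cut inside w.

  In the converse the obstacle is that words nest arbitrarily deeply and carry arbitrarily many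
  unmatched letters, whereas a state or a nonterminal can record only finitely much. At depth n or
  more every contribution lies in F, which is finite and closed under products and \<phi>. Since
  \<phi>^n is a homomorphism commuting with \<phi>, the image under \<phi>^n of the value of a
  factor can be computed along its parse without knowing the value itself.

  Every move of the transducer emits exactly one letter, so a move that contributes nothing has to
  emit the identity. This is why the identity is adjoined to the generators of M.

  The extension is given by a presentation; equality in it is replaced by equality of triples on
  which words act, and the grammars speak only of those triples.\<close>

inductive derives :: "('n \<times> ('n + 't) list) set \<Rightarrow> ('n + 't) list \<Rightarrow> 't list \<Rightarrow> bool" for P where
  derives_Nil: "derives P [] []"
| derives_Inr: "derives P \<gamma> w \<Longrightarrow> derives P (Inr t # \<gamma>) (t # w)"
| derives_Inl: "(X, rhs) \<in> P \<Longrightarrow> derives P rhs u \<Longrightarrow> derives P \<gamma> v \<Longrightarrow> derives P (Inl X # \<gamma>) (u @ v)"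

inductive_cases derives_NilE: "derives P [] w"
inductive_cases derives_InrE: "derives P (Inr t # \<gamma>) w"
inductive_cases derives_InlE: "derives P (Inl X # \<gamma>) w"

lemma derives_appendI:
  "derives P \<gamma> u \<Longrightarrow> derives P \<delta> v \<Longrightarrow> derives P (\<gamma> @ \<delta>) (u @ v)"
proof (induction rule: derives.induct)
  case (derives_Inl X rhs u \<gamma> v')
  then show ?case using derives.derives_Inl[of X rhs P u "\<gamma> @ \<delta>" "v' @ v"] by simp
qed (auto intro: derives.intros)

lemma derives_appendE:
  assumes "derives P (\<gamma> @ \<delta>) w"
  obtains u v where "w = u @ v" "derives P \<gamma> u" "derives P \<delta> v"
  using assms
proof (induction \<gamma> arbitrary: w thesis)
  case Nil
  then show ?case using derives_Nil by fastforce
next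
  case (Cons Y \<gamma>)
  show ?case
  proof (cases Y)
    case (Inl X)
    with Cons.prems(2) obtain rhs u v where 1: "(X, rhs) \<in> P" "derives P rhs u" "w = u @ v" "derives P (\<gamma> @ \<delta>) v"
      by (auto elim: derives_InlE)
    from Cons.IH[OF _ 1(4)] obtain v1 v2 where "v = v1 @ v2" "derives P \<gamma> v1" "derives P \<delta> v2" by blast
    then show ?thesis using Cons.prems(1)[of "u @ v1" v2] 1 Inl by (auto intro: derives_Inl)
  next
    case (Inr t)
    with Cons.prems(2) obtain v where 1: "w = t # v" "derives P (\<gamma> @ \<delta>) v"
      by (auto elim: derives_InrE)
    from Cons.IH[OF _ 1(2)] obtain v1 v2 where "v = v1 @ v2" "derives P \<gamma> v1" "derives P \<delta> v2" by blast
    then show ?thesis using Cons.prems(1)[of "t # v1" v2] 1 Inr by (auto intro: derives_Inr)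
  qed
qed

lemma derives_single: "(X, rhs) \<in> P \<Longrightarrow> derives P rhs u \<Longrightarrow> derives P [Inl X] u"
  using derives_Inl[OF _ _ derives_Nil] by force

lemma derives_singleE:
  assumes "derives P [Inl X] w"
  obtains rhs where "(X, rhs) \<in> P" "derives P rhs w"
  using assms by (auto elim!: derives_InlE derives_NilE)

lemma derives_terminals: "derives P (map Inr w) w"
  by (induction w) (auto intro: derives.intros)

lemma derives_if_cfg_step:
  assumes "cfg_step P \<gamma> \<delta>" "derives P \<delta> w"
  shows "derives P \<gamma> w"
  using assms
proof cases
  case (1 A rhs u v)
  with assms(2) obtain w1 w2 w3 where "w = w1 @ w2 @ w3" "derives P u w1" "derives P rhs w2" "derives P v w3"
    by (metis derives_appendE)
  moreover from this have "derives P (u @ Inl A # v) (w1 @ w2 @ w3)"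
    using 1 by (intro derives_appendI derives_Inl)
  ultimately show ?thesis using 1 by simp
qed

lemma cfg_steps_context:
  assumes "(cfg_step P)\<^sup>*\<^sup>* \<gamma> \<delta>"
  shows "(cfg_step P)\<^sup>*\<^sup>* (x @ \<gamma> @ y) (x @ \<delta> @ y)"
  using assms
proof (induction rule: rtranclp_induct)
  case (step \<delta> \<epsilon>)
  from step(2) have "cfg_step P (x @ \<delta> @ y) (x @ \<epsilon> @ y)"
  proof cases
    case (1 A rhs u v)
    then show ?thesis using cfg_step.intros[OF 1(3), of "x @ u" "v @ y"] by simp
  qed
  with step show ?case by auto
qed simp

lemma cfg_steps_if_derives:
  assumes "derives P \<gamma> w"
  shows "(cfg_step P)\<^sup>*\<^sup>* \<gamma> (map Inr w)"
  using assms
proof induction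
  case (derives_Inr \<gamma> w t)
  then show ?case using cfg_steps_context[of P \<gamma> "map Inr w" "[Inr t]" "[]"] by simp
next
  case (derives_Inl X rhs u \<gamma> v)
  have "cfg_step P (Inl X # \<gamma>) (rhs @ \<gamma>)"
    using cfg_step.intros[OF derives_Inl(1), of "[]" \<gamma>] by simp
  moreover have "(cfg_step P)\<^sup>*\<^sup>* (rhs @ \<gamma>) (map Inr u @ \<gamma>)"
    using cfg_steps_context[OF derives_Inl(4), of "[]" \<gamma>] by simp
  moreover have "(cfg_step P)\<^sup>*\<^sup>* (map Inr u @ \<gamma>) (map Inr u @ map Inr v)"
    using cfg_steps_context[OF derives_Inl(5), of "map Inr u" "[]"] by simp
  ultimately show ?case by (metis (no_types, lifting) converse_rtranclp_into_rtranclp map_append rtranclp_trans)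
qed simp

lemma cfg_lang_eq_derives: "cfg_lang P S = {w. derives P [Inl S] w}"
proof -
  have "derives P \<gamma> w" if "(cfg_step P)\<^sup>*\<^sup>* \<gamma> (map Inr w)" for \<gamma> w
    using that by (induction rule: converse_rtranclp_induct) (auto intro: derives_terminals derives_if_cfg_step)
  then show ?thesis unfolding cfg_lang_def using cfg_steps_if_derives by blast
qed

text \<open>From here on context-freeness is used only through this big-step form. It allows
  induction over derivation trees and splitting a derived word along a concatenation of sentential
  forms.\<close>

lemma context_free_iff_derives:
  "context_free (L :: 't list set) \<longleftrightarrow>
    (\<exists>(P :: (nat \<times> (nat + 't) list) set) S. finite P \<and> L = {w. derives P [Inl S] w})"
  unfolding context_free_def cfg_lang_eq_derives ..

lemma derives_rename:
  "derives P \<gamma> w \<Longrightarrow> derives ((\<lambda>(X, rhs). (f X, map (map_sum f id) rhs)) ` P) (map (map_sum f id) \<gamma>) w"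
  by (induction rule: derives.induct) (force intro: derives.intros)+

text \<open>Nonterminals may have any type: the finitely many that occur are injected into
  \<open>nat\<close>. Renaming back with the inverse of the injection recovers \<open>P\<close>, so
  \<open>derives_rename\<close> serves for both inclusions.\<close>

lemma derives_context_free:
  fixes P :: "('n \<times> ('n + 't) list) set"
  assumes fin: "finite P"
  shows "context_free {w. derives P [Inl S] w}"
proof -
  define N where "N = insert S (fst ` P \<union> {X. \<exists>(Y, rhs) \<in> P. Inl X \<in> set rhs})"
  have "{X. \<exists>(Y, rhs) \<in> P. Inl X \<in> set rhs} = (\<Union>(Y, rhs) \<in> P. Inl -` set rhs)" by auto
  moreover have "finite (Inl -` set rhs :: 'n set)" for rhs :: "('n + 't) list"
    by (intro finite_vimageI) auto
  ultimately have "finite N" using fin by (auto simp: N_def)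
  then obtain f :: "'n \<Rightarrow> nat" where inj: "inj_on f N"
    using finite_imp_inj_to_nat_seg by blast
  define g where "g = inv_into N f"
  have gf: "g (f X) = X" if "X \<in> N" for X using that inj by (simp add: g_def)
  let ?F = "\<lambda>(X, rhs). (f X, map (map_sum f id) rhs)"
  let ?G = "\<lambda>(X, rhs). (g X, map (map_sum g id) rhs)"
  have "map (map_sum g id) (map (map_sum f id) rhs) = rhs" if "(X, rhs) \<in> P" for X and rhs :: "('n + 't) list"
  proof -
    have "map_sum g id (map_sum f id Y) = Y" if "Y \<in> set rhs" for Y
    proof (cases Y)
      case (Inl X')
      then have "X' \<in> N" using that \<open>(X, rhs) \<in> P\<close> by (auto simp: N_def)
      then show ?thesis using Inl gf by simp
    qed simp
    then show ?thesis by (simp add: map_idI)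
  qed
  moreover have "X \<in> N" if "(X, rhs) \<in> P" for X rhs using that by (force simp: N_def)
  ultimately have "?G (?F p) = p" if "p \<in> P" for p using that by (cases p) (simp add: gf del: map_map)
  then have "?G ` ?F ` P = P" by (force simp del: map_map)
  then have "derives P [Inl S] w" if "derives (?F ` P) [Inl (f S)] w" for w
    using derives_rename[OF that, of g] gf[of S] by (simp add: N_def del: map_map)
  moreover have "derives (?F ` P) [Inl (f S)] w" if "derives P [Inl S] w" for w
    using derives_rename[OF that, of f] by simp
  ultimately have "{w. derives P [Inl S] w} = {w. derives (?F ` P) [Inl (f S)] w}" by blast
  then show ?thesis unfolding context_free_iff_derives using fin by blast
qed

section \<open>Grammars whose terminals are languages\<close>

definition conc :: "'t list set \<Rightarrow> 't list set \<Rightarrow> 't list set" (infixr "\<cdot>" 75) where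
  "K \<cdot> L = {u @ v | u v. u \<in> K \<and> v \<in> L}"

lemma concI: "u \<in> K \<Longrightarrow> v \<in> L \<Longrightarrow> u @ v \<in> K \<cdot> L"
  by (auto simp: conc_def)

text \<open>A terminal stands for a whole language, from which each occurrence picks its own word.
  Later grammars can thus use languages already known to be context-free as building blocks.\<close>

inductive lderives :: "('n \<times> ('n + 't list set) list) set \<Rightarrow> ('n + 't list set) list \<Rightarrow> 't list \<Rightarrow> bool" for P where
  lderives_Nil: "lderives P [] []"
| lderives_Inr: "u \<in> L \<Longrightarrow> lderives P \<gamma> v \<Longrightarrow> lderives P (Inr L # \<gamma>) (u @ v)"
| lderives_Inl: "(X, rhs) \<in> P \<Longrightarrow> lderives P rhs u \<Longrightarrow> lderives P \<gamma> v \<Longrightarrow> lderives P (Inl X # \<gamma>) (u @ v)"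

inductive_cases lderives_NilE: "lderives P [] w"
inductive_cases lderives_InrE: "lderives P (Inr L # \<gamma>) w"
inductive_cases lderives_InlE: "lderives P (Inl X # \<gamma>) w"

lemma lderives_single: "(X, rhs) \<in> P \<Longrightarrow> lderives P rhs u \<Longrightarrow> lderives P [Inl X] u"
  using lderives_Inl[OF _ _ lderives_Nil] by force

lemma lderives_Cons: "lderives P [Y] u \<Longrightarrow> lderives P \<gamma> v \<Longrightarrow> lderives P (Y # \<gamma>) (u @ v)"
  by (cases Y) (auto elim!: lderives_InlE lderives_InrE lderives_NilE intro: lderives.intros)

fun sem :: "('n \<Rightarrow> 't list set) \<Rightarrow> ('n + 't list set) list \<Rightarrow> 't list set" where
  "sem I [] = {[]}"
| "sem I (Inl X # \<gamma>) = I X \<cdot> sem I \<gamma>"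
| "sem I (Inr L # \<gamma>) = L \<cdot> sem I \<gamma>"

text \<open>Least-fixed-point principle: an interpretation closed under all productions contains
  every derivable word. Soundness of a grammar then amounts to checking its productions against the
  intended languages \<open>I\<close>.\<close>

lemma lderives_sound:
  assumes "lderives P \<gamma> w" and "\<And>X rhs. (X, rhs) \<in> P \<Longrightarrow> sem I rhs \<subseteq> I X"
  shows "w \<in> sem I \<gamma>"
  using assms(1) by induction (use assms(2) in \<open>auto intro!: concI\<close>)

text \<open>Closure under substitution. The grammars of the finitely many occurring languages are
  made disjoint by tagging their nonterminals with the language, and each terminal \<open>L\<close>
  is replaced by the tagged start symbol of its grammar.\<close>

lemma lderives_context_free:
  fixes P :: "('n \<times> ('n + 't list set) list) set"
  assumes fin: "finite P" and cf: "\<And>X rhs L. (X, rhs) \<in> P \<Longrightarrow> Inr L \<in> set rhs \<Longrightarrow> context_free L"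
  shows "context_free {w. lderives P [Inl S] w}"
proof -
  define \<L> where "\<L> = {L. \<exists>(X, rhs) \<in> P. Inr L \<in> set rhs}"
  have "\<L> = (\<Union>(X, rhs) \<in> P. Inr -` set rhs)" by (auto simp: \<L>_def)
  moreover have "finite (Inr -` set rhs :: 't list set set)" for rhs :: "('n + 't list set) list"
    by (intro finite_vimageI) auto
  ultimately have fin\<L>: "finite \<L>" using fin by auto
  have "\<forall>L \<in> \<L>. \<exists>Q S. finite (Q :: (nat \<times> (nat + 't) list) set) \<and> L = {w. derives Q [Inl S] w}"
    using cf unfolding \<L>_def context_free_iff_derives by fast
  then obtain Q and s where
    finQ: "\<And>L. L \<in> \<L> \<Longrightarrow> finite (Q L :: (nat \<times> (nat + 't) list) set)" and
    LQ: "\<And>L. L \<in> \<L> \<Longrightarrow> L = {w. derives (Q L) [Inl (s L)] w}" by metis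
  let ?tr = "\<lambda>Y :: 'n + 't list set. (case Y of Inl X \<Rightarrow> Inl (Inl X) | Inr L \<Rightarrow> Inl (Inr (L, s L))) :: ('n + 't list set \<times> nat) + 't"
  let ?tag = "\<lambda>L (X, rhs). (Inr (L, X), map (map_sum (\<lambda>X. Inr (L, X)) id) rhs) :: ('n + 't list set \<times> nat) \<times> (('n + 't list set \<times> nat) + 't) list"
  define R where "R = (\<lambda>(X, rhs). (Inl X, map ?tr rhs)) ` P \<union> (\<Union>L \<in> \<L>. ?tag L ` Q L)"
  have tagged: "derives R (map (map_sum (\<lambda>X. Inr (L, X)) id) \<gamma>) w" if "L \<in> \<L>" "derives (Q L) \<gamma> w" for L \<gamma> w
    using that(2)
  proof induction
    case (derives_Inl X rhs u \<gamma> v)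
    have "(Inr (L, X), map (map_sum (\<lambda>X. Inr (L, X)) id) rhs) \<in> R"
      using derives_Inl(1) that(1) unfolding R_def by force
    from derives.derives_Inl[OF this derives_Inl(4,5)] show ?case by simp
  qed (auto intro: derives.intros)
  have complete: "derives R (map ?tr \<gamma>) w" if "lderives P \<gamma> w" "\<And>L. Inr L \<in> set \<gamma> \<Longrightarrow> L \<in> \<L>" for \<gamma> w
    using that
  proof induction
    case (lderives_Inr u L \<gamma> v)
    then have "L \<in> \<L>" by simp
    with lderives_Inr(1) LQ have "derives (Q L) [Inl (s L)] u" by blast
    from tagged[OF \<open>L \<in> \<L>\<close> this] have "derives R [Inl (Inr (L, s L))] u" by simp
    then show ?case using lderives_Inr derives_appendI[of R "[Inl (Inr (L, s L))]" u] by auto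
  next
    case (lderives_Inl X rhs u \<gamma> v)
    then have "\<And>L. Inr L \<in> set rhs \<Longrightarrow> L \<in> \<L>" unfolding \<L>_def by blast
    with lderives_Inl have "derives R (map ?tr rhs) u" by blast
    moreover have "(Inl X, map ?tr rhs) \<in> R" using lderives_Inl(1) unfolding R_def by force
    ultimately show ?case using lderives_Inl by (auto intro: derives.intros)
  qed (auto intro: derives.intros)
  \<comment> \<open>A derivation in \<open>R\<close> can start from a translated form of
    \<open>P\<close> or from a tagged form of some \<open>Q L\<close>, and it passes from the first
    kind to the second; hence one induction proves both statements. \<open>?tr\<close> yields no
    terminals, so in the first statement the terminal case is contradictory.\<close>
  have sound: "(\<forall>\<delta>. \<gamma> = map ?tr \<delta> \<and> (\<forall>L. Inr L \<in> set \<delta> \<longrightarrow> L \<in> \<L>) \<longrightarrow> lderives P \<delta> w) \<and>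
    (\<forall>L \<delta>. \<gamma> = map (map_sum (\<lambda>X. Inr (L, X)) id) \<delta> \<and> L \<in> \<L> \<longrightarrow> derives (Q L) \<delta> w)"
    if "derives R \<gamma> w" for \<gamma> w
    using that
  proof induction
    case derives_Nil
    then show ?case by (auto intro: derives.intros lderives.intros)
  next
    case (derives_Inr \<gamma> w t)
    show ?case
    proof (intro conjI allI impI; elim conjE)
      fix \<delta> assume "Inr t # \<gamma> = map ?tr \<delta>"
      then obtain Y where "?tr Y = Inr t" by (auto simp: Cons_eq_map_conv)
      then show "lderives P \<delta> (t # w)" by (auto split: sum.splits)
    next
      fix L \<delta> assume \<delta>: "Inr t # \<gamma> = map (map_sum (\<lambda>X. Inr (L, X)) id) \<delta>" "L \<in> \<L>"
      then obtain Y \<delta>' where Y: "\<delta> = Y # \<delta>'" "(Inr t :: ('n + 't list set \<times> nat) + 't) = map_sum (\<lambda>X. Inr (L, X)) id Y"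
          "\<gamma> = map (map_sum (\<lambda>X. Inr (L, X)) id) \<delta>'"
        by (auto simp: Cons_eq_map_conv)
      then have "Y = Inr t" by (cases Y) auto
      moreover have "derives (Q L) \<delta>' w" using derives_Inr(2) Y(3) \<delta>(2) by blast
      ultimately show "derives (Q L) \<delta> (t # w)" using Y(1) by (auto intro: derives.intros)
    qed
  next
    case (derives_Inl Z rhs u \<gamma> v)
    show ?case
    proof (intro conjI allI impI; elim conjE)
      fix \<delta> assume \<delta>: "Inl Z # \<gamma> = map ?tr \<delta>" "\<forall>L. Inr L \<in> set \<delta> \<longrightarrow> L \<in> \<L>"
      then obtain Y \<delta>' where Y: "\<delta> = Y # \<delta>'" "?tr Y = Inl Z" "\<gamma> = map ?tr \<delta>'" by (auto simp: Cons_eq_map_conv)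
      have v: "lderives P \<delta>' v" using derives_Inl(5) Y \<delta> by auto
      show "lderives P \<delta> (u @ v)"
      proof (cases Y)
        case (Inl X)
        with Y derives_Inl(1) obtain rhs' where r: "(X, rhs') \<in> P" "rhs = map ?tr rhs'"
          unfolding R_def by auto
        then have "\<And>L. Inr L \<in> set rhs' \<Longrightarrow> L \<in> \<L>" unfolding \<L>_def by blast
        then have "lderives P rhs' u" using derives_Inl(4) r by blast
        then show ?thesis using v r Y Inl by (auto intro: lderives.intros)
      next
        case (Inr L)
        with Y \<delta> have L: "L \<in> \<L>" by auto
        from Inr Y derives_Inl(1) obtain rhs' where r: "(s L, rhs') \<in> Q L" "rhs = map (map_sum (\<lambda>X. Inr (L, X)) id) rhs'"
          unfolding R_def by auto
        then have "derives (Q L) rhs' u" using derives_Inl(4) L by blast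
        then have "u \<in> L" using LQ[OF L] r derives_single by fast
        then show ?thesis using v Y Inr by (auto intro: lderives.intros)
      qed
    next
      fix L \<delta> assume \<delta>: "Inl Z # \<gamma> = map (map_sum (\<lambda>X. Inr (L, X)) id) \<delta>" "L \<in> \<L>"
      then obtain Y \<delta>' where Y: "\<delta> = Y # \<delta>'" "Inl Z = map_sum (\<lambda>X. Inr (L, X)) id Y"
          "\<gamma> = map (map_sum (\<lambda>X. Inr (L, X)) id) \<delta>'"
        by (auto simp: Cons_eq_map_conv)
      then obtain X where X: "Y = Inl X" "Z = Inr (L, X)" by (cases Y) auto
      with derives_Inl(1) obtain rhs' where r: "(X, rhs') \<in> Q L" "rhs = map (map_sum (\<lambda>X. Inr (L, X)) id) rhs'"
        unfolding R_def by auto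
      then have "derives (Q L) rhs' u" using derives_Inl(4) \<delta> by blast
      moreover have "derives (Q L) \<delta>' v" using derives_Inl(5) Y \<delta> by blast
      ultimately show "derives (Q L) \<delta> (u @ v)" using r X Y by (auto intro: derives.intros)
    qed
  qed
  have "finite R" unfolding R_def using fin fin\<L> finQ by auto
  then have "context_free {w. derives R [Inl (Inl S)] w}" by (rule derives_context_free)
  moreover have "{w. derives R [Inl (Inl S)] w} = {w. lderives P [Inl S] w}"
    using complete[of "[Inl S]"] sound[of "[Inl (Inl S)]"] by (auto dest!: spec[where x="[Inl S]"])
  ultimately show ?thesis by simp
qed

lemma context_free_singleton: "context_free {w}"
proof -
  have "derives {(0 :: nat, map Inr w)} [Inl 0] v \<longleftrightarrow> v = w" for v
  proof
    have *: "v = w" if "derives P (map Inr w) v" for v w and P :: "(nat \<times> (nat + 'a) list) set"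
      using that by (induction w arbitrary: v) (auto elim: derives_NilE derives_InrE)
    assume "derives {(0 :: nat, map Inr w)} [Inl 0] v"
    then have "derives {(0 :: nat, map Inr w)} (map Inr w) v" by (rule derives_singleE) simp
    then show "v = w" by (rule *)
  qed (auto intro: derives_single derives_terminals)
  then have "{w} = {v. derives {(0 :: nat, map Inr w)} [Inl 0] v}" by auto
  then show ?thesis using derives_context_free[of "{(0 :: nat, map Inr w)}" 0] by simp
qed

text \<open>Reversing all right-hand sides is an involution on grammars, so one direction of the
  derivation argument gives both inclusions.\<close>

lemma context_free_rev:
  assumes "context_free L"
  shows "context_free (rev ` L)"
proof -
  from assms obtain P :: "(nat \<times> (nat + 'a) list) set" and S
    where P: "finite P" "L = {w. derives P [Inl S] w}"
    unfolding context_free_iff_derives by blast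
  let ?R = "\<lambda>P :: (nat \<times> (nat + 'a) list) set. (\<lambda>(X, rhs). (X, rev rhs)) ` P"
  have *: "derives (?R P) (rev \<gamma>) (rev w)" if "derives P \<gamma> w" for P \<gamma> w
    using that
  proof induction
    case (derives_Inl X rhs u \<gamma> v)
    then have "derives (?R P) [Inl X] (rev u)" by (force intro: derives_single)
    then show ?case using derives_Inl by (auto intro: derives_appendI)
  qed (auto intro: derives_appendI derives.intros)
  have "?R (?R P) = P" by force
  then have "derives P [Inl S] (rev w)" if "derives (?R P) [Inl S] w" for w
    using *[OF that] by simp
  moreover have "derives (?R P) [Inl S] (rev w)" if "derives P [Inl S] w" for w
    using *[OF that] by simp
  ultimately have "rev ` L = {w. derives (?R P) [Inl S] w}"
    unfolding P(2) by (force simp: image_iff intro: exI[of _ "rev _"])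
  then show ?thesis using derives_context_free[of "?R P" S] P(1) by simp
qed

lemma context_free_map:
  assumes "context_free L"
  shows "context_free (map f ` L)"
proof -
  from assms obtain P :: "(nat \<times> (nat + 'a) list) set" and S
    where P: "finite P" "L = {w. derives P [Inl S] w}"
    unfolding context_free_iff_derives by blast
  let ?m = "map (map_sum id f)"
  let ?P = "(\<lambda>(X, rhs). (X, ?m rhs)) ` P"
  have 1: "derives ?P (?m \<gamma>) (map f w)" if "derives P \<gamma> w" for \<gamma> w
    using that by induction (force intro: derives.intros)+
  \<comment> \<open>\<open>f\<close> need not be injective, so the derivation cannot be inverted by
    renaming; it is traced back to some preimage of the derived word.\<close>
  have 2: "\<forall>\<gamma>. \<delta> = ?m \<gamma> \<longrightarrow> (\<exists>w. derives P \<gamma> w \<and> v = map f w)" if "derives ?P \<delta> v" for \<delta> v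
    using that
  proof induction
    case (derives_Inr \<delta> v t)
    show ?case
    proof (intro allI impI)
      fix \<gamma> assume "Inr t # \<delta> = ?m \<gamma>"
      then obtain Y \<gamma>' where Y: "\<gamma> = Y # \<gamma>'" "map_sum id f Y = Inr t" "\<delta> = ?m \<gamma>'"
        by (auto simp: Cons_eq_map_conv)
      then obtain s where "Y = Inr s" "t = f s" by (cases Y) auto
      moreover obtain w where "derives P \<gamma>' w" "v = map f w" using derives_Inr(2) Y by blast
      ultimately show "\<exists>w. derives P \<gamma> w \<and> t # v = map f w"
        using Y by (intro exI[of _ "s # w"]) (auto intro: derives.intros)
    qed
  next
    case (derives_Inl X rhs u \<delta> v)
    show ?case
    proof (intro allI impI)
      fix \<gamma> assume "Inl X # \<delta> = ?m \<gamma>"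
      then obtain Y \<gamma>' where Y: "\<gamma> = Y # \<gamma>'" "map_sum id f Y = Inl X" "\<delta> = ?m \<gamma>'"
        by (auto simp: Cons_eq_map_conv)
      then have "Y = Inl X" by (cases Y) auto
      moreover obtain w where "derives P \<gamma>' w" "v = map f w" using derives_Inl(5) Y by blast
      moreover obtain rhs' where "(X, rhs') \<in> P" "rhs = ?m rhs'" using derives_Inl(1) by auto
      moreover obtain z where "derives P rhs' z" "u = map f z" using derives_Inl(4) calculation(5) by blast
      ultimately show "\<exists>w. derives P \<gamma> w \<and> u @ v = map f w"
        using Y by (intro exI[of _ "z @ w"]) (auto intro: derives.intros)
    qed
  qed (auto intro: derives.intros)
  have "map f ` L = {w. derives ?P [Inl S] w}"
    unfolding P(2) using 1[of "[Inl S]"] 2[of "[Inl S]"] by (force dest!: spec[where x="[Inl S]"])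
  then show ?thesis using derives_context_free[of ?P S] P(1) by simp
qed

section \<open>Inverse images under transducers\<close>

text \<open>Since every transition emits exactly one letter, no empty moves have to be threaded through a
  grammar for the emitted words.\<close>

inductive path :: "('q \<times> 'x list set \<times> 'a \<times> 'q) set \<Rightarrow> 'q \<Rightarrow> 'x list \<Rightarrow> 'a list \<Rightarrow> 'q \<Rightarrow> bool" for E where
  path_Nil: "path E p [] [] p"
| path_Cons: "(p, L, a, q) \<in> E \<Longrightarrow> x \<in> L \<Longrightarrow> path E q w us r \<Longrightarrow> path E p (x @ w) (a # us) r"

inductive_cases path_NilE: "path E p w [] q"
inductive_cases path_ConsE: "path E p w (a # us) q"

lemma path_append: "path E p w us q \<Longrightarrow> path E q v vs r \<Longrightarrow> path E p (w @ v) (us @ vs) r"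
  by (induction rule: path.induct) (auto intro: path.intros)

lemma path_single: "(p, L, a, q) \<in> E \<Longrightarrow> x \<in> L \<Longrightarrow> path E p x [a] q"
  using path_Cons[OF _ _ path_Nil] by force

lemma path_step: "(p, {x}, a, q) \<in> E \<Longrightarrow> path E q w us r \<Longrightarrow> path E p (x @ w) (a # us) r"
  by (auto intro: path_Cons)

lemma path_snoc:
  "path E p w us q \<Longrightarrow> (q, L, a, r) \<in> E \<Longrightarrow> x \<in> L \<Longrightarrow> path E p (w @ x) (us @ [a]) r"
  by (blast intro: path_append path_single)

lemma path_appendE:
  assumes "path E p w (us @ vs) q"
  obtains w1 w2 r where "w = w1 @ w2" "path E p w1 us r" "path E r w2 vs q"
  using assms
proof (induction us arbitrary: p w thesis)
  case Nil
  then show ?case using path_Nil by fastforce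
next
  case (Cons a us)
  from Cons.prems(2) obtain L q' x w' where 1: "(p, L, a, q') \<in> E" "x \<in> L" "w = x @ w'" "path E q' w' (us @ vs) q"
    by (auto elim: path_ConsE)
  from Cons.IH[OF _ 1(4)] obtain w1 w2 r where "w' = w1 @ w2" "path E q' w1 us r" "path E r w2 vs q" by blast
  then show ?case using Cons.prems(1)[of "x @ w1" w2 r] 1 by (auto intro: path_Cons)
qed

lemma path_states: "path E p w us q \<Longrightarrow> p \<in> insert q ((\<lambda>(p, _). p) ` E)"
  by (induction rule: path.induct) force+

text \<open>All ways of threading intermediate states through a sentential form. The triple
  \<open>(p, Y, r)\<close> is meant to generate what is read from \<open>p\<close> to
  \<open>r\<close> while a word derived from \<open>Y\<close> is emitted.\<close>

fun lifts :: "'q set \<Rightarrow> 'q \<Rightarrow> 'y list \<Rightarrow> 'q \<Rightarrow> ('q \<times> 'y \<times> 'q + 'z) list set" where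
  "lifts Q p [] q = (if p = q then {[]} else {})"
| "lifts Q p (Y # \<gamma>) q = (\<Union>r \<in> Q. (\<lambda>\<delta>. Inl (p, Y, r) # \<delta>) ` lifts Q r \<gamma> q)"

lemma finite_lifts: "finite Q \<Longrightarrow> finite (lifts Q p \<gamma> q)"
  by (induction \<gamma> arbitrary: p) auto

lemma lifts_no_Inr: "\<delta> \<in> lifts Q p \<gamma> q \<Longrightarrow> Inr L \<notin> set \<delta>"
  by (induction \<gamma> arbitrary: p \<delta>) (auto split: if_splits)

text \<open>The triple construction for intersecting a context-free language with a regular one,
  with transitions that read a word of a context-free language. A triple whose middle is a terminal
  \<open>a\<close> generates the languages of the transitions emitting \<open>a\<close>.\<close>

lemma context_free_transduction:
  fixes E :: "('q \<times> 'x list set \<times> 'a \<times> 'q) set"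
  assumes E: "finite E" "\<And>p L a q. (p, L, a, q) \<in> E \<Longrightarrow> context_free L" and K: "context_free K"
  shows "context_free {w. \<exists>us \<in> K. path E p0 w us q0}"
proof -
  from K obtain P :: "(nat \<times> (nat + 'a) list) set" and S
    where P: "finite P" "K = {w. derives P [Inl S] w}"
    unfolding context_free_iff_derives by blast
  define Q where "Q = insert q0 ((\<lambda>(p, _). p) ` E) \<union> (\<lambda>(_, _, _, q). q) ` E"
  have finQ: "finite Q" using E(1) by (simp add: Q_def)
  have Q0: "q0 \<in> Q" by (simp add: Q_def)
  have QE: "p \<in> Q" "q \<in> Q" if "(p, L, a, q) \<in> E" for p L a q using that by (force simp: Q_def)+
  define R :: "(('q \<times> (nat + 'a) \<times> 'q) \<times> ('q \<times> (nat + 'a) \<times> 'q + 'x list set) list) set" where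
    "R = (\<Union>(X, rhs) \<in> P. \<Union>p \<in> insert p0 Q. \<Union>q \<in> Q. (\<lambda>\<delta>. ((p, Inl X, q), \<delta>)) ` lifts Q p rhs q)
      \<union> (\<lambda>(p, L, a, q). ((p, Inr a, q), [Inr L])) ` E"
  let ?I = "\<lambda>(p, Y, q). {w. \<exists>us. derives P [Y] us \<and> path E p w us q}"
  have complete: "\<exists>\<delta> \<in> lifts Q p \<gamma> q. lderives R \<delta> w"
    if "derives P \<gamma> us" "path E p w us q" "p \<in> insert p0 Q" "q \<in> Q" for p q w \<gamma> us
    using that
  proof (induction arbitrary: p q w)
    case derives_Nil
    then show ?case by (auto elim!: path_NilE intro: lderives.intros)
  next
    case (derives_Inr \<gamma> us a)
    from derives_Inr.prems(1) obtain L r x v where 1: "(p, L, a, r) \<in> E" "x \<in> L" "w = x @ v" "path E r v us q"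
      by (auto elim: path_ConsE)
    with derives_Inr.IH[OF 1(4)] derives_Inr.prems QE[OF 1(1)]
    obtain \<delta> where \<delta>: "\<delta> \<in> lifts Q r \<gamma> q" "lderives R \<delta> v" by blast
    have "((p, Inr a, r), [Inr L]) \<in> R" 
      unfolding R_def by (rule UnI2, rule image_eqI[OF _ 1(1)]) simp
    moreover have "lderives R [Inr L] x" using lderives_Inr[OF 1(2) lderives_Nil] by simp
    ultimately have "lderives R (Inl (p, Inr a, r) # \<delta>) w" unfolding 1(3) using \<delta>(2)
      by (rule lderives_Inl)
    then show ?case using \<delta>(1) QE[OF 1(1)] by auto
  next
    case (derives_Inl X rhs us \<gamma> vs)
    from derives_Inl.prems(1) obtain w1 w2 r where 1: "w = w1 @ w2" "path E p w1 us r" "path E r w2 vs q"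
      by (rule path_appendE)
    then have r: "r \<in> Q" using path_states[OF 1(3)] derives_Inl.prems(3) by (auto simp: Q_def)
    from derives_Inl.IH(1)[OF 1(2) derives_Inl.prems(2) r] obtain \<delta>1
      where \<delta>1: "\<delta>1 \<in> lifts Q p rhs r" "lderives R \<delta>1 w1" by blast
    from derives_Inl.IH(2)[OF 1(3) _ derives_Inl.prems(3)] r obtain \<delta>2
      where \<delta>2: "\<delta>2 \<in> lifts Q r \<gamma> q" "lderives R \<delta>2 w2" by blast
    have "((p, Inl X, r), \<delta>1) \<in> R"
      unfolding R_def
      by (rule UnI1, rule UN_I[OF derives_Inl.hyps(1)], simp only: prod.case, rule UN_I[OF derives_Inl.prems(2)])
        (use r \<delta>1(1) in blast)
    then have "lderives R (Inl (p, Inl X, r) # \<delta>2) w" unfolding 1(1) using \<delta>1(2) \<delta>2(2)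
      by (rule lderives_Inl)
    then show ?case using \<delta>2(1) r by auto
  qed
  have lifts_sound: "sem ?I \<delta> \<subseteq> {w. \<exists>us. derives P \<gamma> us \<and> path E p w us q}" if "\<delta> \<in> lifts Q p \<gamma> q" for \<delta> p \<gamma> q
    using that
  proof (induction \<gamma> arbitrary: \<delta> p)
    case Nil
    then show ?case by (auto split: if_splits intro: derives.intros path.intros)
  next
    case (Cons Y \<gamma>)
    then obtain r \<delta>' where \<delta>: "\<delta> = Inl (p, Y, r) # \<delta>'" "\<delta>' \<in> lifts Q r \<gamma> q" by auto
    show ?case
    proof
      fix w assume "w \<in> sem ?I \<delta>"
      with \<delta>(1) obtain w1 w2 us where w: "w = w1 @ w2" "w2 \<in> sem ?I \<delta>'"
          and us: "derives P [Y] us" "path E p w1 us r"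
        by (auto simp: conc_def)
      from w(2) Cons.IH[OF \<delta>(2)] obtain vs where vs: "derives P \<gamma> vs" "path E r w2 vs q" by blast
      have "derives P ([Y] @ \<gamma>) (us @ vs)" "path E p w (us @ vs) q"
        using derives_appendI[OF us(1) vs(1)] path_append[OF us(2) vs(2)] w(1) by simp_all
      then show "w \<in> {w. \<exists>us. derives P (Y # \<gamma>) us \<and> path E p w us q}" by auto
    qed
  qed
  have sound: "sem ?I rhs \<subseteq> ?I Z" if "(Z, rhs) \<in> R" for Z rhs
    using that unfolding R_def
  proof (elim UnE)
    assume "(Z, rhs) \<in> (\<Union>(X, rhs) \<in> P. \<Union>p \<in> insert p0 Q. \<Union>q \<in> Q. (\<lambda>\<delta>. ((p, Inl X, q), \<delta>)) ` lifts Q p rhs q)"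
    then obtain X \<gamma> p q where *: "(X, \<gamma>) \<in> P" "Z = (p, Inl X, q)" "rhs \<in> lifts Q p \<gamma> q" by blast
    show ?thesis
    proof
      fix w assume "w \<in> sem ?I rhs"
      then obtain us where "derives P \<gamma> us" "path E p w us q" using lifts_sound[OF *(3)] by blast
      moreover from this have "derives P [Inl X] us" using *(1) by (blast intro: derives_single)
      ultimately show "w \<in> ?I Z" using *(2) by auto
    qed
  next
    assume "(Z, rhs) \<in> (\<lambda>(p, L, a, q). ((p, Inr a, q), [Inr L])) ` E"
    then show ?thesis by (auto simp: conc_def intro!: exI[of _ "[_]"] path_single derives_Inr derives_Nil)
  qed
  have "finite R" unfolding R_def using E(1) P(1) finQ
    by (intro finite_UnI finite_UN_I) (auto simp: finite_lifts)
  moreover have "context_free L" if "(Z, rhs) \<in> R" "Inr L \<in> set rhs" for Z rhs L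
    using that(1) unfolding R_def
  proof (elim UnE)
    assume "(Z, rhs) \<in> (\<Union>(X, rhs) \<in> P. \<Union>p \<in> insert p0 Q. \<Union>q \<in> Q. (\<lambda>\<delta>. ((p, Inl X, q), \<delta>)) ` lifts Q p rhs q)"
    then obtain \<gamma> p q where "rhs \<in> lifts Q p \<gamma> q" by blast
    with lifts_no_Inr[OF this] that(2) show ?thesis by blast
  next
    assume "(Z, rhs) \<in> (\<lambda>(p, L, a, q). ((p, Inr a, q), [Inr L])) ` E"
    with that(2) E(2) show ?thesis by auto
  qed
  ultimately have "context_free {w. lderives R [Inl (p0, Inl S, q0)] w}"
    by (rule lderives_context_free)
  moreover have "lderives R [Inl (p0, Inl S, q0)] w \<longleftrightarrow> (\<exists>us \<in> K. path E p0 w us q0)" for w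
  proof
    assume "lderives R [Inl (p0, Inl S, q0)] w"
    from lderives_sound[OF this, of ?I] sound show "\<exists>us \<in> K. path E p0 w us q0"
      unfolding P(2) by (auto simp: conc_def)
  next
    assume "\<exists>us \<in> K. path E p0 w us q0"
    then obtain us where us: "derives P [Inl S] us" "path E p0 w us q0" using P(2) by blast
    from complete[OF this _ Q0] obtain \<delta> where "\<delta> \<in> lifts Q p0 [Inl S] q0" "lderives R \<delta> w" by auto
    then show "lderives R [Inl (p0, Inl S, q0)] w" by (auto split: if_splits)
  qed
  ultimately show ?thesis by simp
qed

text \<open>The same transducer \<open>D\<close> processes both halves of u # v^rev: forwards on the
  left, on a second copy of the states, and with all transitions and their languages reversed on the
  right. The transitions of \<open>Z\<close> connect the copies; they emit the separator but may
  read a whole language in its place, and they can make the two runs agree on where they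
  stop.\<close>

lemma context_free_pair_transduction:
  fixes D :: "('q \<times> 'x list set \<times> 'a \<times> 'q) set" and Z :: "('q \<times> 'x option list set \<times> 'q) set"
  assumes D: "finite D" "\<And>p L a q. (p, L, a, q) \<in> D \<Longrightarrow> context_free L"
    and Z: "finite Z" "\<And>p L q. (p, L, q) \<in> Z \<Longrightarrow> context_free L" and K: "context_free K"
  shows "context_free {map Some x @ l @ rev (map Some y) | x l y. \<exists>us vs z z' L.
    path D p x us z \<and> path D p' y vs z' \<and> (z, L, z') \<in> Z \<and> l \<in> L \<and>
    map Some us @ [None] @ rev (map Some vs) \<in> K}"
    (is "context_free ?T")
proof -
  define E :: "(('q + 'q) \<times> 'x option list set \<times> 'a option \<times> ('q + 'q)) set" where
    "E = (\<lambda>(p, L, a, q). (Inl p, map Some ` L, Some a, Inl q)) ` D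
      \<union> (\<lambda>(p, L, a, q). (Inr q, rev ` map Some ` L, Some a, Inr p)) ` D
      \<union> (\<lambda>(p, L, q). (Inl p, L, None, Inr q)) ` Z"
  have ED: "(Inl p, map Some ` L, Some a, Inl q) \<in> E" "(Inr q, rev ` map Some ` L, Some a, Inr p) \<in> E"
    if "(p, L, a, q) \<in> D" for p L a q using that unfolding E_def by force+
  have EZ: "(Inl p, L, None, Inr q) \<in> E" if "(p, L, q) \<in> Z" for p L q using that unfolding E_def by force
  have left: "path E (Inl p) (map Some x) (map Some us) (Inl z)" if "path D p x us z" for p x us z
    using that
  proof induction
    case (path_Cons p L a q x w us r)
    then show ?case using path.path_Cons[OF ED(1)[OF path_Cons(1)], of "map Some x"] by auto
  qed (auto intro: path.intros)
  have right: "path E (Inr z) (rev (map Some y)) (rev (map Some vs)) (Inr p)" if "path D p y vs z" for p y vs z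
    using that
  proof induction
    case (path_Cons p L a q x w us r)
    then have "rev (map Some x) \<in> rev ` map Some ` L" by simp
    then show ?case using path_snoc[OF path_Cons(4) ED(2)[OF path_Cons(1)]] by simp
  qed (auto intro: path.intros)
  \<comment> \<open>Induction from the front of the path: a state \<open>Inr q\<close> means that
    the center has been passed, so only a reversed run of \<open>D\<close> remains, whereas from
    \<open>Inl q\<close> the rest still contains the center.\<close>
  have sound: "(\<forall>q. s = Inr q \<longrightarrow> (\<exists>y vs. w = rev (map Some y) \<and> us = rev (map Some vs) \<and> path D p' y vs q))
    \<and> (\<forall>q. s = Inl q \<longrightarrow> (\<exists>x l y us' vs z z' L. w = map Some x @ l @ rev (map Some y) \<and>
        us = map Some us' @ [None] @ rev (map Some vs) \<and> path D q x us' z \<and> path D p' y vs z' \<and>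
        (z, L, z') \<in> Z \<and> l \<in> L))"
    if "path E s w us t" "t = Inr p'" for s w us t
    using that
  proof induction
    case (path_Nil s)
    then show ?case by (auto intro!: exI[of _ "[]"] path.intros)
  next
    case (path_Cons s L a s' x w us t)
    note IH = path_Cons(4)[OF path_Cons(5)]
    from path_Cons(1) consider
        (left) p L' b q where "(p, L', b, q) \<in> D" "s = Inl p" "L = map Some ` L'" "a = Some b" "s' = Inl q"
      | (right) p L' b q where "(p, L', b, q) \<in> D" "s = Inr q" "L = rev ` map Some ` L'" "a = Some b" "s' = Inr p"
      | (center) p q where "(p, L, q) \<in> Z" "s = Inl p" "a = None" "s' = Inr q"
      unfolding E_def by (elim UnE imageE) (auto split: prod.splits)
    then show ?case
    proof cases
      case left
      with path_Cons(2) obtain x' where x': "x = map Some x'" "x' \<in> L'" by auto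
      from IH left(5) obtain x1 l y us' vs z z' L1 where
        "w = map Some x1 @ l @ rev (map Some y)" "us = map Some us' @ [None] @ rev (map Some vs)"
        "path D q x1 us' z" "path D p' y vs z'" "(z, L1, z') \<in> Z" "l \<in> L1" by blast
      moreover from this have "path D p (x' @ x1) (b # us') z"
        using left(1) x'(2) by (blast intro: path.path_Cons)
      moreover have "x @ w = map Some (x' @ x1) @ l @ rev (map Some y)"
        "a # us = map Some (b # us') @ [None] @ rev (map Some vs)" using calculation x' left by simp_all
      ultimately show ?thesis using left(2) by blast
    next
      case right
      with path_Cons(2) obtain x' where x': "x = rev (map Some x')" "x' \<in> L'" by auto
      from IH right(5) obtain y vs where y:
        "w = rev (map Some y)" "us = rev (map Some vs)" "path D p' y vs p" by blast
      have "x @ w = rev (map Some (y @ x'))" "a # us = rev (map Some (vs @ [b]))" using y x' right by simp_all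
      moreover have "path D p' (y @ x') (vs @ [b]) q"
        using path_snoc[OF y(3) right(1) x'(2)] .
      ultimately show ?thesis using right(2) by blast
    next
      case center
      from IH center(4) obtain y vs where
        "w = rev (map Some y)" "us = rev (map Some vs)" "path D p' y vs q" by blast
      then have "x @ w = map Some [] @ x @ rev (map Some y) \<and>
        a # us = map Some [] @ [None] @ rev (map Some vs) \<and> path D p [] [] p \<and> path D p' y vs q \<and> (p, L, q) \<in> Z \<and> x \<in> L"
        using center path_Cons(2) by (auto intro: path.intros)
      then show ?thesis using center(2) by blast
    qed
  qed
  define G where "G x l y \<longleftrightarrow> (\<exists>us vs z z' L.
    path D p x us z \<and> path D p' y vs z' \<and> (z, L, z') \<in> Z \<and> l \<in> L \<and>
    map Some us @ [None] @ rev (map Some vs) \<in> K)" for x l y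
  have "(\<exists>x l y. w = map Some x @ l @ rev (map Some y) \<and> G x l y) \<longleftrightarrow> (\<exists>us \<in> K. path E (Inl p) w us (Inr p'))" for w
  proof
    assume "\<exists>x l y. w = map Some x @ l @ rev (map Some y) \<and> G x l y"
    then obtain x l y where w: "w = map Some x @ l @ rev (map Some y)" and "G x l y" by blast
    then obtain us vs z z' L where *: "path D p x us z" "path D p' y vs z'" "(z, L, z') \<in> Z" "l \<in> L"
      "map Some us @ [None] @ rev (map Some vs) \<in> K" unfolding G_def by blast
    have "path E (Inl p) w (map Some us @ [None] @ rev (map Some vs)) (Inr p')"
      unfolding w by (rule path_append[OF left[OF *(1)] path_append[OF path_single[OF EZ[OF *(3)] *(4)] right[OF *(2)]]])
    then show "\<exists>us \<in> K. path E (Inl p) w us (Inr p')" using *(5) by blast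
  next
    assume "\<exists>us \<in> K. path E (Inl p) w us (Inr p')"
    then obtain us where "us \<in> K" "path E (Inl p) w us (Inr p')" by blast
    moreover from sound[OF this(2)] obtain x l y us' vs z z' L where "w = map Some x @ l @ rev (map Some y)"
      "us = map Some us' @ [None] @ rev (map Some vs)" "path D p x us' z" "path D p' y vs z'"
      "(z, L, z') \<in> Z" "l \<in> L" by auto
    ultimately show "\<exists>x l y. w = map Some x @ l @ rev (map Some y) \<and> G x l y"
      unfolding G_def by blast
  qed
  then have "?T = {w. \<exists>us \<in> K. path E (Inl p) w us (Inr p')}"
    unfolding G_def by (rule Collect_cong)
  moreover have "context_free {w. \<exists>us \<in> K. path E (Inl p) w us (Inr p')}"
  proof (rule context_free_transduction[OF _ _ K])
    show "finite E" unfolding E_def using D(1) Z(1) by simp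
    show "context_free L" if "(s, L, a, t) \<in> E" for s L a t
      using that D(2) Z(2) unfolding E_def by (auto intro!: context_free_rev context_free_map)
  qed
  ultimately show ?thesis by simp
qed

section \<open>Languages of word pairs and change of generators\<close>

definition pair_lang :: "'x set \<Rightarrow> ('x list \<Rightarrow> 'x list \<Rightarrow> bool) \<Rightarrow> 'x option list set" where
  "pair_lang X R = {map Some u @ [None] @ rev (map Some v) | u v. u \<in> lists X \<and> v \<in> lists X \<and> R u v}"

lemma word_problem_eq_pair_lang:
  "word_problem G X = pair_lang X (\<lambda>u v. word_prod G u = word_prod G v)"
  by (simp add: word_problem_def pair_lang_def)

lemma map_Some_None_eq_iff:
  "map Some u @ None # v = map Some u' @ None # v' \<longleftrightarrow> u = u' \<and> v = v'"
proof (induction u arbitrary: u')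
  case Nil
  then show ?case by (cases u') auto
next
  case (Cons a u)
  then show ?case by (cases u') auto
qed

lemma pair_lang_iff:
  "map Some u @ [None] @ rev (map Some v) \<in> pair_lang X R \<longleftrightarrow> u \<in> lists X \<and> v \<in> lists X \<and> R u v"
  unfolding pair_lang_def by (auto simp: map_Some_None_eq_iff inj_map_eq_map)

text \<open>Closure under inverse homomorphisms, applied to both halves at once; this is how a word
  problem moves to another alphabet. Reading \<open>y\<close> has to emit a letter at once, whence
  the images under \<open>h\<close> are nonempty.\<close>

lemma context_free_pair_lang_hom:
  fixes h :: "'y \<Rightarrow> 'x list"
  assumes cf: "context_free (pair_lang X R)" and Y: "finite Y"
    and h: "\<And>y. y \<in> Y \<Longrightarrow> h y \<in> lists X" "\<And>y. y \<in> Y \<Longrightarrow> h y \<noteq> []"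
    and R: "\<And>u v. u \<in> lists Y \<Longrightarrow> v \<in> lists Y \<Longrightarrow> R' u v \<longleftrightarrow> R (concat (map h u)) (concat (map h v))"
  shows "context_free (pair_lang Y R')"
proof -
  \<comment> \<open>The states are the suffixes of words \<open>h y\<close> that still have to be
    emitted. A letter is read only in the state \<open>[]\<close>; the other states emit without
    reading.\<close>
  define T where "T = (\<Union>y \<in> Y. \<Union>k \<in> {..length (h y)}. {drop k (h y)})"
  define D :: "('x list \<times> 'y list set \<times> 'x \<times> 'x list) set" where
    "D = (\<lambda>y. ([], {[y]}, hd (h y), tl (h y))) ` Y \<union> (\<lambda>s. (s, {[]}, hd s, tl s)) ` (T - {[]})"
  have "finite T" unfolding T_def using Y by simp
  then have finD: "finite D" unfolding D_def using Y by simp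
  have T: "drop k (h y) \<in> T" if "y \<in> Y" for y k
  proof (cases "k \<le> length (h y)")
    case False
    then have "drop k (h y) = drop (length (h y)) (h y)" by simp
    then show ?thesis using that unfolding T_def by blast
  qed (use that in \<open>auto simp: T_def\<close>)
  have drain: "path D (drop k (h y)) [] (drop k (h y)) []" if "y \<in> Y" for y k
  proof (induction "length (h y) - k" arbitrary: k)
    case (Suc n)
    then obtain a where a: "drop k (h y) = a # drop (Suc k) (h y)" by (metis Cons_nth_drop_Suc Suc_neq_Zero diff_is_0_eq' not_less)
    have "path D (drop (Suc k) (h y)) [] (drop (Suc k) (h y)) []" using Suc by simp
    moreover have "drop k (h y) \<in> T - {[]}" using T[OF that, of k] a by simp
    then have "(drop k (h y), {[]}, hd (drop k (h y)), tl (drop k (h y))) \<in> D" unfolding D_def by blast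
    then have "(drop k (h y), {[]}, a, drop (Suc k) (h y)) \<in> D" using a by simp
    ultimately show ?case using path_step[of "drop k (h y)" "[]"] a by fastforce
  qed (auto intro: path.intros)
  have complete: "path D [] u (concat (map h u)) []" if "u \<in> lists Y" for u
    using that
  proof induction
    case (Cons y u)
    from h(2)[OF Cons(1)] obtain a s where a: "h y = a # s" by (cases "h y") auto
    then have "([], {[y]}, a, s) \<in> D" using Cons(1) unfolding D_def by force
    then have "path D [] [y] [a] s" by (rule path_single) simp
    moreover have "path D s [] s []" using drain[OF Cons(1), of 1] a by simp
    ultimately have "path D [] ([y] @ [] @ u) ([a] @ s @ concat (map h u)) []"
      using Cons(3) by (blast intro: path_append)
    then show ?case using a by simp
  qed (auto intro: path.intros)
  have sound: "u \<in> lists Y \<and> us = s @ concat (map h u)" if "path D s u us t" "t = []" for s u us t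
    using that
  proof induction
    case (path_Cons s L a s' x w us t)
    then show ?case using h(2) unfolding D_def by auto
  qed simp
  have iff: "path D [] u us [] \<longleftrightarrow> u \<in> lists Y \<and> us = concat (map h u)" for u us
    using complete sound by fastforce
  have hX: "concat (map h u) \<in> lists X" if "u \<in> lists Y" for u
    using that h(1) by (induction u) auto
  have *: "context_free {map Some x @ l @ rev (map Some y) | x l y. \<exists>us vs z z' L.
      path D [] x us z \<and> path D [] y vs z' \<and> (z, L, z') \<in> {([], {[None]}, [])} \<and> l \<in> L \<and>
      map Some us @ [None] @ rev (map Some vs) \<in> pair_lang X R}"
    using finD cf by (intro context_free_pair_transduction) (auto simp: D_def intro: context_free_singleton)
  have **: "(\<exists>us vs z z' L.
      path D [] x us z \<and> path D [] y vs z' \<and> (z, L, z') \<in> {([], {[None]}, [])} \<and> l \<in> L \<and>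
      map Some us @ [None] @ rev (map Some vs) \<in> pair_lang X R) \<longleftrightarrow>
      l = [None] \<and> x \<in> lists Y \<and> y \<in> lists Y \<and> R' x y" for x l y
    unfolding pair_lang_iff using R[of x y] hX[of x] hX[of y] by (auto simp: iff simp del: in_lists_conv_set)
  have "pair_lang Y R' = {map Some x @ l @ rev (map Some y) | x l y.
      l = [None] \<and> x \<in> lists Y \<and> y \<in> lists Y \<and> R' x y}"
    by (auto simp: pair_lang_def)
  then show ?thesis using *[unfolded **] by simp
qed

text \<open>Each letter \<open>a\<close> is replaced by the language of words with one
  \<open>a\<close> and copies of \<open>e\<close> around it. Every inserted \<open>e\<close> needs a
  letter of the original word to attach to, so the empty word is excluded from
  \<open>K\<close>.\<close>

lemma context_free_insert_neutral:
  assumes K: "context_free K" and \<Sigma>: "finite \<Sigma>" "K \<subseteq> lists \<Sigma>" "e \<notin> \<Sigma>" and ne: "[] \<notin> K"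
  shows "context_free {w. filter (\<lambda>a. a \<noteq> e) w \<in> K}"
proof -
  define L where "L a = {w. filter (\<lambda>a. a \<noteq> e) w = [a]}" for a
  have cfL: "context_free (L a)" if "a \<in> \<Sigma>" for a
  proof -
    let ?P = "{((), [Inr {[a]}]), ((), [Inr {[e]}, Inl ()]), ((), [Inl (), Inr {[e]}])}"
    have "a \<noteq> e" using that \<Sigma>(3) by blast
    have "lderives ?P [Inl ()] w \<longleftrightarrow> w \<in> L a" for w
    proof
      assume "lderives ?P [Inl ()] w"
      then have "w \<in> sem (\<lambda>_. L a) [Inl ()]"
        by (rule lderives_sound) (use \<open>a \<noteq> e\<close> in \<open>auto simp: L_def conc_def\<close>)
      then show "w \<in> L a" by (auto simp: conc_def)
    next
      have trail: "lderives ?P [Inl ()] (a # w)" if "filter (\<lambda>a. a \<noteq> e) w = []" for w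
        using that
      proof (induction w rule: rev_induct)
        case Nil
        have "lderives ?P [Inr {[a]}] ([a] @ [])" by (intro lderives.intros) simp
        then show ?case by (auto intro: lderives_single)
      next
        case (snoc x w)
        then have "x = e" by (auto split: if_splits)
        have "lderives ?P [Inl ()] (a # w)" using snoc by (auto split: if_splits)
        moreover have "lderives ?P [Inr {[e]}] ([e] @ [])" by (intro lderives.intros) simp
        ultimately have "lderives ?P [Inl (), Inr {[e]}] ((a # w) @ [e])" using lderives_Cons by fastforce
        then show ?case using \<open>x = e\<close> by (auto intro: lderives_single)
      qed
      assume "w \<in> L a"
      then show "lderives ?P [Inl ()] w"
      proof (induction w)
        case (Cons x w)
        show ?case
        proof (cases "x = e")
          case True
          then have "lderives ?P [Inl ()] w" using Cons by (simp add: L_def)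
          then have "lderives ?P [Inr {[e]}, Inl ()] ([e] @ w)" by (intro lderives_Inr) simp
          then show ?thesis using True by (auto intro: lderives_single)
        next
          case False
          then show ?thesis using Cons.prems trail by (auto simp: L_def)
        qed
      qed (simp add: L_def)
    qed
    moreover have "context_free {w. lderives ?P [Inl ()] w}"
      by (rule lderives_context_free) (auto intro: context_free_singleton)
    ultimately show ?thesis by simp
  qed
  define E where "E = (\<lambda>a. ((), L a, a, ())) ` \<Sigma>"
  have EI: "path E () w [a] ()" if "w \<in> L a" "a \<in> \<Sigma>" for w a
    using that by (intro path_single[of _ "L a"]) (auto simp: E_def)
  have sound: "path E p w us q \<Longrightarrow> filter (\<lambda>a. a \<noteq> e) w = us" for p w us q
    by (induction rule: path.induct) (auto simp: E_def L_def)
  \<comment> \<open>Copies of \<open>e\<close> at the front are absorbed by the first letter read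
    after them, copies at the end by the last letter before them. A word of copies of
    \<open>e\<close> alone has no path, hence the condition \<open>us \<noteq> []\<close>.\<close>
  have complete: "us \<noteq> [] \<longrightarrow> path E () w us ()"
    if "filter (\<lambda>a. a \<noteq> e) w = us" "us \<in> lists \<Sigma>" for w us
    using that
  proof (induction w arbitrary: us)
    case (Cons x w)
    show ?case
    proof (cases "x = e")
      case True
      show ?thesis
      proof
        assume "us \<noteq> []"
        with Cons True have "path E () w us ()" by simp
        then show "path E () (x # w) us ()"
        proof cases
          case (path_Cons L' a q y v vs)
          then have "a \<in> \<Sigma>" "y \<in> L a" by (auto simp: E_def)
          then have "path E () (x # y) [a] ()" using True by (intro EI) (auto simp: L_def)
          then have "path E () ((x # y) @ v) ([a] @ vs) ()"
            using path_Cons by (intro path_append) auto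
          then show ?thesis using path_Cons by simp
        qed (use \<open>us \<noteq> []\<close> in simp)
      qed
    next
      case False
      then have us: "us = x # filter (\<lambda>a. a \<noteq> e) w" "x \<in> \<Sigma>" using Cons.prems by auto
      show ?thesis
      proof (cases "filter (\<lambda>a. a \<noteq> e) w = []")
        case True
        then have "path E () (x # w) [x] ()" using us False by (intro EI) (auto simp: L_def)
        then show ?thesis using us True by simp
      next
        case nonempty: False
        then have "path E () w (filter (\<lambda>a. a \<noteq> e) w) ()" using Cons us by auto
        moreover have "path E () [x] [x] ()" using us False by (intro EI) (auto simp: L_def)
        ultimately show ?thesis using us path_append[of E "()" "[x]" "[x]"] by fastforce
      qed
    qed
  qed simp
  have "filter (\<lambda>a. a \<noteq> e) w \<in> K \<longleftrightarrow> (\<exists>us \<in> K. path E () w us ())" for w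
  proof
    assume "filter (\<lambda>a. a \<noteq> e) w \<in> K"
    moreover from this have "path E () w (filter (\<lambda>a. a \<noteq> e) w) ()"
      using complete[of w] \<Sigma>(2) ne by force
    ultimately show "\<exists>us \<in> K. path E () w us ()" by blast
  qed (auto dest: sound)
  then have "{w. filter (\<lambda>a. a \<noteq> e) w \<in> K} = {w. \<exists>us \<in> K. path E () w us ()}" by simp
  moreover have "context_free {w. \<exists>us \<in> K. path E () w us ()}"
    using K \<Sigma>(1) cfL by (intro context_free_transduction) (auto simp: E_def)
  ultimately show ?thesis by simp
qed

section \<open>Normal forms in the Bruck--Reilly extension\<close>

locale bruck_reilly = monoid M for M :: "('a, 'b) monoid_scheme" (structure) +
  fixes \<phi> :: "'a \<Rightarrow> 'a"
  assumes hom: "\<phi> \<in> hom M M" and phi_one [simp]: "\<phi> \<one> = \<one>"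
begin

lemma phi_closed [simp]: "x \<in> carrier M \<Longrightarrow> \<phi> x \<in> carrier M"
  using hom by (auto simp: hom_def)

lemma phi_mult [simp]: "x \<in> carrier M \<Longrightarrow> y \<in> carrier M \<Longrightarrow> \<phi> (x \<otimes> y) = \<phi> x \<otimes> \<phi> y"
  using hom by (auto simp: hom_def)

lemma phi_pow_closed [simp]: "x \<in> carrier M \<Longrightarrow> (\<phi> ^^ k) x \<in> carrier M"
  by (induction k) auto

lemma phi_pow_mult [simp]:
  "x \<in> carrier M \<Longrightarrow> y \<in> carrier M \<Longrightarrow> (\<phi> ^^ k) (x \<otimes> y) = (\<phi> ^^ k) x \<otimes> (\<phi> ^^ k) y"
  by (induction k) auto

lemma phi_pow_one [simp]: "(\<phi> ^^ k) \<one> = \<one>"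
  by (induction k) auto

lemma phi_pow_add: "(\<phi> ^^ k) ((\<phi> ^^ l) x) = (\<phi> ^^ (k + l)) x"
  by (simp add: funpow_add)

lemma word_prod_Nil [simp]: "word_prod M [] = \<one>"
  and word_prod_Cons [simp]: "word_prod M (x # w) = x \<otimes> word_prod M w"
  by (simp_all add: word_prod_def)

lemma word_prod_closed [simp]: "w \<in> lists (carrier M) \<Longrightarrow> word_prod M w \<in> carrier M"
  by (induction w) auto

lemma word_prod_append:
  "u \<in> lists (carrier M) \<Longrightarrow> v \<in> lists (carrier M) \<Longrightarrow> word_prod M (u @ v) = word_prod M u \<otimes> word_prod M v"
  by (induction u) (auto simp: m_assoc)

text \<open>The triple \<open>(i, m, j)\<close> stands for the element \<open>c\<^sup>i m b\<^sup>j\<close>.\<close>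

fun act :: "'a brgen \<Rightarrow> nat \<times> 'a \<times> nat \<Rightarrow> nat \<times> 'a \<times> nat" where
  "act (Gen a) (i, m, j) = (i, (\<phi> ^^ i) a \<otimes> m, j)"
| "act C (i, m, j) = (Suc i, m, j)"
| "act B (0, m, j) = (0, \<phi> m, Suc j)"
| "act B (Suc i, m, j) = (i, m, j)"

text \<open>The letters act as left multiplications on normal forms, starting from the identity.
  This evaluates a word without passing to the quotient, and it is the invariant that tells classes
  apart.\<close>

definition val :: "'a brgen list \<Rightarrow> nat \<times> 'a \<times> nat" where
  "val w = foldr act w (0, \<one>, 0)"

lemma val_Nil [simp]: "val [] = (0, \<one>, 0)"
  and val_Cons [simp]: "val (g # w) = act g (val w)"
  by (simp_all add: val_def)

text \<open>In c^i m b^j c^k n b^l the middle b's and c's cancel. The remaining c's move left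
  through m, or the remaining b's move right through n, applying \<phi> once per letter.\<close>

fun tmult :: "nat \<times> 'a \<times> nat \<Rightarrow> nat \<times> 'a \<times> nat \<Rightarrow> nat \<times> 'a \<times> nat" where
  "tmult (i, m, j) (k, n, l) =
    (if j \<le> k then (i + (k - j), (\<phi> ^^ (k - j)) m \<otimes> n, l)
     else (i, m \<otimes> (\<phi> ^^ (j - k)) n, l + (j - k)))"

abbreviation gens :: "'a set \<Rightarrow> 'a brgen set" where
  "gens X \<equiv> Gen ` X \<union> {B, C}"

lemma val_closed: "w \<in> lists (gens (carrier M)) \<Longrightarrow> fst (snd (val w)) \<in> carrier M"
proof (induction w)
  case (Cons g w)
  obtain i m j where "val w = (i, m, j)" by (cases "val w")
  with Cons show ?case by (cases i) auto
qed simp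

lemma val_closed': "w \<in> lists (gens (carrier M)) \<Longrightarrow> val w = (i, m, j) \<Longrightarrow> m \<in> carrier M"
  using val_closed[of w] by simp

text \<open>Associativity for a left factor that is a single generator, which is all that the
  induction for \<open>val_append\<close> needs.\<close>

lemma act_tmult:
  assumes "g \<in> gens (carrier M)" "m \<in> carrier M" "n \<in> carrier M"
  shows "act g (tmult (i, m, j) (k, n, l)) = tmult (act g (i, m, j)) (k, n, l)"
proof (cases g)
  case (Gen a)
  then have "a \<in> carrier M" using assms by auto
  then show ?thesis using assms Gen by (auto simp: phi_pow_add m_assoc add.commute)
next
  case B
  show ?thesis
  proof (cases i)
    case 0
    consider "j < k" | "j = k" | "j > k" by linarith
    then show ?thesis
    proof cases
      case 1
      then obtain d where "k = Suc (j + d)" using less_imp_Suc_add by blast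
      then show ?thesis using B 0 by (simp add: funpow_swap1 Suc_diff_le)
    next
      case 3
      then obtain d where "j = Suc (k + d)" using less_imp_Suc_add by blast
      then show ?thesis using B 0 assms by (simp add: Suc_diff_le)
    qed (use B 0 assms in simp)
  qed (use B in simp)
qed simp

lemma val_append:
  assumes "u \<in> lists (gens (carrier M))" "v \<in> lists (gens (carrier M))"
  shows "val (u @ v) = tmult (val u) (val v)"
  using assms(1)
proof induction
  case Nil
  show ?case using val_closed[OF assms(2)] by (cases "val v") simp
next
  case (Cons g u)
  then show ?case using act_tmult[OF Cons(1)] val_closed[OF Cons(2)] val_closed[OF assms(2)]
    by (cases "val u"; cases "val v") (simp del: tmult.simps)
qed

lemma val_Gen [simp]: "val (map Gen u) = (0, word_prod M u, 0)"
  by (induction u) simp_all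

lemma val_replicate_C: "val (replicate k C @ w) = (\<lambda>(i, m, j). (k + i, m, j)) (val w)"
  by (induction k) (auto split: prod.splits)

lemma val_replicate_B [simp]: "val (replicate k B) = (0, \<one>, k)"
  by (induction k) auto

lemma val_Gen_replicate_B:
  "u \<in> lists (carrier M) \<Longrightarrow> val (map Gen u @ replicate j B) = (0, word_prod M u, j)"
  by (induction u) simp_all

lemma val_normal_form:
  "u \<in> lists (carrier M) \<Longrightarrow> val (replicate i C @ map Gen u @ replicate j B) = (i, word_prod M u, j)"
  using val_Gen_replicate_B by (simp add: val_replicate_C)

abbreviation "R \<equiv> br_rels M \<phi>"

lemma br_rels_base:
  "u \<in> lists (carrier M) \<Longrightarrow> v \<in> lists (carrier M) \<Longrightarrow> word_prod M u = word_prod M v \<Longrightarrow>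
    (map Gen u, map Gen v) \<in> R"
  unfolding br_rels_def by blast

lemma br_rels_sound:
  assumes "(u, v) \<in> R"
  shows "u \<in> lists (gens (carrier M)) \<and> v \<in> lists (gens (carrier M)) \<and> val u = val v"
  using assms unfolding br_rels_def by (auto simp: r_one l_one)

text \<open>\<open>pres_cong\<close> also relates words with letters \<open>Gen a\<close> outside
  the carrier. That both words or neither are over the right alphabet is therefore carried along;
  \<open>val_append\<close> in the context case depends on it.\<close>

lemma pres_cong_sound:
  assumes "pres_cong R u v"
  shows "(u \<in> lists (gens (carrier M)) \<longleftrightarrow> v \<in> lists (gens (carrier M))) \<and>
    (u \<in> lists (gens (carrier M)) \<longrightarrow> val u = val v)"
  using assms
proof induction
  case (ctxt u v x y)
  then show ?case by (auto simp: val_append simp del: in_lists_conv_set)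
qed (use br_rels_sound in auto)

lemma pres_cong_Cons: "pres_cong R u v \<Longrightarrow> pres_cong R (g # u) (g # v)"
  using pres_cong.ctxt[of R u v "[g]" "[]"] by simp

lemma pres_cong_append: "pres_cong R u v \<Longrightarrow> pres_cong R u' v' \<Longrightarrow> pres_cong R (u @ u') (v @ v')"
  using pres_cong.ctxt[of R u v "[]" u'] pres_cong.ctxt[of R u' v' v "[]"] by (auto intro: pres_cong.trans)

lemma pres_cong_Gen_C:
  assumes "a \<in> carrier M"
  shows "pres_cong R (Gen a # replicate i C) (replicate i C @ [Gen ((\<phi> ^^ i) a)])"
  using assms
proof (induction i arbitrary: a)
  case (Suc i)
  have "([Gen a, C], [C, Gen (\<phi> a)]) \<in> R" using Suc.prems by (auto simp: br_rels_def)
  then have "pres_cong R (Gen a # replicate (Suc i) C) (C # Gen (\<phi> a) # replicate i C)"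
    using pres_cong_append[OF pres_cong.base pres_cong.refl[of R "replicate i C"]] by fastforce
  also have "pres_cong R (C # Gen (\<phi> a) # replicate i C) (replicate (Suc i) C @ [Gen ((\<phi> ^^ Suc i) a)])"
    using pres_cong_Cons[OF Suc.IH[of "\<phi> a"]] Suc.prems by (simp add: funpow_swap1)
  finally (pres_cong.trans) show ?case .
qed (simp add: pres_cong.refl)

lemma pres_cong_normal_form:
  assumes "w \<in> lists (gens (carrier M))" "val w = (i, m, j)"
  shows "pres_cong R w (replicate i C @ Gen m # replicate j B)"
  using assms
proof (induction w arbitrary: i m j rule: list.induct)
  case Nil
  have "(map Gen [], map Gen [\<one>]) \<in> R" by (rule br_rels_base) auto
  then show ?case using Nil by (auto intro: pres_cong.base)
next
  case (Cons g w)
  obtain i' m' j' where v: "val w = (i', m', j')" by (cases "val w")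
  have w: "w \<in> lists (gens (carrier M))" and g: "g \<in> gens (carrier M)"
    using Cons.prems(1) by (simp_all only: Cons_in_lists_iff)
  have m': "m' \<in> carrier M" using val_closed'[OF w v] .
  have IH: "pres_cong R (g # w) (g # replicate i' C @ Gen m' # replicate j' B)"
    using pres_cong_Cons[OF Cons.IH[OF w v]] .
  show ?case
  proof (cases g)
    case (Gen a)
    then have a: "a \<in> carrier M" using g by auto
    let ?a = "(\<phi> ^^ i') a"
    have "(map Gen [?a, m'], map Gen [?a \<otimes> m']) \<in> R"
      by (rule br_rels_base) (use a m' in auto)
    then have 1: "pres_cong R ([Gen ?a, Gen m'] @ replicate j' B) ([Gen (?a \<otimes> m')] @ replicate j' B)"
      using pres_cong_append[OF pres_cong.base pres_cong.refl] by fastforce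
    note IH
    also have "pres_cong R (g # replicate i' C @ Gen m' # replicate j' B)
        ((replicate i' C @ [Gen ?a]) @ Gen m' # replicate j' B)"
      using pres_cong_append[OF pres_cong_Gen_C[OF a, of i'] pres_cong.refl] Gen by simp
    also (pres_cong.trans) have "pres_cong R ((replicate i' C @ [Gen ?a]) @ Gen m' # replicate j' B)
        (replicate i' C @ Gen (?a \<otimes> m') # replicate j' B)"
      using pres_cong_append[OF pres_cong.refl[of R "replicate i' C"] 1] by simp
    finally (pres_cong.trans) show ?thesis using Cons.prems v Gen by auto
  next
    case B
    show ?thesis
    proof (cases i')
      case 0
      have "([B, Gen m'], [Gen (\<phi> m'), B]) \<in> R" using m' by (auto simp: br_rels_def)
      then have "pres_cong R ([B, Gen m'] @ replicate j' B) ([Gen (\<phi> m'), B] @ replicate j' B)"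
        by (intro pres_cong_append pres_cong.base pres_cong.refl)
      then show ?thesis using IH Cons.prems v B 0 by (auto intro: pres_cong.trans)
    next
      case (Suc k)
      have "([B, C], []) \<in> R" by (auto simp: br_rels_def)
      then have "pres_cong R ([B, C] @ replicate k C @ Gen m' # replicate j' B) ([] @ replicate k C @ Gen m' # replicate j' B)"
        by (intro pres_cong_append pres_cong.base pres_cong.refl)
      then show ?thesis using IH Cons.prems v B Suc by (auto intro: pres_cong.trans)
    qed
  next
    case C
    then show ?thesis using IH Cons.prems v by auto
  qed
qed

text \<open>The relations bring every word to the normal form prescribed by its \<open>val\<close>,
  and \<open>val\<close> is invariant under the relations. So normal forms exist and are
  unique.\<close>

lemma pres_cong_iff_val:
  assumes "u \<in> lists (gens (carrier M))" "v \<in> lists (gens (carrier M))"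
  shows "pres_cong R u v \<longleftrightarrow> val u = val v"
proof
  assume "val u = val v"
  obtain i m j where v: "val v = (i, m, j)" by (cases "val v")
  with \<open>val u = val v\<close> have u: "val u = (i, m, j)" by simp
  show "pres_cong R u v"
    by (rule pres_cong.trans[OF pres_cong_normal_form[OF assms(1) u]
        pres_cong.sym[OF pres_cong_normal_form[OF assms(2) v]]])
qed (use pres_cong_sound assms in blast)

section \<open>The word problem of the extension in terms of normal forms\<close>

abbreviation "cls \<equiv> pres_class R"

lemma cls_eq_iff: "cls u = cls v \<longleftrightarrow> pres_cong R u v"
  unfolding pres_class_def by (auto intro: pres_cong.intros)

lemma cls_eq_iff_val:
  "u \<in> lists (gens (carrier M)) \<Longrightarrow> v \<in> lists (gens (carrier M)) \<Longrightarrow> cls u = cls v \<longleftrightarrow> val u = val v"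
  using cls_eq_iff pres_cong_iff_val by simp

text \<open>This is the choice built into the multiplication of \<open>presented_monoid\<close>.
  Naming it turns a product in the extension into the class of the concatenated
  representatives.\<close>

definition rep :: "'a brgen list set \<Rightarrow> 'a brgen list" where
  "rep x = (SOME w. w \<in> x)"

lemma rep_cls: "pres_cong R (rep (cls w)) w"
proof -
  have "w \<in> cls w" by (simp add: pres_class_def pres_cong.refl)
  then have "rep (cls w) \<in> cls w" unfolding rep_def by (rule someI)
  then show ?thesis by (auto simp: pres_class_def intro: pres_cong.sym)
qed

lemma carrier_BR: "carrier (BR M \<phi>) = cls ` lists (gens (carrier M))"
  by (simp add: BR_def presented_monoid_def)

lemma rep_closed:
  assumes "x \<in> carrier (BR M \<phi>)"
  shows "rep x \<in> lists (gens (carrier M))" and "cls (rep x) = x"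
proof -
  obtain w where w: "w \<in> lists (gens (carrier M))" "x = cls w" using assms carrier_BR by blast
  then show "rep x \<in> lists (gens (carrier M))" using pres_cong_sound[OF rep_cls[of w]] by blast
  show "cls (rep x) = x" using w rep_cls by (simp add: cls_eq_iff)
qed

lemma word_prod_BR: "word_prod (BR M \<phi>) xs = cls (concat (map rep xs))"
proof (induction xs)
  case Nil
  then show ?case by (simp add: BR_def presented_monoid_def word_prod_def)
next
  case (Cons x xs)
  have "word_prod (BR M \<phi>) (x # xs) = cls (rep x @ rep (word_prod (BR M \<phi>) xs))"
    by (simp add: BR_def presented_monoid_def word_prod_def rep_def)
  also have "\<dots> = cls (rep x @ concat (map rep xs))"
    unfolding Cons.IH cls_eq_iff by (intro pres_cong_append pres_cong.refl rep_cls)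
  finally show ?case by simp
qed

lemma concat_rep_closed:
  "xs \<in> lists (carrier (BR M \<phi>)) \<Longrightarrow> concat (map rep xs) \<in> lists (gens (carrier M))"
  using rep_closed(1) by (induction xs) auto

lemma word_prod_BR_eq_iff:
  assumes "xs \<in> lists (carrier (BR M \<phi>))" "ys \<in> lists (carrier (BR M \<phi>))"
  shows "word_prod (BR M \<phi>) xs = word_prod (BR M \<phi>) ys \<longleftrightarrow>
    val (concat (map rep xs)) = val (concat (map rep ys))"
  unfolding word_prod_BR using assms by (intro cls_eq_iff_val concat_rep_closed)

lemma val_concat_cong:
  assumes "xs \<in> lists X" and "\<And>x. x \<in> X \<Longrightarrow> h x \<in> lists (gens (carrier M))"
    and "\<And>x. x \<in> X \<Longrightarrow> h' x \<in> lists (gens (carrier M))" and "\<And>x. x \<in> X \<Longrightarrow> val (h x) = val (h' x)"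
  shows "concat (map h xs) \<in> lists (gens (carrier M)) \<and> concat (map h' xs) \<in> lists (gens (carrier M))
    \<and> val (concat (map h xs)) = val (concat (map h' xs))"
  using assms(1)
  by induction (use assms in \<open>simp_all add: val_append del: in_lists_conv_set\<close>)

lemma gens_mono: "X \<subseteq> Y \<Longrightarrow> lists (gens X) \<subseteq> lists (gens Y)"
  by (intro lists_mono) auto

text \<open>The classes of the letters generate, since every value c^i m b^j is spelled by c's, a
  word over \<open>X\<close> and b's. Choosing a letter for each such class gives the homomorphism
  that carries the language of equal values over to the word problem.\<close>

lemma UCF_BR_if:
  assumes X: "finite X" "generates M X" and cf: "context_free (pair_lang (gens X) (\<lambda>u v. val u = val v))"
  shows "UCF (BR M \<phi>)"
proof -
  have XM: "X \<subseteq> carrier M" using X unfolding generates_def by blast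
  define Y where "Y = (\<lambda>g. cls [g]) ` gens X"
  have gM: "[g] \<in> lists (gens (carrier M))" if "g \<in> gens X" for g using that XM by auto
  have YBR: "Y \<subseteq> carrier (BR M \<phi>)" unfolding Y_def carrier_BR using gM by blast
  have words: "\<exists>xs \<in> lists Y. cls w = word_prod (BR M \<phi>) xs" if w: "w \<in> lists (gens (carrier M))" for w
  proof -
    obtain i m j where v: "val w = (i, m, j)" by (cases "val w")
    have "m \<in> carrier M" using val_closed'[OF w v] .
    then obtain u where u: "u \<in> lists X" "m = word_prod M u" using X by (auto simp: generates_def)
    define z where "z = replicate i C @ map Gen u @ replicate j B"
    have "set (replicate i C) \<subseteq> gens X" "set (replicate j B) \<subseteq> gens X" by auto
    then have z: "z \<in> lists (gens X)" unfolding z_def using u(1)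
      by (auto simp del: set_replicate_conv_if)
    have "u \<in> lists (carrier M)" using u(1) XM by auto
    then have vz: "val z = val w" unfolding z_def v u(2) by (rule val_normal_form)
    have zM: "z \<in> lists (gens (carrier M))" using z gens_mono[OF XM] by blast
    have *: "concat (map (\<lambda>g. rep (cls [g])) z) \<in> lists (gens (carrier M)) \<and> concat (map (\<lambda>g. [g]) z) \<in> lists (gens (carrier M))
      \<and> val (concat (map (\<lambda>g. rep (cls [g])) z)) = val (concat (map (\<lambda>g. [g]) z))"
    proof (rule val_concat_cong[OF z])
      fix g assume g: "g \<in> gens X"
      show "[g] \<in> lists (gens (carrier M))" by (rule gM[OF g])
      then show "rep (cls [g]) \<in> lists (gens (carrier M))" "val (rep (cls [g])) = val [g]"
        using pres_cong_sound[OF rep_cls[of "[g]"]] by blast+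
    qed
    have "concat (map (\<lambda>g. [g]) z) = z" by (induction z) auto
    then have "cls w = cls (concat (map rep (map (\<lambda>g. cls [g]) z)))"
      using * vz w zM by (subst cls_eq_iff_val) (simp_all add: comp_def del: in_lists_conv_set)
    then have "cls w = word_prod (BR M \<phi>) (map (\<lambda>g. cls [g]) z)" unfolding word_prod_BR .
    moreover have "map (\<lambda>g. cls [g]) z \<in> lists Y"
      using z unfolding Y_def lists_eq_set by (simp only: mem_Collect_eq set_map image_mono)
    ultimately show ?thesis by blast
  qed
  have closed: "word_prod (BR M \<phi>) xs \<in> carrier (BR M \<phi>)" if "xs \<in> lists Y" for xs
    unfolding word_prod_BR carrier_BR using concat_rep_closed that YBR lists_mono[OF YBR] by blast
  have "carrier (BR M \<phi>) \<subseteq> word_prod (BR M \<phi>) ` lists Y"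
    unfolding carrier_BR by (rule image_subsetI) (use words in blast)
  moreover have "word_prod (BR M \<phi>) ` lists Y \<subseteq> carrier (BR M \<phi>)"
    by (rule image_subsetI) (rule closed)
  ultimately have gen: "generates (BR M \<phi>) Y"
    unfolding generates_def using YBR by (intro conjI equalityI)
  define h where "h y = (SOME g. g \<in> gens X \<and> cls [g] = y)" for y
  have h: "h y \<in> gens X \<and> cls [h y] = y" if "y \<in> Y" for y
  proof -
    have "\<exists>g. g \<in> gens X \<and> cls [g] = y" using that unfolding Y_def by blast
    then show ?thesis unfolding h_def by (rule someI_ex)
  qed
  have "context_free (pair_lang Y (\<lambda>u v. word_prod (BR M \<phi>) u = word_prod (BR M \<phi>) v))"
  proof (rule context_free_pair_lang_hom[OF cf, of Y "\<lambda>y. [h y]"])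
    show "finite Y" using X unfolding Y_def by simp
    show "[h y] \<in> lists (gens X)" if "y \<in> Y" for y using h[OF that] by auto
    have *: "val (concat (map rep u)) = val (concat (map (\<lambda>y. [h y]) u))" if "u \<in> lists Y" for u
    proof -
      have "concat (map rep u) \<in> lists (gens (carrier M)) \<and> concat (map (\<lambda>y. [h y]) u) \<in> lists (gens (carrier M))
        \<and> val (concat (map rep u)) = val (concat (map (\<lambda>y. [h y]) u))"
      proof (rule val_concat_cong[OF that])
        fix y assume y: "y \<in> Y"
        show 1: "rep y \<in> lists (gens (carrier M))" using rep_closed y YBR by blast
        show 2: "[h y] \<in> lists (gens (carrier M))" using h[OF y] gM by blast
        have "cls (rep y) = cls [h y]" using rep_closed(2) h[OF y] y YBR by auto
        then show "val (rep y) = val [h y]" using cls_eq_iff_val[OF 1 2] by simp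
      qed
      then show ?thesis by blast
    qed
    show "(word_prod (BR M \<phi>) u = word_prod (BR M \<phi>) v) =
      (val (concat (map (\<lambda>y. [h y]) u)) = val (concat (map (\<lambda>y. [h y]) v)))"
      if "u \<in> lists Y" "v \<in> lists Y" for u v
    proof -
      have "u \<in> lists (carrier (BR M \<phi>))" "v \<in> lists (carrier (BR M \<phi>))"
        by (rule subsetD[OF lists_mono[OF YBR] that(1)], rule subsetD[OF lists_mono[OF YBR] that(2)])
      from word_prod_BR_eq_iff[OF this] show ?thesis unfolding *[OF that(1)] *[OF that(2)] .
    qed
  qed simp
  moreover have "finite Y" using X(1) by (simp add: Y_def)
  ultimately show ?thesis unfolding UCF_def word_problem_eq_pair_lang
    using gen by blast
qed

text \<open>\<open>X\<close> collects the elements of M that occur in representatives of the given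
  generators. It need not generate M, because b and c also produce images under \<phi>; therefore
  only words over \<open>gens X\<close> with value m are obtained.\<close>

lemma UCF_BR_D:
  assumes "UCF (BR M \<phi>)"
  obtains X where "finite X" "X \<subseteq> carrier M"
    "\<And>m. m \<in> carrier M \<Longrightarrow> \<exists>w \<in> lists (gens X). val w = (0, m, 0)"
    "context_free (pair_lang (gens X) (\<lambda>u v. val u = val v))"
proof -
  from assms obtain Y where Y: "finite Y" "generates (BR M \<phi>) Y"
    "context_free (pair_lang Y (\<lambda>u v. word_prod (BR M \<phi>) u = word_prod (BR M \<phi>) v))"
    unfolding UCF_def word_problem_eq_pair_lang by blast
  have YBR: "Y \<subseteq> carrier (BR M \<phi>)" and Ygen: "carrier (BR M \<phi>) = word_prod (BR M \<phi>) ` lists Y"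
    using Y(2) unfolding generates_def by blast+
  have repY: "concat (map rep u) \<in> lists (gens (carrier M))" if "u \<in> lists Y" for u
    using concat_rep_closed that lists_mono[OF YBR] by blast
  define X where "X = (\<Union>y \<in> Y. Gen -` set (rep y))"
  have "finite X" unfolding X_def using Y(1) by (auto intro!: finite_vimageI simp: inj_def)
  moreover have XM: "X \<subseteq> carrier M" unfolding X_def using rep_closed(1) YBR by fastforce
  have repX: "rep y \<in> lists (gens X)" if "y \<in> Y" for y
  proof -
    have "g \<in> gens X" if "g \<in> set (rep y)" for g
    proof (cases g)
      case (Gen a)
      then have "a \<in> X" using that \<open>y \<in> Y\<close> by (auto simp: X_def)
      then show ?thesis using Gen by simp
    qed simp_all
    then show ?thesis by blast
  qed
  have word: "\<exists>u \<in> lists Y. val (concat (map rep u)) = val w" if "w \<in> lists (gens (carrier M))" for w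
  proof -
    have "cls w \<in> word_prod (BR M \<phi>) ` lists Y" using that Ygen carrier_BR by blast
    then show ?thesis using word_prod_BR cls_eq_iff_val[OF that repY] by fastforce
  qed
  moreover have "\<exists>w \<in> lists (gens X). val w = (0, m, 0)" if "m \<in> carrier M" for m
  proof -
    have "[Gen m] \<in> lists (gens (carrier M))" using that by simp
    with word obtain u where u: "u \<in> lists Y" "val (concat (map rep u)) = val [Gen m]" by blast
    moreover have "concat (map rep u) \<in> lists (gens X)" using u(1) repX by (induction u) auto
    ultimately show ?thesis using that by (intro bexI) auto
  qed
  moreover have "context_free (pair_lang (gens X) (\<lambda>u v. val u = val v))"
  proof -
    have "\<exists>u. u \<in> lists Y \<and> val (concat (map rep u)) = val [g] \<and> u \<noteq> []" if "g \<in> gens X" for g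
    proof -
      have "[g] \<in> lists (gens (carrier M))" using that XM by auto
      then obtain u where u: "u \<in> lists Y" "val (concat (map rep u)) = val [g]" using word by blast
      have "[B] \<in> lists (gens (carrier M))" by simp
      then obtain ub where ub: "ub \<in> lists Y" "val (concat (map rep ub)) = val [B]" using word by blast
      have "[C] \<in> lists (gens (carrier M))" by simp
      then obtain uc where uc: "uc \<in> lists Y" "val (concat (map rep uc)) = val [C]" using word by blast
      have "ub \<noteq> []" using ub(2) by auto
      \<comment> \<open>The word \<open>u\<close> may be empty, but the homomorphism needs nonempty
        images. Words for b and c are appended: bc = 1 keeps the value, and \<open>ub\<close> is
        nonempty because b is not the identity.\<close>
      have "val (concat (map rep (u @ ub @ uc))) = tmult (val [g]) (tmult (val [B]) (val [C]))"
        using u ub uc repY by (simp add: val_append del: in_lists_conv_set)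
      also have "\<dots> = val ([g] @ [B] @ [C])"
        using \<open>[g] \<in> lists (gens (carrier M))\<close> by (subst val_append; simp)+
      also have "\<dots> = val [g]" by simp
      finally show ?thesis using u ub uc \<open>ub \<noteq> []\<close> by (intro exI[of _ "u @ ub @ uc"]) auto
    qed
    then obtain h where h: "\<And>g. g \<in> gens X \<Longrightarrow> h g \<in> lists Y"
      "\<And>g. g \<in> gens X \<Longrightarrow> val (concat (map rep (h g))) = val [g]" "\<And>g. g \<in> gens X \<Longrightarrow> h g \<noteq> []"
      by metis
    show ?thesis
    proof (rule context_free_pair_lang_hom[OF Y(3), of _ h])
      show "finite (gens X)" using \<open>finite X\<close> by simp
      have *: "concat (map h u) \<in> lists Y \<and> val (concat (map rep (concat (map h u)))) = val u"
        if "u \<in> lists (gens X)" for u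
        using that
      proof induction
        case (Cons g u)
        from Cons(1) XM have "[g] \<in> lists (gens (carrier M))" by auto
        moreover from Cons(2) have "u \<in> lists (gens (carrier M))" using gens_mono[OF XM] by blast
        ultimately
have "val (g # u) = tmult (val [g]) (val u)" using val_append[of "[g]" u] by simp
        then show ?case using Cons h(1,2)[OF Cons(1)] repY
          by (simp add: val_append del: in_lists_conv_set val_Cons)
      qed simp
      show "(val u = val v) = (word_prod (BR M \<phi>) (concat (map h u)) = word_prod (BR M \<phi>) (concat (map h v)))"
        if "u \<in> lists (gens X)" "v \<in> lists (gens X)" for u v
      proof -
        have "concat (map h u) \<in> lists (carrier (BR M \<phi>))" "concat (map h v) \<in> lists (carrier (BR M \<phi>))"
          by (rule subsetD[OF lists_mono[OF YBR]], simp only: * that)+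
        from word_prod_BR_eq_iff[OF this] show ?thesis using *[OF that(1)] *[OF that(2)] by simp
      qed
    qed (use h in auto)
  qed
  ultimately show ?thesis using that XM by blast
qed

end

section \<open>Finiteness of the images\<close>

text \<open>Descending to the occurrence of \<open>a\<close> extends only one side of it per step, so the thresholds
  on the two sides cannot be crossed simultaneously.\<close>

lemma derives_center_split:
  assumes "derives P \<gamma> w" and "w = x @ a # y" and "p < length x" and "q \<le> length y"
    and "\<gamma> \<in> \<Gamma>" and tl: "\<And>Y \<gamma>. Y # \<gamma> \<in> \<Gamma> \<Longrightarrow> \<gamma> \<in> \<Gamma>"
    and hd: "\<And>Y \<gamma>. Y # \<gamma> \<in> \<Gamma> \<Longrightarrow> [Y] \<in> \<Gamma>" and rhs: "\<And>X rhs. (X, rhs) \<in> P \<Longrightarrow> rhs \<in> \<Gamma>"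
  shows "\<exists>\<gamma>' \<in> \<Gamma>. \<exists>x1 x2 y1 y2. derives P \<gamma>' (x2 @ a # y2) \<and> x = x1 @ x2 \<and> y = y2 @ y1 \<and>
    (\<forall>z. derives P \<gamma>' z \<longrightarrow> derives P \<gamma> (x1 @ z @ y1)) \<and> (p < length x2 \<longleftrightarrow> \<not> q \<le> length y2)"
  using assms(1-5)
proof (induction arbitrary: x y)
  case (derives_Inr \<gamma> w t)
  from derives_Inr.prems obtain x' where x: "x = t # x'" "w = x' @ a # y" by (cases x) auto
  have \<gamma>: "\<gamma> \<in> \<Gamma>" using derives_Inr.prems(4) tl by blast
  show ?case
  proof (cases "p < length x'")
    case True
    from derives_Inr.IH[OF x(2) this derives_Inr.prems(3) \<gamma>] obtain \<gamma>' x1 x2 y1 y2 where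
      *: "\<gamma>' \<in> \<Gamma>" "derives P \<gamma>' (x2 @ a # y2)" "x' = x1 @ x2" "y = y2 @ y1"
      "\<And>z. derives P \<gamma>' z \<Longrightarrow> derives P \<gamma> (x1 @ z @ y1)" "p < length x2 \<longleftrightarrow> \<not> q \<le> length y2" by blast
    have "derives P (Inr t # \<gamma>) ((t # x1) @ z @ y1)" if "derives P \<gamma>' z" for z
      using derives.derives_Inr[OF *(5)[OF that]] by simp
    moreover have "x = (t # x1) @ x2" using x * by simp
    ultimately show ?thesis using * by blast
  next
    \<comment> \<open>Removing \<open>t\<close> crosses the left threshold and leaves
      \<open>y\<close> unchanged, so the tail is the required node.\<close>
    case False
    have "derives P (Inr t # \<gamma>) ([t] @ z @ [])" if "derives P \<gamma> z" for z
      using derives.derives_Inr[OF that] by simp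
    moreover have "derives P \<gamma> (x' @ a # y)" using derives_Inr.hyps x by simp
    moreover have "x = [t] @ x'" "y = y @ []" using x by simp_all
    ultimately show ?thesis using False derives_Inr.prems(3) \<gamma> by blast
  qed
next
  case (derives_Inl X rhs u \<gamma> v)
  have \<gamma>: "\<gamma> \<in> \<Gamma>" "rhs \<in> \<Gamma>" "[Inl X] \<in> \<Gamma>"
    using derives_Inl.prems(4) derives_Inl.hyps(1) tl hd assms(8) by blast+
  from derives_Inl.prems(1) consider
      (right) x' where "x = u @ x'" "v = x' @ a # y" | (left) y' where "u = x @ a # y'" "y = y' @ v"
    by (auto simp: append_eq_append_conv2 append_eq_Cons_conv)
  then show ?case
  proof cases
    case right
    show ?thesis
    proof (cases "p < length x'")
      case True
      from derives_Inl.IH(2)[OF right(2) this derives_Inl.prems(3) \<gamma>(1)] obtain \<gamma>' x1 x2 y1 y2 where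
        *: "\<gamma>' \<in> \<Gamma>" "derives P \<gamma>' (x2 @ a # y2)" "x' = x1 @ x2" "y = y2 @ y1"
        "\<And>z. derives P \<gamma>' z \<Longrightarrow> derives P \<gamma> (x1 @ z @ y1)" "p < length x2 \<longleftrightarrow> \<not> q \<le> length y2" by blast
      have "derives P (Inl X # \<gamma>) ((u @ x1) @ z @ y1)" if "derives P \<gamma>' z" for z
        using derives.derives_Inl[OF derives_Inl.hyps(1,2) *(5)[OF that]] by simp
      moreover have "x = (u @ x1) @ x2" using right * by simp
      ultimately show ?thesis using * by blast
    next
      case False
      have "derives P (Inl X # \<gamma>) (u @ z @ [])" if "derives P \<gamma> z" for z
        using derives.derives_Inl[OF derives_Inl.hyps(1,2) that] by simp
      moreover have "derives P \<gamma> (x' @ a # y)" using derives_Inl.hyps right by simp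
      moreover have "y = y @ []" by simp
      ultimately show ?thesis using False derives_Inl.prems(3) \<gamma> right(1) by blast
    qed
  next
    case left
    show ?thesis
    proof (cases "q \<le> length y'")
      case True
      from derives_Inl.IH(1)[OF left(1) derives_Inl.prems(2) this \<gamma>(2)] obtain \<gamma>' x1 x2 y1 y2 where
        *: "\<gamma>' \<in> \<Gamma>" "derives P \<gamma>' (x2 @ a # y2)" "x = x1 @ x2" "y' = y2 @ y1"
        "\<And>z. derives P \<gamma>' z \<Longrightarrow> derives P rhs (x1 @ z @ y1)" "p < length x2 \<longleftrightarrow> \<not> q \<le> length y2" by blast
      have "derives P (Inl X # \<gamma>) (x1 @ z @ (y1 @ v))" if "derives P \<gamma>' z" for z
        using derives.derives_Inl[OF derives_Inl.hyps(1) *(5)[OF that] derives_Inl.hyps(3)] by simp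
      moreover have "y = y2 @ (y1 @ v)" using left * by simp
      ultimately show ?thesis using * by blast
    next
      \<comment> \<open>The right threshold is crossed between the whole form and its head. The head
        alone still covers all of \<open>x\<close>, so \<open>[Inl X]\<close> is the node; this is
        why single symbols belong to \<Gamma>.\<close>
      case False
      have "derives P (Inl X # \<gamma>) ([] @ z @ v)" if "derives P [Inl X] z" for z
        using derives_appendI[OF that derives_Inl.hyps(3)] by simp
      moreover have "derives P [Inl X] (x @ a # y')" using derives_Inl.hyps left by (auto intro: derives_single)
      moreover have "x = [] @ x" by simp
      ultimately show ?thesis using False derives_Inl.prems(2) \<gamma> left(2) by blast
    qed
  qed
qed simp

text \<open>An exchange principle: each pair is cut at a node on the way to the separator, and the
  node comes from a finite set. Two pairs cut at the same node can swap their inner parts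
  \<open>u2\<close>, \<open>v2\<close> without leaving \<open>L\<close>. The thresholds
  \<open>p\<close> and \<open>q\<close> decide where to cut.\<close>

lemma context_free_center_split:
  fixes L :: "'x option list set"
  assumes "context_free L"
  obtains \<Gamma> :: "(nat + 'x option) list set" and D where "finite \<Gamma>"
    "\<And>u v p q. map Some u @ [None] @ rev (map Some v) \<in> L \<Longrightarrow> p < length u \<Longrightarrow> q \<le> length v \<Longrightarrow>
      \<exists>\<gamma> \<in> \<Gamma>. \<exists>u1 u2 v1 v2. u = u1 @ u2 \<and> v = v1 @ v2 \<and> D \<gamma> u2 v2 \<and>
        (\<forall>u' v'. D \<gamma> u' v' \<longrightarrow> map Some (u1 @ u') @ [None] @ rev (map Some (v1 @ v')) \<in> L) \<and>
        (p < length u2 \<longleftrightarrow> \<not> q \<le> length v2)"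
proof -
  from assms obtain P :: "(nat \<times> (nat + 'x option) list) set" and S
    where P: "finite P" "L = {w. derives P [Inl S] w}"
    unfolding context_free_iff_derives by blast
  define rs where "rs = insert [Inl S] (snd ` P)"
  \<comment> \<open>Suffixes of right-hand sides and single symbols are all that a descent meets
    which drops either the first symbol or everything after it.\<close>
  define \<Gamma> where "\<Gamma> = (\<Union>r \<in> rs. (\<lambda>k. drop k r) ` {..length r} \<union> (\<lambda>Y. [Y]) ` set r)"
  have "finite \<Gamma>" unfolding \<Gamma>_def rs_def using P(1) by simp
  have suffix: "\<gamma> \<in> \<Gamma>" if "r \<in> rs" "r = \<delta> @ \<gamma>" for r \<delta> \<gamma>
    unfolding \<Gamma>_def using that by (intro UN_I[OF that(1)] UnI1 image_eqI[of _ _ "length \<delta>"]) auto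
  have single: "[Y] \<in> \<Gamma>" if "r \<in> rs" "Y \<in> set r" for r Y
    unfolding \<Gamma>_def using that by blast
  have \<Gamma>_cases: "(\<exists>r \<in> rs. \<exists>\<delta>. r = \<delta> @ \<gamma>) \<or> (\<exists>r \<in> rs. \<exists>Y \<in> set r. \<gamma> = [Y])" if "\<gamma> \<in> \<Gamma>" for \<gamma>
  proof -
    from that consider r k where "r \<in> rs" "\<gamma> = drop k r" | r Y where "r \<in> rs" "Y \<in> set r" "\<gamma> = [Y]"
      unfolding \<Gamma>_def by blast
    then show ?thesis by cases (metis append_take_drop_id, blast)
  qed
  have tl: "\<gamma> \<in> \<Gamma>" if "Y # \<gamma> \<in> \<Gamma>" for Y \<gamma>
    using \<Gamma>_cases[OF that]
  proof (elim disjE bexE exE)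
    fix r \<delta> assume "r \<in> rs" "r = \<delta> @ Y # \<gamma>"
    then show ?thesis using suffix[of r "\<delta> @ [Y]"] by simp
  next
    fix r Z assume "r \<in> rs" "Y # \<gamma> = [Z]"
    then show ?thesis using suffix[of r r] by simp
  qed
  have hd: "[Y] \<in> \<Gamma>" if "Y # \<gamma> \<in> \<Gamma>" for Y \<gamma>
    using \<Gamma>_cases[OF that]
  proof (elim disjE bexE exE)
    fix r \<delta> assume "r \<in> rs" "r = \<delta> @ Y # \<gamma>"
    then show ?thesis using single[of r Y] by simp
  next
    fix r Z assume "r \<in> rs" "Z \<in> set r" "Y # \<gamma> = [Z]"
    then show ?thesis using single[of r Z] by simp
  qed
  have rhs: "r \<in> \<Gamma>" if "(X, r) \<in> P" for X r
  proof -
    have "r \<in> rs" unfolding rs_def by (rule insertI2, rule image_eqI[OF _ that]) simp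
    then show ?thesis using suffix[of r "[]"] by simp
  qed
  have S: "[Inl S] \<in> \<Gamma>" using suffix[of "[Inl S]" "[]"] by (simp add: rs_def)
  let ?D = "\<lambda>\<gamma> u v. derives P \<gamma> (map Some u @ [None] @ rev (map Some v))"
  show thesis
  proof (rule that[OF \<open>finite \<Gamma>\<close>, where D = ?D])
    fix u v p q
    assume "map Some u @ [None] @ rev (map Some v) \<in> L" and pq: "p < length u" "q \<le> length v"
    then have "derives P [Inl S] (map Some u @ None # rev (map Some v))" using P(2) by simp
    then have "\<exists>\<gamma>' \<in> \<Gamma>. \<exists>x1 x2 y1 y2. derives P \<gamma>' (x2 @ None # y2) \<and> map Some u = x1 @ x2 \<and>
        rev (map Some v) = y2 @ y1 \<and> (\<forall>z. derives P \<gamma>' z \<longrightarrow> derives P [Inl S] (x1 @ z @ y1)) \<and>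
        (p < length x2 \<longleftrightarrow> \<not> q \<le> length y2)"
      by (rule derives_center_split[OF _ HOL.refl _ _ S]) (fact tl hd rhs | simp add: pq)+
    then obtain \<gamma> x1 x2 y1 y2 where *: "\<gamma> \<in> \<Gamma>" "derives P \<gamma> (x2 @ None # y2)" "map Some u = x1 @ x2"
      "rev (map Some v) = y2 @ y1" "\<And>z. derives P \<gamma> z \<Longrightarrow> derives P [Inl S] (x1 @ z @ y1)"
      "p < length x2 \<longleftrightarrow> \<not> q \<le> length y2" by blast
    from *(3) obtain u1 u2 where u: "u = u1 @ u2" "x1 = map Some u1" "x2 = map Some u2"
      by (auto simp: map_eq_append_conv)
    from *(4) have "map Some v = rev y1 @ rev y2" by (metis rev_append rev_rev_ident)
    then obtain v1 v2 where v: "v = v1 @ v2" "rev y1 = map Some v1" "rev y2 = map Some v2"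
      by (auto simp: map_eq_append_conv)
    then have y: "y1 = rev (map Some v1)" "y2 = rev (map Some v2)" by (metis rev_rev_ident)+
    have "map Some (u1 @ u') @ [None] @ rev (map Some (v1 @ v')) \<in> L" if "?D \<gamma> u' v'" for u' v'
      using *(5)[OF that] unfolding P(2) u y by simp
    moreover have "?D \<gamma> u2 v2" using *(2) unfolding u y by simp
    moreover have "p < length u2 \<longleftrightarrow> \<not> q \<le> length v2" using *(6) unfolding u y by simp
    ultimately show "\<exists>\<gamma> \<in> \<Gamma>. \<exists>u1 u2 v1 v2. u = u1 @ u2 \<and> v = v1 @ v2 \<and> ?D \<gamma> u2 v2 \<and>
        (\<forall>u' v'. ?D \<gamma> u' v' \<longrightarrow> map Some (u1 @ u') @ [None] @ rev (map Some (v1 @ v')) \<in> L) \<and>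
        (p < length u2 \<longleftrightarrow> \<not> q \<le> length v2)"
      using *(1) u(1) v(1) by blast
  qed
qed

lemma finite_image_factor:
  assumes "finite (k ` A)" "\<And>x y. x \<in> A \<Longrightarrow> y \<in> A \<Longrightarrow> k x = k y \<Longrightarrow> f x = f y"
  shows "finite (f ` A)"
proof -
  have "f x = f (inv_into A k (k x))" if "x \<in> A" for x
    using that by (intro assms(2)) (auto simp: inv_into_into f_inv_into_f)
  then have "f ` A \<subseteq> (\<lambda>y. f (inv_into A k y)) ` k ` A" by blast
  then show ?thesis using assms(1) finite_surj by blast
qed

context bruck_reilly
begin

lemma tmult_eq_zero_zero:
  "tmult (i, m, j) (k, n, l) = (0, p, 0) \<Longrightarrow> i = 0 \<and> j = k \<and> l = 0"
  by (auto split: if_splits)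

lemma finite_phi_pow_image:
  assumes X: "X \<subseteq> carrier M" and words: "\<And>m. m \<in> carrier M \<Longrightarrow> \<exists>w \<in> lists (gens X). val w = (0, m, 0)"
    and cf: "context_free (pair_lang (gens X) (\<lambda>u v. val u = val v))"
  shows "\<exists>n. finite ((\<phi> ^^ n) ` carrier M)"
proof (rule ccontr)
  assume inf: "\<nexists>n. finite ((\<phi> ^^ n) ` carrier M)"
  from words obtain W where W: "\<And>m. m \<in> carrier M \<Longrightarrow> W m \<in> lists (gens X)"
    "\<And>m. m \<in> carrier M \<Longrightarrow> val (W m) = (0, m, 0)" by metis
  \<comment> \<open>The identity is left out because it may be spelled by the empty word; for the
    other elements \<open>W m\<close> is nonempty, so \<open>U n m\<close> is strictly longer than
    n.\<close>
  have ne: "infinite ((\<phi> ^^ n) ` (carrier M - {\<one>}))" for n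
  proof
    assume "finite ((\<phi> ^^ n) ` (carrier M - {\<one>}))"
    moreover have "(\<phi> ^^ n) ` carrier M \<subseteq> insert ((\<phi> ^^ n) \<one>) ((\<phi> ^^ n) ` (carrier M - {\<one>}))" by blast
    ultimately show False using inf finite_subset by blast
  qed
  define U where "U n m = W m @ replicate n C" for n m
  define V where "V n m = replicate n C @ replicate n B @ W m @ replicate n C" for n m
  have repl: "replicate n C \<in> lists (gens X)" "replicate n B \<in> lists (gens X)" for n by auto
  have gensM: "lists (gens X) \<subseteq> lists (gens (carrier M))" by (rule gens_mono[OF X])
  have UV: "U n m \<in> lists (gens X)" "V n m \<in> lists (gens X)" if "m \<in> carrier M" for n m
    unfolding U_def V_def using W(1)[OF that] repl by (simp_all only: append_in_lists_conv)
  have replM: "replicate n C \<in> lists (gens (carrier M))" "replicate n B \<in> lists (gens (carrier M))" for n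
    by auto
  have WM: "W m \<in> lists (gens (carrier M))" if "m \<in> carrier M" for m
    using W(1)[OF that] gensM by blast
  have vC: "val (replicate n C) = (n, \<one>, 0)" for n using val_replicate_C[of n "[]"] by simp
  have vU: "val (U n m) = (n, (\<phi> ^^ n) m, 0)" if "m \<in> carrier M" for n m
    unfolding U_def val_append[OF WM[OF that] replM(1)] using W(2)[OF that] that by (simp add: vC)
  have vV: "val (V n m) = (n, (\<phi> ^^ n) m, 0)" if "m \<in> carrier M" for n m
  proof -
    have "val (replicate n B @ U n m) = tmult (0, \<one>, n) (n, (\<phi> ^^ n) m, 0)"
      using val_append[OF replM(2) subsetD[OF gensM UV(1)[OF that]]] vU[OF that] by simp
    then show ?thesis using that unfolding V_def U_def by (simp add: val_replicate_C)
  qed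
  obtain \<Gamma> :: "(nat + 'a brgen option) list set" and D where \<Gamma>: "finite \<Gamma>" and
    split: "\<And>u v p q. map Some u @ [None] @ rev (map Some v) \<in> pair_lang (gens X) (\<lambda>u v. val u = val v) \<Longrightarrow>
      p < length u \<Longrightarrow> q \<le> length v \<Longrightarrow>
      \<exists>\<gamma> \<in> \<Gamma>. \<exists>u1 u2 v1 v2. u = u1 @ u2 \<and> v = v1 @ v2 \<and> D \<gamma> u2 v2 \<and>
        (\<forall>u' v'. D \<gamma> u' v' \<longrightarrow> map Some (u1 @ u') @ [None] @ rev (map Some (v1 @ v'))
          \<in> pair_lang (gens X) (\<lambda>u v. val u = val v)) \<and>
        (p < length u2 \<longleftrightarrow> \<not> q \<le> length v2)"
    using context_free_center_split[OF cf] by metis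
  \<comment> \<open>The thresholds are n and \<open>length (W m) + n\<close>:
    \<open>n < length u2\<close> says that the inner part of \<open>U\<close> reaches into
    \<open>W m\<close>, and \<open>length (W m) + n \<le> length v2\<close> that the inner part of
    \<open>V\<close> contains all of its \<open>W m\<close>.\<close>
  define Node where "Node n m \<gamma> u1 u2 v1 v2 \<longleftrightarrow>
      \<gamma> \<in> \<Gamma> \<and> U n m = u1 @ u2 \<and> V n m = v1 @ v2 \<and> D \<gamma> u2 v2 \<and>
      (\<forall>u' v'. D \<gamma> u' v' \<longrightarrow> val (u1 @ u') = val (v1 @ v')) \<and>
      (n < length u2 \<longleftrightarrow> \<not> length (W m) + n \<le> length v2)" for n m \<gamma> u1 u2 v1 v2
  have "\<exists>\<gamma> u1 u2 v1 v2. Node n m \<gamma> u1 u2 v1 v2" if m: "m \<in> carrier M - {\<one>}" for n m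
  proof -
    have "W m \<noteq> []" using W(2)[of m] m by auto
    then have len: "n < length (U n m)" "length (W m) + n \<le> length (V n m)" by (simp_all add: U_def V_def)
    have "map Some (U n m) @ [None] @ rev (map Some (V n m)) \<in> pair_lang (gens X) (\<lambda>u v. val u = val v)"
      unfolding pair_lang_iff using UV vU vV m by simp
    from split[OF this len] show ?thesis unfolding Node_def pair_lang_iff by blast
  qed
  then have ex: "\<exists>k. Node n m (fst k) (fst (snd k)) (fst (snd (snd k))) (fst (snd (snd (snd k)))) (snd (snd (snd (snd k))))" if "m \<in> carrier M - {\<one>}" for n m
    using that by simp
  define k where "k n m = (SOME k. Node n m (fst k) (fst (snd k)) (fst (snd (snd k))) (fst (snd (snd (snd k)))) (snd (snd (snd (snd k)))))" for n m
  define g u1 u2 v1 v2 where "g n m = fst (k n m)" and "u1 n m = fst (snd (k n m))"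
    and "u2 n m = fst (snd (snd (k n m)))" and "v1 n m = fst (snd (snd (snd (k n m))))"
    and "v2 n m = snd (snd (snd (snd (k n m))))" for n m
  have Node: "Node n m (g n m) (u1 n m) (u2 n m) (v1 n m) (v2 n m)" if "m \<in> carrier M - {\<one>}" for n m
    using someI_ex[OF ex[OF that, of n]] unfolding g_def u1_def u2_def v1_def v2_def k_def .
  note node = Node[unfolded Node_def]
  have swap: "val (u1 n m @ u2 n' m') = val (v1 n m @ v2 n' m')"
    if "m \<in> carrier M - {\<one>}" "m' \<in> carrier M - {\<one>}" "g n m = g n' m'" for n m n' m'
    using node[OF that(1), of n] node[OF that(2), of n'] that(3) by metis
  \<comment> \<open>Otherwise, for this n, every node has its left inner part inside the trailing
    c^n, and its right inner part contains the second \<open>W m\<close>.\<close>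
  have "\<exists>m \<in> carrier M - {\<one>}. n < length (u2 n m)" for n
  proof (rule ccontr)
    assume "\<not> ?thesis"
    then have small: "length (u2 n m) \<le> n" if "m \<in> carrier M - {\<one>}" for m using that by force
    have u2: "u2 n m = replicate (length (u2 n m)) C" if m: "m \<in> carrier M - {\<one>}" for m
    proof -
      have "W m @ replicate n C = u1 n m @ u2 n m" using node[OF m, of n] by (simp add: U_def)
      then have E: "replicate n C @ rev (W m) = rev (u2 n m) @ rev (u1 n m)" by (metis rev_append rev_replicate)
      have "take (length (u2 n m)) (replicate n C @ rev (W m)) = rev (u2 n m)" unfolding E by simp
      then have "rev (u2 n m) = replicate (length (u2 n m)) C" using small[OF m] by simp
      then show ?thesis by (metis rev_replicate rev_rev_ident)
    qed
    have v1: "length (v1 n m) \<le> 2 * n \<and> v1 n m = take (length (v1 n m)) (replicate n C @ replicate n B)"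
      if m: "m \<in> carrier M - {\<one>}" for m
    proof -
      have V: "(replicate n C @ replicate n B) @ W m @ replicate n C = v1 n m @ v2 n m"
        using node[OF m, of n] by (simp add: V_def)
      moreover have "length (W m) + n \<le> length (v2 n m)" using node[OF m, of n] small[OF m] by auto
      moreover have "length (v1 n m) + length (v2 n m) = 2 * n + length (W m) + n"
        using arg_cong[OF V, of length] by simp
      ultimately have len: "length (v1 n m) \<le> 2 * n" by linarith
      have "v1 n m = take (length (v1 n m)) ((replicate n C @ replicate n B) @ W m @ replicate n C)"
        unfolding V by simp
      also have "\<dots> = take (length (v1 n m)) (replicate n C @ replicate n B)"
        using len by (subst take_append) simp
      finally show ?thesis using len by blast
    qed
    \<comment> \<open>Now \<open>u2\<close> is a power of c and \<open>v1\<close> a prefix of c^n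
      b^n, so the lengths determine them. For equal keys the pair swapped between m and m' has
      \<open>U n m\<close> on the left and \<open>V n m'\<close> on the right, and the equality of
      their values is \<phi>^n(m) = \<phi>^n(m').\<close>
    let ?key = "\<lambda>m. (g n m, length (u2 n m), length (v1 n m))"
    have "?key ` (carrier M - {\<one>}) \<subseteq> \<Gamma> \<times> {..n} \<times> {..2 * n}"
      using node small v1 by blast
    then have "finite (?key ` (carrier M - {\<one>}))" by (rule finite_subset) (use \<Gamma> in simp)
    then have "finite ((\<phi> ^^ n) ` (carrier M - {\<one>}))"
    proof (rule finite_image_factor)
      fix m m' assume m: "m \<in> carrier M - {\<one>}" "m' \<in> carrier M - {\<one>}" and "?key m = ?key m'"
      then have key: "g n m = g n m'" "length (u2 n m) = length (u2 n m')" "length (v1 n m) = length (v1 n m')"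
        by auto
      have u2': "u2 n m' = u2 n m" by (metis u2[OF m(1)] u2[OF m(2)] key(2))
      have v1': "v1 n m = v1 n m'" by (metis v1[OF m(1)] v1[OF m(2)] key(3))
      have "val (U n m) = val (V n m')"
        using swap[OF m key(1)] node[OF m(1), of n] node[OF m(2), of n] unfolding u2' v1' by simp
      then show "(\<phi> ^^ n) m = (\<phi> ^^ n) m'" using vU vV m by simp
    qed
    with ne show False by blast
  qed
  then obtain \<mu> where \<mu>: "\<And>n. \<mu> n \<in> carrier M - {\<one>}" "\<And>n. n < length (u2 n (\<mu> n))" by metis
  \<comment> \<open>Since \<open>W (\<mu> n)\<close> has its value in M, a cut through it leaves as
    many b's pending on the left as there are unmatched c's on the right. This common number is i,
    and the trailing c^n raises the count on the right to i + n.\<close>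
  have shape: "\<exists>s t i p q. W (\<mu> n) = u1 n (\<mu> n) @ s \<and> u2 n (\<mu> n) = s @ replicate n C \<and>
      v1 n (\<mu> n) = replicate n C @ t \<and> val (u1 n (\<mu> n)) = (0, p, i) \<and> val (u2 n (\<mu> n)) = (i + n, q, 0)" for n
  proof -
    note nd = node[OF \<mu>(1), of n n]
    have U: "W (\<mu> n) @ replicate n C = u1 n (\<mu> n) @ u2 n (\<mu> n)" using nd by (simp add: U_def)
    moreover from U have "length (u1 n (\<mu> n)) + length (u2 n (\<mu> n)) = length (W (\<mu> n)) + n"
      by (metis length_append length_replicate)
    ultimately have "take (length (u1 n (\<mu> n))) (W (\<mu> n)) = u1 n (\<mu> n)"
      "drop (length (u1 n (\<mu> n))) (W (\<mu> n)) @ replicate n C = u2 n (\<mu> n)"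
      using \<mu>(2)[of n] by (auto simp: append_eq_append_conv_if split: if_splits)
    then obtain s where s: "W (\<mu> n) = u1 n (\<mu> n) @ s" "u2 n (\<mu> n) = s @ replicate n C"
      by (metis append_take_drop_id)
    have V: "replicate n C @ (replicate n B @ W (\<mu> n) @ replicate n C) = v1 n (\<mu> n) @ v2 n (\<mu> n)"
      using nd by (simp add: V_def)
    have "length (v2 n (\<mu> n)) < length (W (\<mu> n)) + n" using nd \<mu>(2)[of n] by auto
    moreover have "length (v1 n (\<mu> n)) + length (v2 n (\<mu> n)) = 2 * n + length (W (\<mu> n)) + n"
      using arg_cong[OF V, of length] by simp
    ultimately have "n \<le> length (v1 n (\<mu> n))" by linarith
    then have "replicate n C = take n (v1 n (\<mu> n))"
      using V by (simp add: append_eq_append_conv_if)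
    then obtain t where t: "v1 n (\<mu> n) = replicate n C @ t"
      by (metis append_take_drop_id)
    obtain a p i where vu: "val (u1 n (\<mu> n)) = (a, p, i)" by (cases "val (u1 n (\<mu> n))")
    obtain k q l where vs: "val s = (k, q, l)" by (cases "val s")
    have lists: "u1 n (\<mu> n) \<in> lists (gens (carrier M))" "s \<in> lists (gens (carrier M))"
      using W(1)[of "\<mu> n"] \<mu>(1)[of n] gensM unfolding s(1) by auto
    have "tmult (a, p, i) (k, q, l) = (0, \<mu> n, 0)"
      using val_append[OF lists] W(2)[of "\<mu> n"] \<mu>(1)[of n] unfolding s(1) vu vs by simp
    then have *: "a = 0" "i = k" "l = 0" using tmult_eq_zero_zero by blast+
    have "val (u2 n (\<mu> n)) = tmult (k, q, 0) (n, \<one>, 0)"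
      unfolding s(2) using lists(2) vs * vC by (subst val_append) auto
    then show ?thesis using s t vu * by auto
  qed
  then obtain i where i: "\<And>n. \<exists>s t p q. W (\<mu> n) = u1 n (\<mu> n) @ s \<and> u2 n (\<mu> n) = s @ replicate n C \<and>
      v1 n (\<mu> n) = replicate n C @ t \<and> val (u1 n (\<mu> n)) = (0, p, i n) \<and> val (u2 n (\<mu> n)) = (i n + n, q, 0)"
    by metis
  \<comment> \<open>In the swapped pair the left word has i n' + n' - i n unmatched c's, while the
    right word begins with c^n and so has at least n. The subtraction truncates at 0; n > 0 makes it
    a genuine one.\<close>
  have le: "n + i n \<le> n' + i n'" if "0 < n" "g n (\<mu> n) = g n' (\<mu> n')" for n n'
  proof -
    obtain s t p q where 1: "W (\<mu> n) = u1 n (\<mu> n) @ s" "v1 n (\<mu> n) = replicate n C @ t"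
      "val (u1 n (\<mu> n)) = (0, p, i n)" using i by metis
    obtain s' q' where 2: "u2 n' (\<mu> n') = s' @ replicate n' C" "W (\<mu> n') = u1 n' (\<mu> n') @ s'"
      "val (u2 n' (\<mu> n')) = (i n' + n', q', 0)" using i by metis
    have "u1 n (\<mu> n) \<in> lists (gens (carrier M))"
      using W(1)[of "\<mu> n"] \<mu>(1)[of n] gensM unfolding 1(1) by auto
    moreover have "s' \<in> lists (gens (carrier M))"
      using W(1)[of "\<mu> n'"] \<mu>(1)[of n'] gensM unfolding 2(2) by auto
    then have "u2 n' (\<mu> n') \<in> lists (gens (carrier M))" unfolding 2(1) by auto
    ultimately have "val (u1 n (\<mu> n) @ u2 n' (\<mu> n')) = tmult (0, p, i n) (i n' + n', q', 0)"
      using val_append 1(3) 2(3) by simp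
    then have "fst (val (u1 n (\<mu> n) @ u2 n' (\<mu> n'))) = i n' + n' - i n" by (auto split: if_splits)
    moreover have "n \<le> fst (val (v1 n (\<mu> n) @ v2 n' (\<mu> n')))"
      unfolding 1(2) by (simp add: val_replicate_C split: prod.splits)
    ultimately show ?thesis using swap[OF \<mu>(1) \<mu>(1) that(2)] that(1) by simp
  qed
  \<comment> \<open>By symmetry the node determines n + i n. There are finitely many nodes, but the
    number is at least n.\<close>
  have "finite ((\<lambda>n. n + i n) ` {0<..})"
  proof (rule finite_image_factor[of "\<lambda>n. g n (\<mu> n)"])
    show "finite ((\<lambda>n. g n (\<mu> n)) ` {0<..})"
    proof (rule finite_subset[OF image_subsetI \<Gamma>])
      show "g n (\<mu> n) \<in> \<Gamma>" for n using node[OF \<mu>(1), of n n] by blast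
    qed
    fix n n' :: nat assume "n \<in> {0<..}" "n' \<in> {0<..}" "g n (\<mu> n) = g n' (\<mu> n')"
    then show "n + i n = n' + i n'" using le[of n n'] le[of n' n] by simp
  qed
  then obtain K where "\<forall>n \<in> (\<lambda>n. n + i n) ` {0<..}. n < K"
    unfolding finite_nat_set_iff_bounded by (rule exE)
  then have "Suc K + i (Suc K) < K" by (rule bspec) (rule image_eqI[of _ _ "Suc K"], simp_all)
  then show False by simp
qed

section \<open>Finite generation and the word problem of M\<close>

lemma phi_word_prod: "u \<in> lists (carrier M) \<Longrightarrow> \<phi> (word_prod M u) = word_prod M (map \<phi> u)"
  by (induction u) auto

text \<open>Moving b and c past elements of M only applies \<phi> to them, so the middle component
  never leaves a \<phi>-stable submonoid containing \<open>X\<close>. Since \<open>gens X\<close>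
  reaches all of M, \<open>Y\<close> is then seen to generate it.\<close>

lemma val_mem_submonoid:
  assumes Y: "Y \<subseteq> carrier M" "X \<subseteq> Y" "\<phi> ` Y \<subseteq> Y" and "w \<in> lists (gens X)" "val w = (i, m, j)"
  shows "m \<in> word_prod M ` lists Y"
  using assms(4,5)
proof (induction w arbitrary: i m j rule: list.induct)
  case Nil
  then show ?case by (intro image_eqI[of _ _ "[]"]) auto
next
  case (Cons g w)
  obtain i' m' j' where v: "val w = (i', m', j')" by (cases "val w")
  have "w \<in> lists (gens X)" and g: "g \<in> gens X" using Cons.prems(1) by (simp_all only: Cons_in_lists_iff)
  with Cons.IH v obtain u where u: "u \<in> lists Y" "m' = word_prod M u" by blast
  show ?case
  proof (cases g)
    case (Gen a)
    then have "a \<in> Y" using g Y by auto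
    then have "(\<phi> ^^ k) a \<in> Y" for k by (induction k) (use Y(3) in auto)
    then have "(\<phi> ^^ i') a # u \<in> lists Y" using u by simp
    moreover have "m = word_prod M ((\<phi> ^^ i') a # u)" using Cons.prems(2) v Gen u by auto
    ultimately show ?thesis by blast
  next
    case B
    have "map \<phi> u \<in> lists Y" using u(1) Y(3) by (auto simp: image_subset_iff)
    moreover have "\<phi> m' = word_prod M (map \<phi> u)"
      using phi_word_prod u lists_mono[OF Y(1)] by blast
    moreover have "m = m' \<or> m = \<phi> m'" using Cons.prems(2) v B by (cases i') auto
    ultimately show ?thesis using u by blast
  next
    case C
    then show ?thesis using Cons.prems(2) v u by auto
  qed
qed

text \<open>Iterating \<phi> on a finite set yields finitely many elements before the n-th power,
  and from there on everything lies in the finite image of \<phi>^n.\<close>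

lemma phi_closed_superset:
  assumes "finite X" "X \<subseteq> carrier M" and fin: "finite ((\<phi> ^^ n) ` carrier M)"
  obtains Y where "finite Y" "Y \<subseteq> carrier M" "X \<subseteq> Y" "(\<phi> ^^ n) ` carrier M \<subseteq> Y" "\<phi> ` Y \<subseteq> Y"
proof -
  define Y where "Y = X \<union> (\<Union>k < n. (\<phi> ^^ k) ` X) \<union> (\<phi> ^^ n) ` carrier M"
  have "finite Y" unfolding Y_def using assms(1) fin by simp
  moreover have YM: "Y \<subseteq> carrier M" unfolding Y_def using assms(2) by auto
  have X_pow: "(\<phi> ^^ k) x \<in> Y" if "x \<in> X" "k \<le> n" for x k
    using that assms(2) unfolding Y_def by (cases "k = n") auto
  have "\<phi> y \<in> Y" if "y \<in> Y" for y
  proof -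
    from that consider "y \<in> X" | k x where "k < n" "x \<in> X" "y = (\<phi> ^^ k) x"
      | x where "x \<in> carrier M" "y = (\<phi> ^^ n) x" unfolding Y_def by blast
    then show ?thesis
    proof cases
      case 1
      show ?thesis
      proof (cases n)
        case 0
        then show ?thesis using 1 assms(2) unfolding Y_def by auto
      next
        case (Suc k)
        then show ?thesis using X_pow[OF 1, of 1] by simp
      qed
    next
      case 2
      then show ?thesis using X_pow[of x "Suc k"] by simp
    next
      case 3
      then have "\<phi> y = (\<phi> ^^ n) (\<phi> x)" by (simp add: funpow_swap1)
      then show ?thesis using 3 unfolding Y_def by auto
    qed
  qed
  then have "\<phi> ` Y \<subseteq> Y" by blast
  moreover have "X \<subseteq> Y" "(\<phi> ^^ n) ` carrier M \<subseteq> Y" unfolding Y_def by blast+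
  ultimately show thesis using YM by (intro that)
qed

text \<open>M sits in the extension as the elements with triples \<open>(0, m, 0)\<close>. Spelling
  each generator over \<open>gens X\<close> makes its word problem an inverse homomorphic image of
  the one of the extension.\<close>

lemma UCF_base_if:
  assumes "finite X" "X \<subseteq> carrier M"
    and words: "\<And>m. m \<in> carrier M \<Longrightarrow> \<exists>w \<in> lists (gens X). val w = (0, m, 0)"
    and cf: "context_free (pair_lang (gens X) (\<lambda>u v. val u = val v))"
    and fin: "finite ((\<phi> ^^ n) ` carrier M)"
  shows "UCF M"
proof -
  obtain Y where Y: "finite Y" "Y \<subseteq> carrier M" "X \<subseteq> Y" "\<phi> ` Y \<subseteq> Y"
    using phi_closed_superset[OF assms(1,2) fin] by metis
  note YM = Y(2)
  have "carrier M \<subseteq> word_prod M ` lists Y"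
    using words val_mem_submonoid[OF YM Y(3,4)] by blast
  moreover have "word_prod M ` lists Y \<subseteq> carrier M"
    by (rule image_subsetI) (rule word_prod_closed[OF subsetD[OF lists_mono[OF YM]]])
  ultimately have gen: "generates M Y" unfolding generates_def using YM by blast
  from words obtain W where W: "\<And>m. m \<in> carrier M \<Longrightarrow> W m \<in> lists (gens X) \<and> val (W m) = (0, m, 0)" by metis
  \<comment> \<open>The factor bc = 1 keeps the image nonempty even if \<open>W m\<close> is
    empty.\<close>
  define h where "h m = W m @ [B, C]" for m
  have h: "h m \<in> lists (gens (carrier M))" "val (h m) = val [Gen m]" if "m \<in> carrier M" for m
  proof -
    have "W m \<in> lists (gens (carrier M))" using W[OF that] gens_mono[OF assms(2)] by blast
    moreover have "[B, C] \<in> lists (gens (carrier M))" by simp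
    ultimately show "h m \<in> lists (gens (carrier M))" "val (h m) = val [Gen m]"
      unfolding h_def using W[OF that] that by (simp_all only: append_in_lists_conv) (simp add: val_append)
  qed
  have "context_free (pair_lang Y (\<lambda>u v. word_prod M u = word_prod M v))"
  proof (rule context_free_pair_lang_hom[OF cf Y(1), of h])
    show "h y \<in> lists (gens X)" if "y \<in> Y" for y
      using W[of y] that YM unfolding h_def by (auto simp del: in_lists_conv_set)
    show "h y \<noteq> []" for y by (simp add: h_def)
    have *: "val (concat (map h u)) = (0, word_prod M u, 0)" if "u \<in> lists Y" for u
    proof -
      have "concat (map h u) \<in> lists (gens (carrier M)) \<and> concat (map (\<lambda>m. [Gen m]) u) \<in> lists (gens (carrier M))
        \<and> val (concat (map h u)) = val (concat (map (\<lambda>m. [Gen m]) u))"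
      proof (rule val_concat_cong[OF that])
        fix y assume "y \<in> Y"
        then have "y \<in> carrier M" using YM by blast
        then show "h y \<in> lists (gens (carrier M))" "[Gen y] \<in> lists (gens (carrier M))" "val (h y) = val [Gen y]"
          using h by simp_all
      qed
      moreover have "concat (map (\<lambda>m. [Gen m]) u) = map Gen u" by (induction u) auto
      ultimately show ?thesis by simp
    qed
    show "(word_prod M u = word_prod M v) = (val (concat (map h u)) = val (concat (map h v)))"
      if "u \<in> lists Y" "v \<in> lists Y" for u v
      using *[OF that(1)] *[OF that(2)] by simp
  qed
  then show ?thesis unfolding UCF_def word_problem_eq_pair_lang
    using gen Y(1) by blast
qed

end

section \<open>A context-free word problem for the extension\<close>

text \<open>Here b opens and c closes a bracket, and letters of M may stand anywhere. Over \<Sigma>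
  these are the words whose value lies in M; the brackets supply an induction that
  \<open>val\<close> does not offer.\<close>

inductive dyck :: "'a brgen list \<Rightarrow> bool" where
  dyck_Nil: "dyck []"
| dyck_Gen: "dyck w \<Longrightarrow> dyck (Gen a # w)"
| dyck_BC: "dyck u \<Longrightarrow> dyck w \<Longrightarrow> dyck (B # u @ C # w)"

locale bruck_reilly_finite = bruck_reilly +
  fixes Y :: "'a set" and n :: nat
  assumes finite_Y: "finite Y" and Y_carrier: "Y \<subseteq> carrier M" and phi_Y: "\<phi> ` Y \<subseteq> Y"
    and image_Y: "(\<phi> ^^ n) ` carrier M \<subseteq> Y"
begin

abbreviation "F \<equiv> (\<phi> ^^ n) ` carrier M"
abbreviation "\<Sigma> \<equiv> gens Y"

lemma finite_F: "finite F"
  using finite_subset[OF image_Y finite_Y] .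

lemma Y_closed: "a \<in> Y \<Longrightarrow> a \<in> carrier M"
  using Y_carrier by blast

lemma F_closed: "f \<in> F \<Longrightarrow> f \<in> carrier M"
  by auto

lemma F_Y: "f \<in> F \<Longrightarrow> f \<in> Y"
  using image_Y by blast

lemma one_F: "\<one> \<in> F"
  using image_eqI[of \<one> "\<phi> ^^ n" \<one>] by simp

lemma mult_F: "f \<in> F \<Longrightarrow> g \<in> F \<Longrightarrow> f \<otimes> g \<in> F"
  by (auto simp: phi_pow_mult[symmetric] simp del: phi_pow_mult)

lemma phi_F: "f \<in> F \<Longrightarrow> \<phi> f \<in> F"
  by (auto simp: funpow_swap1)

lemma phi_pow_Y: "a \<in> Y \<Longrightarrow> (\<phi> ^^ k) a \<in> Y"
  by (induction k) (use phi_Y in auto)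

lemma phi_phi_pow_swap: "\<phi> ((\<phi> ^^ k) x) = (\<phi> ^^ k) (\<phi> x)"
  by (simp add: funpow_swap1)

lemma \<Sigma>_carrier: "w \<in> lists \<Sigma> \<Longrightarrow> w \<in> lists (gens (carrier M))"
  using gens_mono[OF Y_carrier] by blast

lemma val_carrier: "w \<in> lists \<Sigma> \<Longrightarrow> val w = (i, m, j) \<Longrightarrow> m \<in> carrier M"
  using val_closed' \<Sigma>_carrier by blast

lemma val_append_\<Sigma>: "u \<in> lists \<Sigma> \<Longrightarrow> v \<in> lists \<Sigma> \<Longrightarrow> val (u @ v) = tmult (val u) (val v)"
  using val_append \<Sigma>_carrier by blast

lemma lists_\<Sigma>_simps [simp]:
  "Gen a # w \<in> lists \<Sigma> \<longleftrightarrow> a \<in> Y \<and> w \<in> lists \<Sigma>" "B # w \<in> lists \<Sigma> \<longleftrightarrow> w \<in> lists \<Sigma>"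
  "C # w \<in> lists \<Sigma> \<longleftrightarrow> w \<in> lists \<Sigma>" "u @ w \<in> lists \<Sigma> \<longleftrightarrow> u \<in> lists \<Sigma> \<and> w \<in> lists \<Sigma>"
  by auto

declare in_lists_conv_set [simp del] in_listsD [rule del] in_listsI [rule del]

lemma dyck_val: "dyck d \<Longrightarrow> d \<in> lists \<Sigma> \<Longrightarrow> \<exists>p \<in> carrier M. val d = (0, p, 0)"
proof (induction rule: dyck.induct)
  case (dyck_Gen w a)
  then show ?case using Y_closed by auto
next
  case (dyck_BC u w)
  then obtain p q where "val u = (0, p, 0)" "p \<in> carrier M" "val w = (0, q, 0)" "q \<in> carrier M" by auto
  then show ?case using dyck_BC.prems by (simp add: val_append_\<Sigma>)
qed simp

lemma val_dyck_C:
  "d \<in> lists \<Sigma> \<Longrightarrow> x \<in> lists \<Sigma> \<Longrightarrow> val d = (0, p, 0) \<Longrightarrow> val x = (i, m, j) \<Longrightarrow>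
    val (d @ C # x) = (Suc i, (\<phi> ^^ Suc i) p \<otimes> m, j)"
  by (simp add: val_append_\<Sigma>)

lemma val_dyck_B:
  "d \<in> lists \<Sigma> \<Longrightarrow> x \<in> lists \<Sigma> \<Longrightarrow> val d = (0, p, 0) \<Longrightarrow> val x = (0, m, j) \<Longrightarrow>
    val (d @ B # x) = (0, p \<otimes> \<phi> m, Suc j)"
  by (simp add: val_append_\<Sigma>)

text \<open>The word is cut at its first unmatched letter. If that is a b, no unmatched c can
  follow, since it would be the partner of this b; this is what \<open>fst (val x) = 0\<close>
  records.\<close>

lemma parse:
  "w \<in> lists \<Sigma> \<Longrightarrow> dyck w \<or> (\<exists>d x. dyck d \<and> w = d @ C # x) \<or>
    (\<exists>d x. dyck d \<and> w = d @ B # x \<and> fst (val x) = 0)"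
proof (induction w rule: length_induct)
  case (1 w)
  show ?case
  proof (cases w)
    case (Cons g y)
    with 1 have y: "y \<in> lists \<Sigma>" by simp
    with 1(1) Cons have IH: "dyck y \<or> (\<exists>d x. dyck d \<and> y = d @ C # x) \<or>
      (\<exists>d x. dyck d \<and> y = d @ B # x \<and> fst (val x) = 0)" by simp
    show ?thesis
    proof (cases g)
      case (Gen a)
      from IH show ?thesis
      proof (elim disjE exE conjE)
        fix d x assume "dyck d" "y = d @ C # x"
        then have "dyck (Gen a # d)" "w = (Gen a # d) @ C # x" using Cons Gen by (auto intro: dyck.intros)
        then show ?thesis by blast
      next
        fix d x assume *: "dyck d" "y = d @ B # x" "fst (val x) = 0"
        then have "dyck (Gen a # d)" "w = (Gen a # d) @ B # x" using Cons Gen by (auto intro: dyck.intros)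
        then show ?thesis using *(3) by blast
      qed (use Cons Gen in \<open>auto intro: dyck.intros\<close>)
    next
      case C
      then show ?thesis using Cons dyck_Nil by (metis append_Nil)
    next
      case B
      have zero: ?thesis if "fst (val y) = 0" using that Cons B dyck_Nil by (metis append_Nil)
      from IH show ?thesis
      proof (elim disjE exE conjE)
        assume "dyck y"
        then show ?thesis using zero dyck_val[OF _ y] by auto
      next
        fix d x assume *: "dyck d" "y = d @ B # x" "fst (val x) = 0"
        then have l: "d \<in> lists \<Sigma>" "x \<in> lists \<Sigma>" using y by auto
        obtain p m j where "val d = (0, p, 0)" "val x = (0, m, j)"
          using dyck_val[OF *(1) l(1)] *(3) by (cases "val x") auto
        from val_dyck_B[OF l this] show ?thesis using zero *(2) by simp
      next
        \<comment> \<open>The leading b is matched by this c, and the search starts again in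
          \<open>x\<close>, which is shorter than the tail of \<open>w\<close>. Hence the induction
          on length.\<close>
        fix d x assume *: "dyck d" "y = d @ C # x"
        then have "x \<in> lists \<Sigma>" "length x < length w" using y Cons by auto
        with 1(1) have "dyck x \<or> (\<exists>d x'. dyck d \<and> x = d @ C # x') \<or>
          (\<exists>d x'. dyck d \<and> x = d @ B # x' \<and> fst (val x') = 0)" by blast
        moreover have "w = B # d @ C # x" using Cons B * by simp
        ultimately show ?thesis using dyck_BC[OF *(1)] by (metis append.assoc append_Cons)
      qed
    qed
  qed (simp add: dyck_Nil)
qed

lemma dyck_iff_val: "w \<in> lists \<Sigma> \<Longrightarrow> dyck w \<longleftrightarrow> (\<exists>p. val w = (0, p, 0))"
proof
  assume w: "w \<in> lists \<Sigma>" "\<exists>p. val w = (0, p, 0)"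
  from parse[OF w(1)] show "dyck w"
  proof (elim disjE exE conjE)
    fix d x assume *: "dyck d" "w = d @ C # x"
    then have l: "d \<in> lists \<Sigma>" "x \<in> lists \<Sigma>" using w by auto
    obtain p where "val d = (0, p, 0)" using dyck_val[OF *(1) l(1)] by auto
    moreover obtain i m j where "val x = (i, m, j)" by (cases "val x")
    ultimately show ?thesis using val_dyck_C[OF l] w(2) *(2) by simp
  next
    fix d x assume *: "dyck d" "w = d @ B # x" "fst (val x) = 0"
    then have l: "d \<in> lists \<Sigma>" "x \<in> lists \<Sigma>" using w by auto
    obtain p m j where "val d = (0, p, 0)" "val x = (0, m, j)"
      using dyck_val[OF *(1) l(1)] *(3) by (cases "val x") auto
    then show ?thesis using val_dyck_B[OF l] w(2) *(2) by simp
  qed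
qed (use dyck_val in blast)

text \<open>An unmatched c in the value means that the first unmatched letter is a c. The balanced
  prefix has to pass all i + 1 unmatched c's, which accounts for the power of \<phi> on
  \<open>p\<close>.\<close>

lemma split_C:
  assumes w: "w \<in> lists \<Sigma>" "val w = (Suc i, m, j)"
  obtains d x p m' where "w = d @ C # x" "dyck d" "d \<in> lists \<Sigma>" "x \<in> lists \<Sigma>" "p \<in> carrier M" "m' \<in> carrier M"
    "val d = (0, p, 0)" "val x = (i, m', j)" "m = (\<phi> ^^ Suc i) p \<otimes> m'"
proof -
  from parse[OF w(1)] consider d x where "dyck d" "w = d @ C # x" | d x where "dyck d" "w = d @ B # x" "fst (val x) = 0"
    using dyck_iff_val[OF w(1)] w(2) by auto
  then show thesis
  proof cases
    case 1
    then have l: "d \<in> lists \<Sigma>" "x \<in> lists \<Sigma>" using w by auto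
    obtain p where p: "val d = (0, p, 0)" "p \<in> carrier M" using dyck_val[OF 1(1) l(1)] by auto
    obtain i' m' j' where x: "val x = (i', m', j')" by (cases "val x")
    then show ?thesis using that[OF 1(2,1) l p(2) val_carrier[OF l(2) x] p(1)] val_dyck_C[OF l p(1) x] w(2) 1(2) by auto
  next
    case 2
    then have l: "d \<in> lists \<Sigma>" "x \<in> lists \<Sigma>" using w by auto
    obtain p m j where "val d = (0, p, 0)" "val x = (0, m, j)"
      using dyck_val[OF 2(1) l(1)] 2(3) by (cases "val x") auto
    then show ?thesis using val_dyck_B[OF l] w(2) 2(2) by simp
  qed
qed

lemma split_B:
  assumes w: "w \<in> lists \<Sigma>" "val w = (0, m, Suc j)"
  obtains d x p m' where "w = d @ B # x" "dyck d" "d \<in> lists \<Sigma>" "x \<in> lists \<Sigma>" "p \<in> carrier M" "m' \<in> carrier M"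
    "val d = (0, p, 0)" "val x = (0, m', j)" "m = p \<otimes> \<phi> m'"
proof -
  from parse[OF w(1)] consider d x where "dyck d" "w = d @ C # x" | d x where "dyck d" "w = d @ B # x" "fst (val x) = 0"
    using dyck_iff_val[OF w(1)] w(2) by auto
  then show thesis
  proof cases
    case 1
    then have l: "d \<in> lists \<Sigma>" "x \<in> lists \<Sigma>" using w by auto
    obtain p where p: "val d = (0, p, 0)" "p \<in> carrier M" using dyck_val[OF 1(1) l(1)] by auto
    obtain i' m' j' where x: "val x = (i', m', j')" by (cases "val x")
    then show ?thesis using val_dyck_C[OF l p(1) x] w(2) 1(2) by auto
  next
    case 2
    then have l: "d \<in> lists \<Sigma>" "x \<in> lists \<Sigma>" using w by auto
    obtain p where p: "val d = (0, p, 0)" "p \<in> carrier M" using dyck_val[OF 2(1) l(1)] by auto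
    obtain m' j' where x: "val x = (0, m', j')" using 2(3) by (cases "val x") auto
    then show ?thesis using that[OF 2(2,1) l p(2) val_carrier[OF l(2) x] p(1)] val_dyck_B[OF l p(1) x] w(2) 2(2) by auto
  qed
qed

section \<open>Balanced words and the innermost factor\<close>

definition Dyck :: "'a \<Rightarrow> 'a brgen list set" where
  "Dyck g = {d \<in> lists \<Sigma>. \<exists>p. val d = (0, p, 0) \<and> (\<phi> ^^ n) p = g}"

lemma DyckI: "d \<in> lists \<Sigma> \<Longrightarrow> val d = (0, p, 0) \<Longrightarrow> d \<in> Dyck ((\<phi> ^^ n) p)"
  by (simp add: Dyck_def)

lemma DyckE:
  assumes "d \<in> Dyck g"
  obtains p where "d \<in> lists \<Sigma>" "val d = (0, p, 0)" "p \<in> carrier M" "(\<phi> ^^ n) p = g"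
  using assms val_carrier unfolding Dyck_def by blast

text \<open>A balanced word is recorded only by \<phi>^n of its value, so finitely many nonterminals
  suffice. If u and w have records g and h, then b u c w has the value \<phi>(u) w and hence the
  record \<phi>(g) h.\<close>

lemma context_free_Dyck: "context_free (Dyck g)"
proof -
  define P :: "('a \<times> ('a + 'a brgen list set) list) set" where
    "P = {(\<one>, [])} \<union> (\<lambda>(a, g). ((\<phi> ^^ n) a \<otimes> g, [Inr {[Gen a]}, Inl g])) ` (Y \<times> F)
      \<union> (\<lambda>(g, h). (\<phi> g \<otimes> h, [Inr {[B]}, Inl g, Inr {[C]}, Inl h])) ` (F \<times> F)"
  have "finite P" unfolding P_def using finite_Y finite_F by simp
  have "lderives P [Inl g] w \<longleftrightarrow> w \<in> Dyck g" for g w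
  proof
    assume "lderives P [Inl g] w"
    then have "w \<in> sem Dyck [Inl g]"
    proof (rule lderives_sound)
      fix X rhs assume "(X, rhs) \<in> P"
      then consider "X = \<one>" "rhs = []"
        | a g where "a \<in> Y" "X = (\<phi> ^^ n) a \<otimes> g" "rhs = [Inr {[Gen a]}, Inl g]"
        | g h where "X = \<phi> g \<otimes> h" "rhs = [Inr {[B]}, Inl g, Inr {[C]}, Inl h]"
        unfolding P_def by (elim UnE imageE) auto
      then show "sem Dyck rhs \<subseteq> Dyck X"
      proof cases
        case 1
        then show ?thesis using DyckI[of "[]" \<one>] by simp
      next
        case 2
        have "Gen a # w \<in> Dyck ((\<phi> ^^ n) a \<otimes> g)" if "w \<in> Dyck g" for w
          using that
        proof (rule DyckE)
          fix p assume "w \<in> lists \<Sigma>" "val w = (0, p, 0)" "p \<in> carrier M" "(\<phi> ^^ n) p = g"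
          then show ?thesis using DyckI[of "Gen a # w" "a \<otimes> p"] 2(1) Y_closed by simp
        qed
        then show ?thesis using 2 by (auto simp: conc_def)
      next
        case 3
        have "B # u @ C # w \<in> Dyck (\<phi> g \<otimes> h)" if "u \<in> Dyck g" "w \<in> Dyck h" for u w
        proof -
          from that(1) obtain p where p: "u \<in> lists \<Sigma>" "val u = (0, p, 0)" "p \<in> carrier M" "(\<phi> ^^ n) p = g"
            by (rule DyckE)
          from that(2) obtain q where q: "w \<in> lists \<Sigma>" "val w = (0, q, 0)" "q \<in> carrier M" "(\<phi> ^^ n) q = h"
            by (rule DyckE)
          have "val (B # u @ C # w) = (0, \<phi> p \<otimes> q, 0)" using val_dyck_C[OF p(1) q(1) p(2) q(2)] by simp
          moreover have "(\<phi> ^^ n) (\<phi> p) = \<phi> g" using p(4) phi_phi_pow_swap[of n p] by simp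
          ultimately show ?thesis using DyckI[of "B # u @ C # w" "\<phi> p \<otimes> q"] p q by simp
        qed
        then show ?thesis using 3 by (auto simp: conc_def)
      qed
    qed
    then show "w \<in> Dyck g" by (auto simp: conc_def)
  next
    have complete: "lderives P [Inl ((\<phi> ^^ n) p)] d" if "dyck d" "d \<in> lists \<Sigma>" "val d = (0, p, 0)" for d p
      using that
    proof (induction arbitrary: p)
      case dyck_Nil
      then show ?case by (auto simp: P_def intro!: lderives_single[of _ "[]"] lderives_Nil)
    next
      case (dyck_Gen w a)
      then obtain q where q: "val w = (0, q, 0)" "q \<in> carrier M" using dyck_val by auto
      then have IH: "lderives P [Inl ((\<phi> ^^ n) q)] w" using dyck_Gen by simp
      have p: "p = a \<otimes> q" "a \<in> Y" "a \<in> carrier M" using dyck_Gen q Y_closed by auto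
      have "((\<phi> ^^ n) a \<otimes> (\<phi> ^^ n) q, [Inr {[Gen a]}, Inl ((\<phi> ^^ n) q)]) \<in> P"
        unfolding P_def using p(2) q(2) by (intro UnI1 UnI2 image_eqI[of _ _ "(a, (\<phi> ^^ n) q)"]) auto
      moreover have "lderives P [Inr {[Gen a]}, Inl ((\<phi> ^^ n) q)] ([Gen a] @ w)"
        using IH by (intro lderives_Inr) simp
      ultimately show ?case using p q(2) by (auto intro: lderives_single)
    next
      case (dyck_BC u w)
      then have l: "u \<in> lists \<Sigma>" "w \<in> lists \<Sigma>" by auto
      obtain r where r: "val u = (0, r, 0)" "r \<in> carrier M" using dyck_val[OF dyck_BC(1) l(1)] by auto
      obtain q where q: "val w = (0, q, 0)" "q \<in> carrier M" using dyck_val[OF dyck_BC(2) l(2)] by auto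
      have p: "p = \<phi> r \<otimes> q" using val_dyck_C[OF l r(1) q(1)] dyck_BC.prems(2) by simp
      let ?r = "(\<phi> ^^ n) r" and ?q = "(\<phi> ^^ n) q"
      have "(\<phi> ?r \<otimes> ?q, [Inr {[B]}, Inl ?r, Inr {[C]}, Inl ?q]) \<in> P"
        unfolding P_def using q(2) r(2) by (intro UnI2 image_eqI[of _ _ "(?r, ?q)"]) auto
      moreover have "lderives P [Inr {[B]}, Inl ?r, Inr {[C]}, Inl ?q] ([B] @ u @ [C] @ w)"
        using dyck_BC.IH(1)[OF l(1) r(1)] dyck_BC.IH(2)[OF l(2) q(1)]
        by (intro lderives_Inr lderives_Cons[of _ "Inl ?r"]) auto
      moreover have "(\<phi> ^^ n) p = \<phi> ?r \<otimes> ?q" using p q(2) r(2) by (simp add: funpow_swap1)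
      ultimately show ?case by (auto intro: lderives_single)
    qed
    assume "w \<in> Dyck g"
    then show "lderives P [Inl g] w"
      by (rule DyckE) (use complete dyck_iff_val in auto)
  qed
  moreover have "context_free {w. lderives P [Inl g] w}"
    by (rule lderives_context_free[OF \<open>finite P\<close>]) (auto simp: P_def intro: context_free_singleton)
  ultimately show ?thesis by simp
qed

abbreviation "SDyck g \<equiv> map Some ` Dyck g"
abbreviation "RDyck g \<equiv> rev ` map Some ` Dyck g"

lemma context_free_SDyck: "context_free (SDyck g)" "context_free (RDyck g)"
  by (intro context_free_rev context_free_map context_free_Dyck)+

text \<open>What is left of the two words once n unmatched b's have been read: these rests act
  through \<phi>^n only, so their classes g, g' are all that the outside needs. Both have the same
  number of unmatched b's, because the total numbers must agree.\<close>

definition Inner :: "'a \<Rightarrow> 'a \<Rightarrow> 'a brgen option list set" where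
  "Inner g g' = pair_lang \<Sigma> (\<lambda>x y. \<exists>p p' l. val x = (0, p, l) \<and> val y = (0, p', l) \<and>
    (\<phi> ^^ n) p = g \<and> (\<phi> ^^ n) p' = g')"

lemma pair_langE:
  assumes "w \<in> pair_lang X R'"
  obtains u v where "w = map Some u @ [None] @ rev (map Some v)" "u \<in> lists X" "v \<in> lists X" "R' u v"
  using assms unfolding pair_lang_def by blast

text \<open>The unmatched b's of the two words are generated in pairs around the separator. What
  follows such a b acquires one application of \<phi>, which on the recorded classes is again
  \<phi>.\<close>

lemma context_free_Inner: "context_free (Inner g g')"
proof -
  define P :: "(('a \<times> 'a) \<times> ('a \<times> 'a + 'a brgen option list set) list) set" where
    "P = (\<lambda>(g, g'). ((g, g'), [Inr (SDyck g), Inr {[None]}, Inr (RDyck g')])) ` (F \<times> F)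
      \<union> (\<lambda>((h, h'), (k, k')). ((h \<otimes> \<phi> k, h' \<otimes> \<phi> k'),
          [Inr (SDyck h), Inr {[Some B]}, Inl (k, k'), Inr {[Some B]}, Inr (RDyck h')])) ` ((F \<times> F) \<times> (F \<times> F))"
  have "finite P" unfolding P_def using finite_F by simp
  let ?I = "\<lambda>(g, g'). Inner g g'"
  have "lderives P [Inl (g, g')] w \<longleftrightarrow> w \<in> Inner g g'" for g g' w
  proof
    assume "lderives P [Inl (g, g')] w"
    then have "w \<in> sem ?I [Inl (g, g')]"
    proof (rule lderives_sound)
      fix X rhs assume "(X, rhs) \<in> P"
      then consider g g' where "X = (g, g')" "rhs = [Inr (SDyck g), Inr {[None]}, Inr (RDyck g')]"
        | h h' k k' where "X = (h \<otimes> \<phi> k, h' \<otimes> \<phi> k')"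
          "rhs = [Inr (SDyck h), Inr {[Some B]}, Inl (k, k'), Inr {[Some B]}, Inr (RDyck h')]"
        unfolding P_def by (elim UnE imageE) auto
      then show "sem ?I rhs \<subseteq> ?I X"
      proof cases
        case 1
        have "map Some d @ [None] @ rev (map Some d') \<in> Inner g g'" if "d \<in> Dyck g" "d' \<in> Dyck g'" for d d'
          unfolding Inner_def pair_lang_iff using that by (elim DyckE) simp
        then show ?thesis using 1 by (auto simp: conc_def)
      next
        case 2
        have "map Some d @ [Some B] @ w @ [Some B] @ rev (map Some d') \<in> Inner (h \<otimes> \<phi> k) (h' \<otimes> \<phi> k')"
          if d: "d \<in> Dyck h" "d' \<in> Dyck h'" and w: "w \<in> Inner k k'" for d d' w
        proof -
          from w obtain x y where w: "w = map Some x @ [None] @ rev (map Some y)" and xy: "x \<in> lists \<Sigma>" "y \<in> lists \<Sigma>"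
            and ex: "\<exists>p p' l. val x = (0, p, l) \<and> val y = (0, p', l) \<and> (\<phi> ^^ n) p = k \<and> (\<phi> ^^ n) p' = k'"
            unfolding Inner_def by (rule pair_langE)
          from ex obtain p p' l where v: "val x = (0, p, l)" "val y = (0, p', l)" "(\<phi> ^^ n) p = k" "(\<phi> ^^ n) p' = k'"
            by blast
          have "p \<in> carrier M" "p' \<in> carrier M" using val_carrier xy v by blast+
          moreover have "(\<phi> ^^ n) (\<phi> p) = \<phi> k" "(\<phi> ^^ n) (\<phi> p') = \<phi> k'"
            using v(3,4) phi_phi_pow_swap[of n p] phi_phi_pow_swap[of n p'] by simp_all
          moreover from d(1) obtain q where q: "d \<in> lists \<Sigma>" "val d = (0, q, 0)" "q \<in> carrier M" "(\<phi> ^^ n) q = h"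
            by (rule DyckE)
          moreover from d(2) obtain q' where q': "d' \<in> lists \<Sigma>" "val d' = (0, q', 0)" "q' \<in> carrier M" "(\<phi> ^^ n) q' = h'"
            by (rule DyckE)
          ultimately have "map Some (d @ B # x) @ [None] @ rev (map Some (d' @ B # y)) \<in> Inner (h \<otimes> \<phi> k) (h' \<otimes> \<phi> k')"
            unfolding Inner_def pair_lang_iff
            using val_dyck_B[OF q(1) xy(1) q(2) v(1)] val_dyck_B[OF q'(1) xy(2) q'(2) v(2)] xy v
            by simp
          then show ?thesis unfolding w by simp
        qed
        then show ?thesis using 2 by (auto simp: conc_def)
      qed
    qed
    then show "w \<in> Inner g g'" by (auto simp: conc_def)
  next
    have complete: "lderives P [Inl ((\<phi> ^^ n) p, (\<phi> ^^ n) p')] (map Some x @ [None] @ rev (map Some y))"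
      if "x \<in> lists \<Sigma>" "y \<in> lists \<Sigma>" "val x = (0, p, l)" "val y = (0, p', l)" for x y p p' l
      using that
    proof (induction l arbitrary: x y p p')
      case 0
      have "p \<in> carrier M" "p' \<in> carrier M" using val_carrier 0 by blast+
      then have "(((\<phi> ^^ n) p, (\<phi> ^^ n) p'), [Inr (SDyck ((\<phi> ^^ n) p)), Inr {[None]}, Inr (RDyck ((\<phi> ^^ n) p'))]) \<in> P"
        unfolding P_def by (intro UnI1 image_eqI[of _ _ "((\<phi> ^^ n) p, (\<phi> ^^ n) p')"]) auto
      moreover have "lderives P [Inr (SDyck ((\<phi> ^^ n) p)), Inr {[None]}, Inr (RDyck ((\<phi> ^^ n) p'))]
        (map Some x @ [None] @ rev (map Some y) @ [])"
        by (intro lderives_Inr lderives_Nil imageI DyckI 0) simp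
      ultimately show ?case by (auto intro: lderives_single)
    next
      case (Suc l)
      from Suc.prems(1,3) obtain d x' q m where x: "x = d @ B # x'" "dyck d" "d \<in> lists \<Sigma>" "x' \<in> lists \<Sigma>"
        "q \<in> carrier M" "m \<in> carrier M" "val d = (0, q, 0)" "val x' = (0, m, l)" "p = q \<otimes> \<phi> m" by (rule split_B)
      from Suc.prems(2,4) obtain d' y' q' m' where y: "y = d' @ B # y'" "dyck d'" "d' \<in> lists \<Sigma>" "y' \<in> lists \<Sigma>"
        "q' \<in> carrier M" "m' \<in> carrier M" "val d' = (0, q', 0)" "val y' = (0, m', l)" "p' = q' \<otimes> \<phi> m'" by (rule split_B)
      let ?q = "(\<phi> ^^ n) q" and ?q' = "(\<phi> ^^ n) q'" and ?m = "(\<phi> ^^ n) m" and ?m' = "(\<phi> ^^ n) m'"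
      have "((?q \<otimes> \<phi> ?m, ?q' \<otimes> \<phi> ?m'),
          [Inr (SDyck ?q), Inr {[Some B]}, Inl (?m, ?m'), Inr {[Some B]}, Inr (RDyck ?q')]) \<in> P"
        unfolding P_def using x y by (intro UnI2 image_eqI[of _ _ "((?q, ?q'), (?m, ?m'))"]) auto
      moreover have "lderives P [Inr (SDyck ?q), Inr {[Some B]}, Inl (?m, ?m'), Inr {[Some B]}, Inr (RDyck ?q')]
        (map Some d @ [Some B] @ (map Some x' @ [None] @ rev (map Some y')) @ [Some B] @ rev (map Some d') @ [])"
        by (intro lderives_Inr lderives_Nil lderives_Cons[OF Suc.IH] imageI DyckI x y singletonI)
      moreover have "(\<phi> ^^ n) p = ?q \<otimes> \<phi> ?m" "(\<phi> ^^ n) p' = ?q' \<otimes> \<phi> ?m'"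
        using x y by (simp_all add: funpow_swap1)
      ultimately show ?case unfolding x(1) y(1) by (auto intro: lderives_single)
    qed
    assume "w \<in> Inner g g'"
    then show "lderives P [Inl (g, g')] w"
      unfolding Inner_def by (rule pair_langE) (use complete in blast)
  qed
  moreover have "context_free {w. lderives P [Inl (g, g')] w}"
    by (rule lderives_context_free[OF \<open>finite P\<close>])
      (auto simp: P_def intro: context_free_singleton context_free_SDyck)
  ultimately show ?thesis by simp
qed

end

section \<open>The transducer for the levels up to n\<close>

text \<open>\<open>Level b k\<close>: the letters read next are sent to their image under \<open>\<phi>\<^sup>k\<close>; \<open>b\<close> tells whether all
  unmatched letters \<open>c\<close> have been read.\<close>

datatype 'a state = Start 'a nat | Level bool nat | End 'a nat

context bruck_reilly_finite
begin

text \<open>The product of the emitted letters is the contribution of the input to the M-component.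
  Brackets emit the identity; at level n, where no further level is available, a balanced factor is
  read in one move of \<open>t_Dyck\<close>. \<open>t_start\<close> emits a factor f inherited from
  the outside, and \<open>t_inner\<close> guesses the class of the unread rest, which is checked
  where the two halves meet.\<close>

inductive_set delta :: "('a state \<times> 'a brgen list set \<times> 'a \<times> 'a state) set" where
  t_start: "f \<in> F \<Longrightarrow> i \<le> n \<Longrightarrow> (Start f i, {[]}, f, Level False i) \<in> delta"
| t_switch: "(Level False 0, {[]}, \<one>, Level True 0) \<in> delta"
| t_Gen: "a \<in> Y \<Longrightarrow> k \<le> n \<Longrightarrow> (Level b k, {[Gen a]}, (\<phi> ^^ k) a, Level b k) \<in> delta"
| t_B: "k < n \<Longrightarrow> (Level b k, {[B]}, \<one>, Level b (Suc k)) \<in> delta"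
| t_C: "k < n \<Longrightarrow> (Level b (Suc k), {[C]}, \<one>, Level b k) \<in> delta"
| t_Dyck: "g \<in> F \<Longrightarrow> (Level b n, Dyck g, g, Level b n) \<in> delta"
| t_end: "j < n \<Longrightarrow> (Level True j, {[]}, \<one>, End \<one> j) \<in> delta"
| t_inner: "g \<in> F \<Longrightarrow> (Level True n, {[]}, g, End g n) \<in> delta"

lemma finite_delta: "finite delta"
proof -
  have "delta \<subseteq> (\<lambda>(f, i). (Start f i, {[]}, f, Level False i)) ` (F \<times> {..n})
    \<union> {(Level False 0, {[]}, \<one>, Level True 0)}
    \<union> (\<lambda>(a, b, k). (Level b k, {[Gen a]}, (\<phi> ^^ k) a, Level b k)) ` (Y \<times> UNIV \<times> {..n})
    \<union> (\<lambda>(b, k). (Level b k, {[B]}, \<one>, Level b (Suc k))) ` (UNIV \<times> {..n})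
    \<union> (\<lambda>(b, k). (Level b (Suc k), {[C]}, \<one>, Level b k)) ` (UNIV \<times> {..n})
    \<union> (\<lambda>(g, b). (Level b n, Dyck g, g, Level b n)) ` (F \<times> UNIV)
    \<union> (\<lambda>j. (Level True j, {[]}, \<one>, End \<one> j)) ` {..n}
    \<union> (\<lambda>g. (Level True n, {[]}, g, End g n)) ` F" (is "_ \<subseteq> ?S")
  proof
    fix t assume "t \<in> delta"
    moreover obtain p L a q where t: "t = (p, L, a, q)" by (cases t)
    ultimately have "(p, L, a, q) \<in> delta" by simp
    then show "t \<in> ?S" unfolding t by cases (auto simp: image_iff)
  qed
  then show ?thesis by (rule finite_subset) (simp add: finite_Y finite_F)
qed

lemma context_free_delta: "(p, L, a, q) \<in> delta \<Longrightarrow> context_free L"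
  by (auto elim!: delta.cases intro: context_free_singleton context_free_Dyck)

lemma delta_output: "(p, L, a, q) \<in> delta \<Longrightarrow> a \<in> Y"
  by (auto elim!: delta.cases intro: F_Y phi_pow_Y one_F)

lemma path_output: "path delta p x us q \<Longrightarrow> us \<in> lists Y"
  by (induction rule: path.induct) (auto dest: delta_output)

lemma path_output_carrier: "path delta p x us q \<Longrightarrow> us \<in> lists (carrier M)"
  using path_output lists_mono[OF Y_carrier] by blast

lemma delta_input: "(p, L, a, q) \<in> delta \<Longrightarrow> x \<in> L \<Longrightarrow> x \<in> lists \<Sigma>"
  by (auto elim!: delta.cases simp: Dyck_def)

lemma path_input: "path delta p x us q \<Longrightarrow> x \<in> lists \<Sigma>"
  by (induction rule: path.induct) (auto dest: delta_input)

lemma replicate_\<Sigma>: "replicate k B \<in> lists \<Sigma>"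
  by (induction k) auto

text \<open>b^k p = \<phi>^k(p) b^k: behind k pending b's a balanced factor acts like a single
  letter in front of them.\<close>

lemma val_replicate_B_append:
  assumes "y \<in> lists \<Sigma>" "val y = (0, p, 0)" "x \<in> lists \<Sigma>"
  shows "val (replicate k B @ y @ x) = act (Gen ((\<phi> ^^ k) p)) (val (replicate k B @ x))"
proof -
  have p: "p \<in> carrier M" using val_carrier assms by blast
  then have Gen: "[Gen ((\<phi> ^^ k) p)] \<in> lists (gens (carrier M))" by auto
  have "val (replicate k B @ y) = val ([Gen ((\<phi> ^^ k) p)] @ replicate k B)"
    using p by (simp add: val_append_\<Sigma>[OF replicate_\<Sigma> assms(1)] assms(2))
  then have "val ((replicate k B @ y) @ x) = val (([Gen ((\<phi> ^^ k) p)] @ replicate k B) @ x)"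
    using replicate_\<Sigma> assms(1,3) \<Sigma>_carrier Gen
    by (simp only: val_append lists_\<Sigma>_simps append_in_lists_conv)
  then show ?thesis by simp
qed

text \<open>At \<open>Level True k\<close> the prefix read so far has left \<open>b\<^sup>k\<close> to act on the rest of the word, whereas
  at \<open>Level False k\<close> the rest of the word still has \<open>k\<close> unmatched letters \<open>c\<close>.\<close>

fun reads :: "'a \<Rightarrow> nat \<Rightarrow> 'a state \<Rightarrow> 'a brgen list \<Rightarrow> 'a list \<Rightarrow> bool" where
  "reads g j (End h l) x us \<longleftrightarrow> h = g \<and> l = j \<and> x = [] \<and> us = []"
| "reads g j (Level True k) x us \<longleftrightarrow>
    (\<exists>m \<in> carrier M. val (replicate k B @ x) = (0, m, j) \<and> word_prod M us = m \<otimes> g)"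
| "reads g j (Level False k) x us \<longleftrightarrow> (\<exists>m \<in> carrier M. val x = (k, m, j) \<and> word_prod M us = m \<otimes> g)"
| "reads g j (Start f i) x us \<longleftrightarrow> (\<exists>m \<in> carrier M. val x = (i, m, j) \<and> word_prod M us = f \<otimes> (m \<otimes> g))"

lemma path_sound:
  assumes "path delta s x us t" "t = End g j" "g \<in> F"
  shows "reads g j s x us"
  using assms
proof induction
  case (path_Cons s L a s' y x us t)
  note g = F_closed[OF \<open>g \<in> F\<close>]
  note x = path_input[OF path_Cons(3)]
  note IH = path_Cons(4)[OF path_Cons(5,6)]
  from path_Cons(1) show ?case
  proof cases
    case (t_start i)
    then show ?thesis using path_Cons(2) IH by auto
  next
    case t_switch
    then show ?thesis using path_Cons(2) IH g by auto
  next
    case (t_Gen c k b)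
    then have c: "c \<in> Y" "c \<in> carrier M" using Y_closed by auto
    show ?thesis
    proof (cases b)
      case True
      have "val (replicate k B @ [Gen c] @ x) = act (Gen ((\<phi> ^^ k) c)) (val (replicate k B @ x))"
        by (rule val_replicate_B_append) (use c x in auto)
      then show ?thesis using IH True t_Gen path_Cons(2) c g by (auto simp: m_assoc)
    next
      case False
      then show ?thesis using IH t_Gen path_Cons(2) c g by (auto simp: m_assoc)
    qed
  next
    case (t_B k b)
    then show ?thesis using IH path_Cons(2) g
      by (cases b) (auto simp: replicate_app_Cons_same)
  next
    case (t_C k b)
    have "val (replicate (Suc k) B @ C # x) = val (replicate k B @ x)"
    proof -
      have "val (B # C # x) = val x" by (cases "val x") simp
      then have "val (replicate k B @ B # C # x) = val (replicate k B @ x)"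
        by (induction k) auto
      then show ?thesis by (simp add: replicate_app_Cons_same)
    qed
    then show ?thesis using IH t_C path_Cons(2) g by (cases b) auto
  next
    case (t_Dyck b)
    from path_Cons(2) obtain p where p: "y \<in> lists \<Sigma>" "val y = (0, p, 0)" "p \<in> carrier M" "(\<phi> ^^ n) p = a"
      unfolding t_Dyck by (rule DyckE)
    show ?thesis
    proof (cases b)
      case True
      have "val (replicate n B @ y @ x) = act (Gen a) (val (replicate n B @ x))"
        using val_replicate_B_append[OF p(1,2) x] p(4) by simp
      then show ?thesis using IH True t_Dyck p g by (auto simp: m_assoc)
    next
      case False
      then show ?thesis using IH t_Dyck p x g by (auto simp: val_append_\<Sigma> m_assoc)
    qed
  next
    case (t_end l)
    then show ?thesis using IH path_Cons(2) by auto
  next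
    case t_inner
    then show ?thesis using IH path_Cons(2) g by auto
  qed
qed simp

lemma path_sound_Start:
  assumes "path delta (Start f i) x us (End g j)" "g \<in> F"
  obtains m where "m \<in> carrier M" "val x = (i, m, j)" "word_prod M us = f \<otimes> (m \<otimes> g)"
  using path_sound[OF assms(1) HOL.refl assms(2)] by auto

text \<open>The interior of a bracket is read one level higher, so the level varies in the
  induction. At level n the recursion stops: a factor that begins with a bracket is read whole by
  \<open>t_Dyck\<close>.\<close>

lemma path_dyck:
  assumes "dyck d" "d \<in> lists \<Sigma>" "val d = (0, p, 0)" "k \<le> n"
  shows "\<exists>us. path delta (Level b k) d us (Level b k) \<and> word_prod M us = (\<phi> ^^ k) p"
  using assms
proof (induction arbitrary: p k)
  case dyck_Nil
  then show ?case by (auto intro!: exI[of _ "[]"] path.intros)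
next
  case (dyck_Gen w a)
  obtain q where q: "val w = (0, q, 0)" "q \<in> carrier M" using dyck_val[OF dyck_Gen(1)] dyck_Gen.prems(1) by auto
  then obtain us where us: "path delta (Level b k) w us (Level b k)" "word_prod M us = (\<phi> ^^ k) q"
    using dyck_Gen by fastforce
  have a: "a \<in> Y" "a \<in> carrier M" using dyck_Gen Y_closed by auto
  have "path delta (Level b k) ([Gen a] @ w) ((\<phi> ^^ k) a # us) (Level b k)"
    using path_step[OF t_Gen[OF a(1) dyck_Gen.prems(3)] us(1)] .
  moreover have "word_prod M ((\<phi> ^^ k) a # us) = (\<phi> ^^ k) p" using us(2) q a dyck_Gen.prems by auto
  ultimately show ?case by (intro exI[of _ "(\<phi> ^^ k) a # us"]) simp
next
  case (dyck_BC u w)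
  show ?case
  proof (cases "k = n")
    case True
    have "p \<in> carrier M" using val_carrier[OF dyck_BC.prems(1,2)] .
    then have "path delta (Level b n) (B # u @ C # w) [(\<phi> ^^ n) p] (Level b n)"
      by (intro path_single[OF t_Dyck] DyckI dyck_BC.prems) auto
    then show ?thesis using True \<open>p \<in> carrier M\<close> by (intro exI[of _ "[(\<phi> ^^ n) p]"]) simp
  next
    case False
    then have k: "k < n" using dyck_BC.prems by simp
    have l: "u \<in> lists \<Sigma>" "w \<in> lists \<Sigma>" using dyck_BC.prems by auto
    obtain r where r: "val u = (0, r, 0)" "r \<in> carrier M" using dyck_val[OF dyck_BC(1) l(1)] by auto
    obtain q where q: "val w = (0, q, 0)" "q \<in> carrier M" using dyck_val[OF dyck_BC(2) l(2)] by auto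
    have p: "p = \<phi> r \<otimes> q" using val_dyck_C[OF l r(1) q(1)] dyck_BC.prems(2) by simp
    obtain us where us: "path delta (Level b (Suc k)) u us (Level b (Suc k))" "word_prod M us = (\<phi> ^^ Suc k) r"
      using dyck_BC.IH(1)[OF l(1) r(1) Suc_leI[OF k]] by blast
    obtain vs where vs: "path delta (Level b k) w vs (Level b k)" "word_prod M vs = (\<phi> ^^ k) q"
      using dyck_BC.IH(2)[OF l(2) q(1) dyck_BC.prems(3)] by blast
    have "path delta (Level b k) ([B] @ u @ [C] @ w) (\<one> # us @ \<one> # vs) (Level b k)"
      by (intro path_step[OF t_B[OF k]] path_append[OF us(1)] path_step[OF t_C[OF k]] vs(1))
    moreover have "word_prod M (\<one> # us @ \<one> # vs) = (\<phi> ^^ k) p"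
      using us(2) vs(2) r q p path_output_carrier[OF us(1)] path_output_carrier[OF vs(1)]
      by (simp add: word_prod_append phi_phi_pow_swap)
    ultimately show ?thesis by (intro exI[of _ "\<one> # us @ \<one> # vs"]) simp
  qed
qed

text \<open>Each unmatched c lowers the level by one, and the balanced factor before it is read at
  the level given by the unmatched c's still ahead. The run stops right after the last of
  them.\<close>

lemma path_descend:
  assumes "x \<in> lists \<Sigma>" "val x = (i, m, j)" "i \<le> n"
  shows "\<exists>x1 x2 us m2. x = x1 @ x2 \<and> path delta (Level False i) x1 us (Level False 0) \<and>
    val x2 = (0, m2, j) \<and> m2 \<in> carrier M \<and> m = word_prod M us \<otimes> m2"
  using assms
proof (induction i arbitrary: x m)
  case 0
  have "m \<in> carrier M" using val_carrier[OF 0(1,2)] .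
  then show ?case using 0
    by (intro exI[of _ "[]"] exI[of _ x] exI[of _ m]) (auto intro: path.intros)
next
  case (Suc i)
  from Suc.prems(1,2) obtain d y p m' where y: "x = d @ C # y" "dyck d" "d \<in> lists \<Sigma>" "y \<in> lists \<Sigma>" "p \<in> carrier M"
    "m' \<in> carrier M" "val d = (0, p, 0)" "val y = (i, m', j)" "m = (\<phi> ^^ Suc i) p \<otimes> m'" by (rule split_C)
  obtain us where us: "path delta (Level False (Suc i)) d us (Level False (Suc i))"
    "word_prod M us = (\<phi> ^^ Suc i) p" using path_dyck[OF y(2,3,7) Suc.prems(3)] by blast
  obtain y1 y2 vs m2 where v: "y = y1 @ y2" "path delta (Level False i) y1 vs (Level False 0)"
    "val y2 = (0, m2, j)" "m2 \<in> carrier M" "m' = word_prod M vs \<otimes> m2"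
    using Suc.IH[OF y(4,8)] Suc.prems(3) by auto
  have "i < n" using Suc.prems by simp
  then have "path delta (Level False (Suc i)) (d @ [C] @ y1) (us @ \<one> # vs) (Level False 0)"
    by (intro path_append[OF us(1)] path_step[OF t_C] v(2))
  moreover have "m = word_prod M (us @ \<one> # vs) \<otimes> m2"
    using us(2) v(4,5) y(9) path_output_carrier[OF us(1)] path_output_carrier[OF v(2)] y(5)
    by (simp add: word_prod_append m_assoc del: funpow.simps)
  ultimately show ?case using y(1) v(1,3,4)
    by (intro exI[of _ "d @ [C] @ y1"] exI[of _ y2]) auto
qed

text \<open>Each unmatched b raises the level. The run stops after l of them, so the unread rest
  \<open>x2\<close> still enters the product with \<phi>^(k + l).\<close>

lemma path_ascend:
  assumes "x \<in> lists \<Sigma>" "val x = (0, m, l + j)" "k + l \<le> n"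
  shows "\<exists>x1 x2 us m2. x = x1 @ x2 \<and> path delta (Level True k) x1 us (Level True (k + l)) \<and>
    val x2 = (0, m2, j) \<and> m2 \<in> carrier M \<and> x2 \<in> lists \<Sigma> \<and> (\<phi> ^^ k) m = word_prod M us \<otimes> (\<phi> ^^ (k + l)) m2"
  using assms
proof (induction l arbitrary: x m k)
  case 0
  have "m \<in> carrier M" using val_carrier[OF 0(1,2)] .
  then show ?case using 0
    by (intro exI[of _ "[]"] exI[of _ x] exI[of _ m]) (auto intro: path.intros)
next
  case (Suc l)
  have "val x = (0, m, Suc (l + j))" using Suc.prems(2) by simp
  with Suc.prems(1) obtain d y p m' where y: "x = d @ B # y" "dyck d" "d \<in> lists \<Sigma>" "y \<in> lists \<Sigma>" "p \<in> carrier M"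
    "m' \<in> carrier M" "val d = (0, p, 0)" "val y = (0, m', l + j)" "m = p \<otimes> \<phi> m'"
    by (rule split_B)
  obtain us where us: "path delta (Level True k) d us (Level True k)"
    "word_prod M us = (\<phi> ^^ k) p" using path_dyck[OF y(2,3,7), of k True] Suc.prems(3) by auto
  obtain y1 y2 vs m2 where v: "y = y1 @ y2" "path delta (Level True (Suc k)) y1 vs (Level True (Suc k + l))"
    "val y2 = (0, m2, j)" "m2 \<in> carrier M" "y2 \<in> lists \<Sigma>"
    "(\<phi> ^^ Suc k) m' = word_prod M vs \<otimes> (\<phi> ^^ (Suc k + l)) m2"
    using Suc.IH[OF y(4,8), of "Suc k"] Suc.prems(3) by auto
  have "k < n" using Suc.prems by simp
  then have "path delta (Level True k) (d @ [B] @ y1) (us @ \<one> # vs) (Level True (Suc k + l))"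
    by (intro path_append[OF us(1)] path_step[OF t_B] v(2))
  moreover have "(\<phi> ^^ k) m = word_prod M (us @ \<one> # vs) \<otimes> (\<phi> ^^ (Suc k + l)) m2"
  proof -
    have "(\<phi> ^^ k) m = (\<phi> ^^ k) p \<otimes> (\<phi> ^^ Suc k) m'" using y by (simp add: funpow_swap1)
    also have "\<dots> = word_prod M us \<otimes> (word_prod M vs \<otimes> (\<phi> ^^ (Suc k + l)) m2)" unfolding us(2) v(6) ..
    finally show ?thesis
      using path_output_carrier[OF us(1)] path_output_carrier[OF v(2)] v(4)
      by (simp add: word_prod_append m_assoc del: funpow.simps)
  qed
  ultimately show ?case using y(1) v(1,3,4,5)
    by (intro exI[of _ "d @ [B] @ y1"] exI[of _ y2] exI[of _ "us @ \<one> # vs"] exI[of _ m2]) simp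
qed

lemma path_Start:
  assumes "x \<in> lists \<Sigma>" "val x = (i, m, l + j)" "i \<le> n" "l \<le> n" "f \<in> F"
  shows "\<exists>x1 x2 us m2. x = x1 @ x2 \<and> path delta (Start f i) x1 us (Level True l) \<and>
    val x2 = (0, m2, j) \<and> m2 \<in> carrier M \<and> x2 \<in> lists \<Sigma> \<and> word_prod M us \<otimes> (\<phi> ^^ l) m2 = f \<otimes> m"
proof -
  obtain x1 y us m1 where 1: "x = x1 @ y" "path delta (Level False i) x1 us (Level False 0)"
    "val y = (0, m1, l + j)" "m1 \<in> carrier M" "m = word_prod M us \<otimes> m1"
    using path_descend[OF assms(1-3)] by blast
  have "y \<in> lists \<Sigma>" using assms(1) 1(1) by simp
  then obtain y1 y2 vs m2 where 2: "y = y1 @ y2" "path delta (Level True 0) y1 vs (Level True l)"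
    "val y2 = (0, m2, j)" "m2 \<in> carrier M" "y2 \<in> lists \<Sigma>" "m1 = word_prod M vs \<otimes> (\<phi> ^^ l) m2"
    using path_ascend[OF _ 1(3), of 0] assms(4) by auto
  have "path delta (Start f i) ([] @ x1 @ [] @ y1) (f # us @ \<one> # vs) (Level True l)"
    by (intro path_step[OF t_start] path_append[OF 1(2)] path_step[OF t_switch] 2(2) assms)
  moreover have "word_prod M (f # us @ \<one> # vs) \<otimes> (\<phi> ^^ l) m2 = f \<otimes> m"
    using 1(5) 2(4,6) path_output_carrier[OF 1(2)] path_output_carrier[OF 2(2)] F_closed[OF assms(5)]
    by (simp add: word_prod_append m_assoc)
  ultimately show ?thesis using 1(1) 2
    by (intro exI[of _ "x1 @ y1"] exI[of _ y2] exI[of _ "f # us @ \<one> # vs"] exI[of _ m2]) simp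
qed

lemma path_Start_End:
  assumes "x \<in> lists \<Sigma>" "val x = (i, m, j)" "i \<le> n" "j < n" "f \<in> F"
  shows "\<exists>us. path delta (Start f i) x us (End \<one> j) \<and> word_prod M us = f \<otimes> m"
proof -
  obtain x1 x2 us m2 where 1: "x = x1 @ x2" "path delta (Start f i) x1 us (Level True j)"
    "val x2 = (0, m2, 0)" "m2 \<in> carrier M" "x2 \<in> lists \<Sigma>" "word_prod M us \<otimes> (\<phi> ^^ j) m2 = f \<otimes> m"
    using path_Start[of x i m j 0 f] assms by auto
  obtain vs where 2: "path delta (Level True j) x2 vs (Level True j)" "word_prod M vs = (\<phi> ^^ j) m2"
    using path_dyck[OF _ 1(5,3)] dyck_iff_val[OF 1(5)] 1(3) assms(4) by (metis less_imp_le)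
  have "path delta (Start f i) (x1 @ x2 @ [] @ []) (us @ vs @ [\<one>]) (End \<one> j)"
    by (intro path_append[OF 1(2)] path_append[OF 2(1)] path_step[OF t_end] path_Nil assms)
  moreover have "word_prod M (us @ vs @ [\<one>]) = f \<otimes> m"
    using 1(4,6) 2(2) path_output_carrier[OF 1(2)] path_output_carrier[OF 2(1)]
    by (simp add: word_prod_append)
  ultimately show ?thesis using 1(1) by auto
qed

text \<open>Only the first n unmatched b's are read. The rest contributes \<phi>^n(m2), an element
  of F, which is emitted as one final letter in place of reading \<open>x2\<close>.\<close>

lemma path_Start_End_inner:
  assumes "x \<in> lists \<Sigma>" "val x = (i, m, n + j)" "i \<le> n" "f \<in> F"
  shows "\<exists>x1 x2 us m2. x = x1 @ x2 \<and> path delta (Start f i) x1 us (End ((\<phi> ^^ n) m2) n) \<and>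
    val x2 = (0, m2, j) \<and> m2 \<in> carrier M \<and> x2 \<in> lists \<Sigma> \<and> word_prod M us = f \<otimes> m"
proof -
  obtain x1 x2 us m2 where 1: "x = x1 @ x2" "path delta (Start f i) x1 us (Level True n)"
    "val x2 = (0, m2, j)" "m2 \<in> carrier M" "x2 \<in> lists \<Sigma>" "word_prod M us \<otimes> (\<phi> ^^ n) m2 = f \<otimes> m"
    using path_Start[of x i m n j f] assms by auto
  have "path delta (Start f i) (x1 @ [] @ []) (us @ [(\<phi> ^^ n) m2]) (End ((\<phi> ^^ n) m2) n)"
    by (intro path_append[OF 1(2)] path_step[OF t_inner] path_Nil imageI 1)
  moreover have "word_prod M (us @ [(\<phi> ^^ n) m2]) = f \<otimes> m"
    using 1(4,6) path_output_carrier[OF 1(2)] by (simp add: word_prod_append)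
  ultimately show ?thesis using 1 by (intro exI[of _ x1] exI[of _ x2] exI[of _ "us @ [(\<phi> ^^ n) m2]"] exI[of _ m2]) simp
qed

end

section \<open>Assembling the word problem of the extension\<close>

context bruck_reilly_finite
begin

text \<open>The factors f and f' stand for the parts of the two words already split off on the
  outside, moved past the unmatched c's; the M-components have to agree only after multiplication
  with them.\<close>

definition Mid :: "'a \<Rightarrow> 'a \<Rightarrow> nat \<Rightarrow> 'a brgen option list set" where
  "Mid f f' i = pair_lang \<Sigma> (\<lambda>x y. \<exists>m m' j. val x = (i, m, j) \<and> val y = (i, m', j) \<and> f \<otimes> m = f' \<otimes> m')"

lemma MidI:
  "x \<in> lists \<Sigma> \<Longrightarrow> y \<in> lists \<Sigma> \<Longrightarrow> val x = (i, m, j) \<Longrightarrow> val y = (i, m', j) \<Longrightarrow> f \<otimes> m = f' \<otimes> m' \<Longrightarrow>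
    map Some x @ [None] @ rev (map Some y) \<in> Mid f f' i"
  unfolding Mid_def pair_lang_iff by simp

lemma MidE:
  assumes "w \<in> Mid f f' i"
  obtains x y m m' j where "w = map Some x @ [None] @ rev (map Some y)" "x \<in> lists \<Sigma>" "y \<in> lists \<Sigma>"
    "val x = (i, m, j)" "val y = (i, m', j)" "f \<otimes> m = f' \<otimes> m'"
  using assms unfolding Mid_def by (elim pair_langE exE conjE) (rule that)

lemma InnerE:
  assumes "w \<in> Inner g g'"
  obtains x y p p' l where "w = map Some x @ [None] @ rev (map Some y)" "x \<in> lists \<Sigma>" "y \<in> lists \<Sigma>"
    "val x = (0, p, l)" "val y = (0, p', l)" "(\<phi> ^^ n) p = g" "(\<phi> ^^ n) p' = g'"
  using assms unfolding Inner_def by (elim pair_langE exE conjE) (rule that)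

lemma val_append_level:
  "x \<in> lists \<Sigma> \<Longrightarrow> y \<in> lists \<Sigma> \<Longrightarrow> val x = (i, m, k) \<Longrightarrow> val y = (0, p, l) \<Longrightarrow>
    val (x @ y) = (i, m \<otimes> (\<phi> ^^ k) p, l + k)"
  by (simp add: val_append_\<Sigma>)

text \<open>Both halves are run through \<open>delta\<close> and the outputs compared in the word
  problem of M. A run has finitely many states at its disposal, so unmatched b's beyond the n-th are
  left to the center.\<close>

lemma context_free_Mid:
  assumes K: "context_free (pair_lang Y (\<lambda>u v. word_prod M u = word_prod M v))"
    and f: "f \<in> F" "f' \<in> F" and i: "i \<le> n"
  shows "context_free (Mid f f' i)"
proof -
  \<comment> \<open>For j < n unmatched b's both runs end with the same j around a bare separator.
    From n on they end at level n, and the center is the language \<open>Inner g g'\<close> for the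
    guessed classes.\<close>
  define Z :: "('a state \<times> 'a brgen option list set \<times> 'a state) set" where
    "Z = (\<lambda>j. (End \<one> j, {[None]}, End \<one> j)) ` {..<n} \<union> (\<lambda>(g, g'). (End g n, Inner g g', End g' n)) ` (F \<times> F)"
  have Z_cases: "(\<exists>j < n. z = End \<one> j \<and> z' = End \<one> j \<and> L = {[None]}) \<or>
      (\<exists>g \<in> F. \<exists>g' \<in> F. z = End g n \<and> z' = End g' n \<and> L = Inner g g')" if "(z, L, z') \<in> Z" for z L z'
    using that unfolding Z_def by auto
  have Z_end: "(End \<one> j, {[None]}, End \<one> j) \<in> Z" if "j < n" for j using that unfolding Z_def by simp
  have Z_inner: "(End g n, Inner g g', End g' n) \<in> Z" if "g \<in> F" "g' \<in> F" for g g'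
    unfolding Z_def by (rule UnI2, rule image_eqI[of _ _ "(g, g')"]) (use that in auto)
  define G where "G x l y \<longleftrightarrow> (\<exists>us vs z z' L. path delta (Start f i) x us z \<and> path delta (Start f' i) y vs z' \<and>
    (z, L, z') \<in> Z \<and> l \<in> L \<and>
    map Some us @ [None] @ rev (map Some vs) \<in> pair_lang Y (\<lambda>u v. word_prod M u = word_prod M v))" for x l y
  have "finite Z" unfolding Z_def using finite_F by simp
  then have "context_free {map Some x @ l @ rev (map Some y) | x l y. G x l y}"
    unfolding G_def
    by (intro context_free_pair_transduction finite_delta K)
      (auto dest!: Z_cases intro: context_free_delta context_free_singleton context_free_Inner)
  moreover have "{map Some x @ l @ rev (map Some y) | x l y. G x l y} = Mid f f' i"
  proof (intro equalityI subsetI)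
    fix w assume "w \<in> {map Some x @ l @ rev (map Some y) | x l y. G x l y}"
    then obtain x l y where w: "w = map Some x @ l @ rev (map Some y)" and "G x l y" by blast
    then obtain us vs z z' L where p: "path delta (Start f i) x us z" "path delta (Start f' i) y vs z'"
      and Z: "(z, L, z') \<in> Z" "l \<in> L" and "map Some us @ [None] @ rev (map Some vs) \<in> pair_lang Y (\<lambda>u v. word_prod M u = word_prod M v)"
      unfolding G_def by blast
    then have eq: "word_prod M us = word_prod M vs" unfolding pair_lang_iff by simp
    have xy: "x \<in> lists \<Sigma>" "y \<in> lists \<Sigma>" using path_input p by blast+
    from Z_cases[OF Z(1)] show "w \<in> Mid f f' i"
    proof (elim disjE exE bexE conjE)
      fix j assume z: "z = End \<one> j" "z' = End \<one> j" "L = {[None]}"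
      obtain m where m: "m \<in> carrier M" "val x = (i, m, j)" "word_prod M us = f \<otimes> (m \<otimes> \<one>)"
        using path_sound_Start[OF p(1)[unfolded z(1)] one_F] .
      obtain m' where m': "m' \<in> carrier M" "val y = (i, m', j)" "word_prod M vs = f' \<otimes> (m' \<otimes> \<one>)"
        using path_sound_Start[OF p(2)[unfolded z(2)] one_F] .
      have "f \<otimes> m = f' \<otimes> m'" using eq m m' by simp
      from MidI[OF xy m(2) m'(2) this] show ?thesis using w z Z by simp
    next
      fix g g' assume g: "g \<in> F" "g' \<in> F" and z: "z = End g n" "z' = End g' n" "L = Inner g g'"
      obtain m where m: "m \<in> carrier M" "val x = (i, m, n)" "word_prod M us = f \<otimes> (m \<otimes> g)"
        using path_sound_Start[OF p(1)[unfolded z(1)] g(1)] .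
      obtain m' where m': "m' \<in> carrier M" "val y = (i, m', n)" "word_prod M vs = f' \<otimes> (m' \<otimes> g')"
        using path_sound_Start[OF p(2)[unfolded z(2)] g(2)] .
      from Z(2)[unfolded z(3)] obtain x2 y2 q q' k where l: "l = map Some x2 @ [None] @ rev (map Some y2)"
        "x2 \<in> lists \<Sigma>" "y2 \<in> lists \<Sigma>" "val x2 = (0, q, k)" "val y2 = (0, q', k)" "(\<phi> ^^ n) q = g" "(\<phi> ^^ n) q' = g'"
        by (rule InnerE)
      \<comment> \<open>The unread factor is multiplied through n pending b's, so it enters as
        \<phi>^n(q) = g, the letter already emitted by the run.\<close>
      have "val (x @ x2) = (i, m \<otimes> g, k + n)" "val (y @ y2) = (i, m' \<otimes> g', k + n)"
        using val_append_level[OF xy(1) l(2) m(2) l(4)] val_append_level[OF xy(2) l(3) m'(2) l(5)] l(6,7) by simp_all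
      moreover have "f \<otimes> (m \<otimes> g) = f' \<otimes> (m' \<otimes> g')" using eq m(3) m'(3) by simp
      ultimately have "map Some (x @ x2) @ [None] @ rev (map Some (y @ y2)) \<in> Mid f f' i"
        using xy l(2,3) by (intro MidI) auto
      then show ?thesis unfolding w l(1) by simp
    qed
  next
    fix w assume "w \<in> Mid f f' i"
    then obtain x y m m' j where w: "w = map Some x @ [None] @ rev (map Some y)" and xy: "x \<in> lists \<Sigma>" "y \<in> lists \<Sigma>"
      and v: "val x = (i, m, j)" "val y = (i, m', j)" and eq: "f \<otimes> m = f' \<otimes> m'" by (rule MidE)
    show "w \<in> {map Some x @ l @ rev (map Some y) | x l y. G x l y}"
    proof (cases "j < n")
      case True
      obtain us where us: "path delta (Start f i) x us (End \<one> j)" "word_prod M us = f \<otimes> m"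
        using path_Start_End[OF xy(1) v(1) i True f(1)] by blast
      obtain vs where vs: "path delta (Start f' i) y vs (End \<one> j)" "word_prod M vs = f' \<otimes> m'"
        using path_Start_End[OF xy(2) v(2) i True f(2)] by blast
      have "map Some us @ [None] @ rev (map Some vs) \<in> pair_lang Y (\<lambda>u v. word_prod M u = word_prod M v)"
        unfolding pair_lang_iff using path_output[OF us(1)] path_output[OF vs(1)] us(2) vs(2) eq by simp
      then have "G x [None] y" unfolding G_def using us(1) vs(1) Z_end[OF True] by blast
      then show ?thesis using w by blast
    next
      case False
      then obtain k where k: "j = n + k" using le_Suc_ex by (metis not_le)
      obtain x1 x2 us p where x: "x = x1 @ x2" "path delta (Start f i) x1 us (End ((\<phi> ^^ n) p) n)"
        "val x2 = (0, p, k)" "p \<in> carrier M" "x2 \<in> lists \<Sigma>" "word_prod M us = f \<otimes> m"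
        using path_Start_End_inner[OF xy(1) v(1)[unfolded k] i f(1)] by blast
      obtain y1 y2 vs q where y: "y = y1 @ y2" "path delta (Start f' i) y1 vs (End ((\<phi> ^^ n) q) n)"
        "val y2 = (0, q, k)" "q \<in> carrier M" "y2 \<in> lists \<Sigma>" "word_prod M vs = f' \<otimes> m'"
        using path_Start_End_inner[OF xy(2) v(2)[unfolded k] i f(2)] by blast
      have "map Some us @ [None] @ rev (map Some vs) \<in> pair_lang Y (\<lambda>u v. word_prod M u = word_prod M v)"
        unfolding pair_lang_iff using path_output[OF x(2)] path_output[OF y(2)] x(6) y(6) eq by simp
      moreover have "map Some x2 @ [None] @ rev (map Some y2) \<in> Inner ((\<phi> ^^ n) p) ((\<phi> ^^ n) q)"
        unfolding Inner_def pair_lang_iff using x y by simp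
      moreover have "(End ((\<phi> ^^ n) p) n, Inner ((\<phi> ^^ n) p) ((\<phi> ^^ n) q), End ((\<phi> ^^ n) q) n) \<in> Z"
        by (intro Z_inner imageI x y)
      ultimately have "G x1 (map Some x2 @ [None] @ rev (map Some y2)) y1"
        unfolding G_def using x(2) y(2) by blast
      moreover have "w = map Some x1 @ (map Some x2 @ [None] @ rev (map Some y2)) @ rev (map Some y1)"
        unfolding w x(1) y(1) by simp
      ultimately show ?thesis by blast
    qed
  qed
  ultimately show ?thesis by simp
qed

text \<open>k counts the unmatched c's beyond n. The factors f, f' lie in F when used: they have
  already been moved past n of the c's, so only \<phi>^k is still to be applied.\<close>

definition Outer :: "'a \<Rightarrow> 'a \<Rightarrow> 'a brgen option list set" where
  "Outer f f' = pair_lang \<Sigma> (\<lambda>x y. \<exists>k m m' j. val x = (k + n, m, j) \<and> val y = (k + n, m', j) \<and>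
    (\<phi> ^^ k) f \<otimes> m = (\<phi> ^^ k) f' \<otimes> m')"

lemma OuterI:
  "x \<in> lists \<Sigma> \<Longrightarrow> y \<in> lists \<Sigma> \<Longrightarrow> val x = (k + n, m, j) \<Longrightarrow> val y = (k + n, m', j) \<Longrightarrow>
    (\<phi> ^^ k) f \<otimes> m = (\<phi> ^^ k) f' \<otimes> m' \<Longrightarrow> map Some x @ [None] @ rev (map Some y) \<in> Outer f f'"
  unfolding Outer_def pair_lang_iff by auto

lemma OuterE:
  assumes "w \<in> Outer f f'"
  obtains x y k m m' j where "w = map Some x @ [None] @ rev (map Some y)" "x \<in> lists \<Sigma>" "y \<in> lists \<Sigma>"
    "val x = (k + n, m, j)" "val y = (k + n, m', j)" "(\<phi> ^^ k) f \<otimes> m = (\<phi> ^^ k) f' \<otimes> m'"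
  using assms unfolding Outer_def by (elim pair_langE exE conjE) (rule that)

text \<open>Moving the outermost unmatched \<open>c\<close> and the \<open>Dyck\<close> prefix in front of it into the factor \<open>f\<close>.\<close>

lemma outer_factor:
  assumes "f \<in> carrier M" "p \<in> carrier M" "m \<in> carrier M"
  shows "(\<phi> ^^ Suc k) f \<otimes> ((\<phi> ^^ Suc (k + n)) p \<otimes> m) = (\<phi> ^^ k) (\<phi> (f \<otimes> (\<phi> ^^ n) p)) \<otimes> m"
  using assms by (simp add: m_assoc phi_pow_add phi_phi_pow_swap)

text \<open>A nonterminal \<open>Some (f, f')\<close> generates \<open>Outer f f'\<close>. A
  recursive production generates the outermost unmatched c of both words with the balanced prefixes
  before them, and updates f to \<phi>(f g), again in F. With exactly n unmatched c's left,
  \<open>Mid f f' n\<close> takes over; words with fewer than n are delegated to \<open>Mid\<close>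
  directly from the start symbol \<open>None\<close>.\<close>

lemma context_free_val_pairs:
  assumes K: "context_free (pair_lang Y (\<lambda>u v. word_prod M u = word_prod M v))"
  shows "context_free (pair_lang \<Sigma> (\<lambda>u v. val u = val v))"
proof -
  define P :: "(('a \<times> 'a) option \<times> (('a \<times> 'a) option + 'a brgen option list set) list) set" where
    "P = (\<lambda>i. (None, [Inr (Mid \<one> \<one> i)])) ` {..<n} \<union> {(None, [Inl (Some (\<one>, \<one>))])}
      \<union> (\<lambda>(f, f'). (Some (f, f'), [Inr (Mid f f' n)])) ` (F \<times> F)
      \<union> (\<lambda>((f, f'), (g, g')). (Some (f, f'), [Inr (SDyck g), Inr {[Some C]},
          Inl (Some (\<phi> (f \<otimes> g), \<phi> (f' \<otimes> g'))), Inr {[Some C]}, Inr (RDyck g')])) ` ((F \<times> F) \<times> (F \<times> F))"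
  have "finite P" unfolding P_def using finite_F by simp
  have P_cases: "(\<exists>i < n. N = None \<and> rhs = [Inr (Mid \<one> \<one> i)]) \<or> N = None \<and> rhs = [Inl (Some (\<one>, \<one>))] \<or>
      (\<exists>f \<in> F. \<exists>f' \<in> F. N = Some (f, f') \<and> rhs = [Inr (Mid f f' n)]) \<or>
      (\<exists>f \<in> F. \<exists>f' \<in> F. \<exists>g \<in> F. \<exists>g' \<in> F. N = Some (f, f') \<and> rhs = [Inr (SDyck g), Inr {[Some C]},
          Inl (Some (\<phi> (f \<otimes> g), \<phi> (f' \<otimes> g'))), Inr {[Some C]}, Inr (RDyck g')])"
    if NP: "(N, rhs) \<in> P" for N rhs
    using NP unfolding P_def
  proof (elim UnE imageE)
    fix i assume "(N, rhs) = (None, [Inr (Mid \<one> \<one> i)])" "i \<in> {..<n}"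
    then show ?thesis by blast
  next
    fix t assume *: "(N, rhs) = (case t of (f, f') \<Rightarrow> (Some (f, f'), [Inr (Mid f f' n)]))" "t \<in> F \<times> F"
    obtain f f' where t: "t = (f, f')" by (cases t)
    with *(2) have "f \<in> F" "f' \<in> F" by blast+
    moreover have "N = Some (f, f') \<and> rhs = [Inr (Mid f f' n)]" using *(1) unfolding t by simp
    ultimately show ?thesis by blast
  next
    fix t assume *: "(N, rhs) = (\<lambda>((f, f'), (g, g')). (Some (f, f'), [Inr (SDyck g), Inr {[Some C]},
          Inl (Some (\<phi> (f \<otimes> g), \<phi> (f' \<otimes> g'))), Inr {[Some C]}, Inr (RDyck g')])) t" "t \<in> (F \<times> F) \<times> (F \<times> F)"
    obtain f f' g g' where t: "t = ((f, f'), (g, g'))" by (metis surj_pair)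
    with *(2) have "f \<in> F" "f' \<in> F" "g \<in> F" "g' \<in> F" by blast+
    moreover have "N = Some (f, f') \<and> rhs = [Inr (SDyck g), Inr {[Some C]},
          Inl (Some (\<phi> (f \<otimes> g), \<phi> (f' \<otimes> g'))), Inr {[Some C]}, Inr (RDyck g')]" using *(1) unfolding t by simp
    ultimately show ?thesis by blast
  qed simp_all
  let ?T = "pair_lang \<Sigma> (\<lambda>u v. val u = val v)"
  let ?I = "\<lambda>N. case N of None \<Rightarrow> ?T | Some (f, f') \<Rightarrow> Outer f f'"
  have sound: "sem ?I rhs \<subseteq> ?I N" if "(N, rhs) \<in> P" for N rhs
    using P_cases[OF that]
  proof (elim disjE exE bexE conjE)
    fix i assume *: "N = None" "rhs = [Inr (Mid \<one> \<one> i)]"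
    have "w \<in> ?T" if "w \<in> Mid \<one> \<one> i" for w
      using that
    proof (rule MidE)
      fix x y m m' j
      assume **: "w = map Some x @ [None] @ rev (map Some y)" "x \<in> lists \<Sigma>" "y \<in> lists \<Sigma>"
        "val x = (i, m, j)" "val y = (i, m', j)" "\<one> \<otimes> m = \<one> \<otimes> m'"
      then have "m = m'" using val_carrier by (metis l_one)
      then show ?thesis unfolding **(1) pair_lang_iff using ** by simp
    qed
    then show ?thesis using * by (auto simp: conc_def)
  next
    assume *: "N = None" "rhs = [Inl (Some (\<one>, \<one>))]"
    have "w \<in> ?T" if "w \<in> Outer \<one> \<one>" for w
      using that
    proof (rule OuterE)
      fix x y k m m' j
      assume **: "w = map Some x @ [None] @ rev (map Some y)" "x \<in> lists \<Sigma>" "y \<in> lists \<Sigma>"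
        "val x = (k + n, m, j)" "val y = (k + n, m', j)" "(\<phi> ^^ k) \<one> \<otimes> m = (\<phi> ^^ k) \<one> \<otimes> m'"
      then have "m = m'" using val_carrier by (metis l_one phi_pow_one)
      then show ?thesis unfolding **(1) pair_lang_iff using ** by simp
    qed
    then show ?thesis using * by (auto simp: conc_def)
  next
    fix f f' assume *: "N = Some (f, f')" "rhs = [Inr (Mid f f' n)]"
    have "w \<in> Outer f f'" if "w \<in> Mid f f' n" for w
      using that
    proof (rule MidE)
      fix x y m m' j
      assume **: "w = map Some x @ [None] @ rev (map Some y)" "x \<in> lists \<Sigma>" "y \<in> lists \<Sigma>"
        "val x = (n, m, j)" "val y = (n, m', j)" "f \<otimes> m = f' \<otimes> m'"
      then show ?thesis unfolding **(1) by (intro OuterI[of _ _ 0]) auto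
    qed
    then show ?thesis using * by (auto simp: conc_def)
  next
    fix f f' g g' assume f: "f \<in> F" "f' \<in> F" and *: "N = Some (f, f')" "rhs = [Inr (SDyck g), Inr {[Some C]},
          Inl (Some (\<phi> (f \<otimes> g), \<phi> (f' \<otimes> g'))), Inr {[Some C]}, Inr (RDyck g')]"
    have "map Some d @ [Some C] @ w @ [Some C] @ rev (map Some d') \<in> Outer f f'"
      if d: "d \<in> Dyck g" "d' \<in> Dyck g'" and w: "w \<in> Outer (\<phi> (f \<otimes> g)) (\<phi> (f' \<otimes> g'))" for d d' w
    proof -
      from w obtain x y k m m' j where w: "w = map Some x @ [None] @ rev (map Some y)"
        and xy: "x \<in> lists \<Sigma>" "y \<in> lists \<Sigma>" and v: "val x = (k + n, m, j)" "val y = (k + n, m', j)"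
        and eq: "(\<phi> ^^ k) (\<phi> (f \<otimes> g)) \<otimes> m = (\<phi> ^^ k) (\<phi> (f' \<otimes> g')) \<otimes> m'" by (rule OuterE)
      have m: "m \<in> carrier M" "m' \<in> carrier M" using val_carrier[OF xy(1) v(1)] val_carrier[OF xy(2) v(2)] .
      from d(1) obtain p where p: "d \<in> lists \<Sigma>" "val d = (0, p, 0)" "p \<in> carrier M" "(\<phi> ^^ n) p = g"
        by (rule DyckE)
      from d(2) obtain p' where p': "d' \<in> lists \<Sigma>" "val d' = (0, p', 0)" "p' \<in> carrier M" "(\<phi> ^^ n) p' = g'"
        by (rule DyckE)
      have "map Some (d @ C # x) @ [None] @ rev (map Some (d' @ C # y)) \<in> Outer f f'"
      proof (rule OuterI)
        show "val (d @ C # x) = (Suc k + n, (\<phi> ^^ Suc (k + n)) p \<otimes> m, j)"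
          using val_dyck_C[OF p(1) xy(1) p(2) v(1)] by simp
        show "val (d' @ C # y) = (Suc k + n, (\<phi> ^^ Suc (k + n)) p' \<otimes> m', j)"
          using val_dyck_C[OF p'(1) xy(2) p'(2) v(2)] by simp
        show "(\<phi> ^^ Suc k) f \<otimes> ((\<phi> ^^ Suc (k + n)) p \<otimes> m) = (\<phi> ^^ Suc k) f' \<otimes> ((\<phi> ^^ Suc (k + n)) p' \<otimes> m')"
          unfolding outer_factor[OF F_closed[OF f(1)] p(3) m(1)] outer_factor[OF F_closed[OF f(2)] p'(3) m(2)] p(4) p'(4)
          by (rule eq)
      qed (use p p' xy in simp_all)
      then show ?thesis unfolding w by simp
    qed
    then show ?thesis using * by (auto simp: conc_def)
  qed
  have complete: "lderives P [Inl (Some (f, f'))] (map Some x @ [None] @ rev (map Some y))"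
    if "f \<in> F" "f' \<in> F" "x \<in> lists \<Sigma>" "y \<in> lists \<Sigma>" "val x = (k + n, m, j)" "val y = (k + n, m', j)"
      "(\<phi> ^^ k) f \<otimes> m = (\<phi> ^^ k) f' \<otimes> m'" for f f' x y k m m' j
    using that
  proof (induction k arbitrary: f f' x y m m')
    case 0
    have "(Some (f, f'), [Inr (Mid f f' n)]) \<in> P"
      unfolding P_def by (rule UnI1, rule UnI2, rule image_eqI[of _ _ "(f, f')"]) (use 0 in auto)
    moreover have "lderives P [Inr (Mid f f' n)] ((map Some x @ [None] @ rev (map Some y)) @ [])"
      using 0 by (intro lderives_Inr lderives_Nil MidI) auto
    ultimately show ?case by (auto intro: lderives_single)
  next
    case (Suc k)
    have v: "val x = (Suc (k + n), m, j)" "val y = (Suc (k + n), m', j)" using Suc.prems(5,6) by simp_all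
    from Suc.prems(3) v(1) obtain d x' p q where x: "x = d @ C # x'" "dyck d" "d \<in> lists \<Sigma>" "x' \<in> lists \<Sigma>"
      "p \<in> carrier M" "q \<in> carrier M" "val d = (0, p, 0)" "val x' = (k + n, q, j)" "m = (\<phi> ^^ Suc (k + n)) p \<otimes> q"
      by (rule split_C)
    from Suc.prems(4) v(2) obtain d' y' p' q' where y: "y = d' @ C # y'" "dyck d'" "d' \<in> lists \<Sigma>" "y' \<in> lists \<Sigma>"
      "p' \<in> carrier M" "q' \<in> carrier M" "val d' = (0, p', 0)" "val y' = (k + n, q', j)" "m' = (\<phi> ^^ Suc (k + n)) p' \<otimes> q'"
      by (rule split_C)
    let ?p = "(\<phi> ^^ n) p" and ?p' = "(\<phi> ^^ n) p'"
    let ?rhs = "[Inr (SDyck ?p), Inr {[Some C]}, Inl (Some (\<phi> (f \<otimes> ?p), \<phi> (f' \<otimes> ?p'))), Inr {[Some C]}, Inr (RDyck ?p')]"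
    have "(Some (f, f'), ?rhs) \<in> P"
      unfolding P_def by (rule UnI2, rule image_eqI[of _ _ "((f, f'), (?p, ?p'))"]) (use Suc.prems x y in auto)
    moreover have "lderives P ?rhs
      (map Some d @ [Some C] @ (map Some x' @ [None] @ rev (map Some y')) @ [Some C] @ rev (map Some d') @ [])"
    proof (intro lderives_Inr lderives_Nil lderives_Cons[OF Suc.IH] imageI DyckI x y singletonI phi_F mult_F Suc.prems)
      show "(\<phi> ^^ k) (\<phi> (f \<otimes> ?p)) \<otimes> q = (\<phi> ^^ k) (\<phi> (f' \<otimes> ?p')) \<otimes> q'"
        using Suc.prems(7)
        unfolding x(9) y(9) outer_factor[OF F_closed[OF Suc.prems(1)] x(5,6)]
          outer_factor[OF F_closed[OF Suc.prems(2)] y(5,6)] .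
    qed (fact x(8) y(8))+
    ultimately show ?case unfolding x(1) y(1) by (auto intro: lderives_single)
  qed
  have "lderives P [Inl None] w \<longleftrightarrow> w \<in> ?T" for w
  proof
    assume "lderives P [Inl None] w"
    then have "w \<in> sem ?I [Inl None]" by (rule lderives_sound) (rule sound)
    then show "w \<in> ?T" by (auto simp: conc_def)
  next
    assume "w \<in> ?T"
    then obtain x y where w: "w = map Some x @ [None] @ rev (map Some y)" and xy: "x \<in> lists \<Sigma>" "y \<in> lists \<Sigma>"
      and eq: "val x = val y" by (rule pair_langE)
    obtain i m j where x: "val x = (i, m, j)" by (cases "val x")
    with eq have y: "val y = (i, m, j)" by simp
    show "lderives P [Inl None] w"
    proof (cases "i < n")
      case True
      then have "(None, [Inr (Mid \<one> \<one> i)]) \<in> P" unfolding P_def by simp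
      moreover have "lderives P [Inr (Mid \<one> \<one> i)] (w @ [])"
        unfolding w using xy x y by (intro lderives_Inr lderives_Nil MidI) auto
      ultimately show ?thesis by (auto intro: lderives_single)
    next
      case False
      then have k: "i = (i - n) + n" by simp
      have "(None, [Inl (Some (\<one>, \<one>))]) \<in> P" unfolding P_def by simp
      moreover have "lderives P [Inl (Some (\<one>, \<one>))] w"
        unfolding w using k x y
        by (intro complete[OF one_F one_F xy, of "i - n" m j m]) auto
      ultimately show ?thesis by (rule lderives_single)
    qed
  qed
  moreover have "context_free {w. lderives P [Inl None] w}"
  proof (rule lderives_context_free[OF \<open>finite P\<close>])
    fix N rhs L assume "(N, rhs) \<in> P" "Inr L \<in> set rhs"
    with P_cases[OF this(1)] show "context_free L"
      by (elim disjE exE bexE conjE)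
        (auto simp del: image_iff intro: context_free_Mid[OF K] one_F context_free_singleton context_free_SDyck)
  qed
  ultimately show ?thesis by simp
qed

end

section \<open>The identity as a generator, and the equivalence\<close>

context bruck_reilly
begin

lemma filter_eq_append_split:
  "filter Q w = u @ v \<Longrightarrow> \<exists>w1 w2. w = w1 @ w2 \<and> filter Q w1 = u \<and> filter Q w2 = v"
proof (induction w arbitrary: u)
  case (Cons a w)
  show ?case
  proof (cases "Q a \<and> u \<noteq> []")
    case True
    with Cons.prems obtain u' where "u = a # u'" "filter Q w = u' @ v" by (cases u) auto
    with Cons.IH[of u'] True obtain w1 w2 where "w = w1 @ w2" "filter Q w1 = u'" "filter Q w2 = v" by blast
    then show ?thesis using True \<open>u = a # u'\<close> by (intro exI[of _ "a # w1"] exI[of _ w2]) simp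
  next
    case False
    show ?thesis
    proof (cases "Q a")
      case True
      then show ?thesis using False Cons.prems by (intro exI[of _ "[]"] exI[of _ "a # w"]) simp
    next
      case nQ: False
      with Cons.prems Cons.IH[of u] obtain w1 w2 where "w = w1 @ w2" "filter Q w1 = u" "filter Q w2 = v" by auto
      then show ?thesis using nQ by (intro exI[of _ "a # w1"] exI[of _ w2]) simp
    qed
  qed
qed simp

lemma word_prod_filter_one:
  "u \<in> lists (carrier M) \<Longrightarrow> word_prod M (filter (\<lambda>a. a \<noteq> \<one>) u) = word_prod M u"
  by (induction u) auto

text \<open>Over a given generating set the identity may have no nonempty spelling, but changing
  generators needs nonempty images. Adjoining the identity inserts arbitrary copies of it into the
  words of the word problem, which is covered by \<open>context_free_insert_neutral\<close>.\<close>

lemma UCF_one_generator: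
  assumes "UCF M"
  obtains X where "finite X" "generates M X" "\<one> \<in> X"
    "context_free (pair_lang X (\<lambda>u v. word_prod M u = word_prod M v))"
proof -
  from assms obtain X where X: "finite X" "generates M X"
    "context_free (pair_lang X (\<lambda>u v. word_prod M u = word_prod M v))"
    unfolding UCF_def word_problem_eq_pair_lang by blast
  show thesis
  proof (cases "\<one> \<in> X")
    case True
    with X that show ?thesis by blast
  next
    case False
    let ?X = "insert \<one> X" and ?K = "pair_lang X (\<lambda>u v. word_prod M u = word_prod M v)"
    have XM: "X \<subseteq> carrier M" and Xgen: "carrier M = word_prod M ` lists X"
      using X(2) unfolding generates_def by blast+
    have IM: "?X \<subseteq> carrier M" using XM by simp
    have "word_prod M ` lists ?X \<subseteq> carrier M"
      by (rule image_subsetI) (rule word_prod_closed[OF subsetD[OF lists_mono[OF IM]]])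
    moreover have "carrier M \<subseteq> word_prod M ` lists ?X"
      unfolding Xgen by (intro image_mono lists_mono) blast
    ultimately have gen: "generates M ?X" unfolding generates_def using IM by blast
    have "context_free {w. filter (\<lambda>a. a \<noteq> Some \<one>) w \<in> ?K}"
    proof (rule context_free_insert_neutral[OF X(3), of "insert None (Some ` X)"])
      show "finite (insert None (Some ` X))" using X(1) by simp
      show "?K \<subseteq> lists (insert None (Some ` X))" unfolding pair_lang_def by auto
      show "Some \<one> \<notin> insert None (Some ` X)" using False by auto
      show "[] \<notin> ?K" unfolding pair_lang_def by simp
    qed
    moreover have "{w. filter (\<lambda>a. a \<noteq> Some \<one>) w \<in> ?K} = pair_lang ?X (\<lambda>u v. word_prod M u = word_prod M v)"
    proof (intro equalityI subsetI)
      have filter: "filter (\<lambda>a. a \<noteq> Some \<one>) (map Some u) = map Some (filter (\<lambda>a. a \<noteq> \<one>) u)" for u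
        by (induction u) auto
      {
        fix w assume "w \<in> pair_lang ?X (\<lambda>u v. word_prod M u = word_prod M v)"
        then obtain u v where w: "w = map Some u @ [None] @ rev (map Some v)" "u \<in> lists ?X" "v \<in> lists ?X"
          "word_prod M u = word_prod M v" unfolding pair_lang_def by blast
        have l: "u \<in> lists (carrier M)" "v \<in> lists (carrier M)"
          using w(2,3) lists_mono[OF IM] by blast+
        have "filter (\<lambda>a. a \<noteq> Some \<one>) w =
          map Some (filter (\<lambda>a. a \<noteq> \<one>) u) @ [None] @ rev (map Some (filter (\<lambda>a. a \<noteq> \<one>) v))"
          unfolding w(1) by (simp add: filter rev_filter[symmetric])
        moreover have "filter (\<lambda>a. a \<noteq> \<one>) u \<in> lists X" "filter (\<lambda>a. a \<noteq> \<one>) v \<in> lists X" using w(2,3) by auto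
        ultimately have "filter (\<lambda>a. a \<noteq> Some \<one>) w \<in> ?K"
          using w(4) word_prod_filter_one[OF l(1)] word_prod_filter_one[OF l(2)] by (simp only: pair_lang_iff)
        then show "w \<in> {w. filter (\<lambda>a. a \<noteq> Some \<one>) w \<in> ?K}" by simp
      next
        fix w assume "w \<in> {w. filter (\<lambda>a. a \<noteq> Some \<one>) w \<in> ?K}"
        then obtain u v where w: "filter (\<lambda>a. a \<noteq> Some \<one>) w = map Some u @ None # rev (map Some v)"
          and uv: "u \<in> lists X" "v \<in> lists X" "word_prod M u = word_prod M v" unfolding pair_lang_def by auto
        from w obtain w1 w' where 1: "w = w1 @ w'" "filter (\<lambda>a. a \<noteq> Some \<one>) w1 = map Some u"
          "filter (\<lambda>a. a \<noteq> Some \<one>) w' = None # rev (map Some v)"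
          using filter_eq_append_split by blast
        \<comment> \<open>The inserted identities directly before the separator end up in
          \<open>w2\<close>; they belong to the left word, which is therefore
          \<open>w1 @ w2\<close>.\<close>
        from 1(3) obtain w2 w3 where 2: "w' = w2 @ None # w3" "\<forall>a \<in> set w2. a = Some \<one>"
          "filter (\<lambda>a. a \<noteq> Some \<one>) w3 = rev (map Some v)"
          by (auto dest!: filter_eq_ConsD)
        have some: "\<exists>z. y = map Some z \<and> z \<in> lists ?X"
          if "filter (\<lambda>a. a \<noteq> Some \<one>) y = map Some t" "t \<in> lists X" for y t
          using that
        proof (induction y arbitrary: t)
          case (Cons a y)
          show ?case
          proof (cases "a = Some \<one>")
            case True
            with Cons obtain z where "y = map Some z" "z \<in> lists ?X" by auto
            then show ?thesis using True by (intro exI[of _ "\<one> # z"]) simp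
          next
            case False
            with Cons.prems obtain b t' where t: "t = b # t'" "a = Some b" "filter (\<lambda>a. a \<noteq> Some \<one>) y = map Some t'"
              by (cases t) auto
            then obtain z where "y = map Some z" "z \<in> lists ?X" using Cons.IH[of t'] Cons.prems by auto
            then show ?thesis using t Cons.prems by (intro exI[of _ "b # z"]) simp
          qed
        qed simp
        have "filter (\<lambda>a. a \<noteq> Some \<one>) (w1 @ w2) = map Some u" using 1(2) 2(2) by simp
        from some[OF this uv(1)] obtain u' where u': "w1 @ w2 = map Some u'" "u' \<in> lists ?X" by blast
        have "filter (\<lambda>a. a \<noteq> Some \<one>) (rev w3) = map Some v" using 2(3) by (simp add: rev_filter[symmetric])
        from some[OF this uv(2)] obtain v' where v': "rev w3 = map Some v'" "v' \<in> lists ?X" by blast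
        have "map Some (filter (\<lambda>a. a \<noteq> \<one>) u') = map Some u"
          using \<open>filter (\<lambda>a. a \<noteq> Some \<one>) (w1 @ w2) = map Some u\<close> unfolding u'(1) filter .
        then have "filter (\<lambda>a. a \<noteq> \<one>) u' = u" by (simp add: inj_map_eq_map)
        moreover have "map Some (filter (\<lambda>a. a \<noteq> \<one>) v') = map Some v"
          using \<open>filter (\<lambda>a. a \<noteq> Some \<one>) (rev w3) = map Some v\<close> unfolding v'(1) filter .
        then have "filter (\<lambda>a. a \<noteq> \<one>) v' = v" by (simp add: inj_map_eq_map)
        moreover have "u' \<in> lists (carrier M)" "v' \<in> lists (carrier M)"
          using u'(2) v'(2) lists_mono[OF IM] by blast+
        ultimately have "word_prod M u' = word_prod M v'"
          using uv(3) word_prod_filter_one[of u'] word_prod_filter_one[of v'] by simp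
        moreover have "w3 = rev (map Some v')" using v'(1) by (metis rev_rev_ident)
        then have "w = map Some u' @ [None] @ rev (map Some v')" using 1(1) 2(1) u'(1) by simp
        ultimately show "w \<in> pair_lang ?X (\<lambda>u v. word_prod M u = word_prod M v)"
          using u'(2) v'(2) by (simp only: pair_lang_iff)
      }
    qed
    ultimately have "context_free (pair_lang ?X (\<lambda>u v. word_prod M u = word_prod M v))" by simp
    then show ?thesis using that[of ?X] X(1) gen by simp
  qed
qed

text \<open>The word problem is transferred to a finite \<phi>-stable generating set containing the
  image of \<phi>^n, so that all outputs of the transducer are letters of the new alphabet.\<close>

lemma UCF_BR_if_finite_image:
  assumes "UCF M" and fin: "finite ((\<phi> ^^ n) ` carrier M)"
  shows "UCF (BR M \<phi>)"
proof -
  obtain X where X: "finite X" "generates M X" "\<one> \<in> X"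
    and cf: "context_free (pair_lang X (\<lambda>u v. word_prod M u = word_prod M v))"
    using UCF_one_generator[OF assms(1)] .
  have XM: "X \<subseteq> carrier M" and Xgen: "carrier M = word_prod M ` lists X"
    using X(2) unfolding generates_def by blast+
  obtain Y where Y: "finite Y" "Y \<subseteq> carrier M" "X \<subseteq> Y" "(\<phi> ^^ n) ` carrier M \<subseteq> Y" "\<phi> ` Y \<subseteq> Y"
    using phi_closed_superset[OF X(1) XM fin] .
  have "word_prod M ` lists Y \<subseteq> carrier M"
    by (rule image_subsetI) (rule word_prod_closed[OF subsetD[OF lists_mono[OF Y(2)]]])
  moreover have "carrier M \<subseteq> word_prod M ` lists Y"
    unfolding Xgen by (intro image_mono lists_mono Y)
  ultimately have gen: "generates M Y" unfolding generates_def using Y(2) by blast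
  define W where "W a = (SOME w. w \<in> lists X \<and> word_prod M w = a)" for a
  have W: "W a \<in> lists X \<and> word_prod M (W a) = a" if "a \<in> carrier M" for a
  proof -
    from that have "a \<in> word_prod M ` lists X" using Xgen by simp
    then have "\<exists>w. w \<in> lists X \<and> word_prod M w = a" by (elim imageE) (intro exI conjI, assumption, simp)
    then show ?thesis unfolding W_def by (rule someI_ex)
  qed
  have WX: "\<one> # W a \<in> lists X" "word_prod M (\<one> # W a) = a" if "a \<in> carrier M" for a
    using W[OF that] X(3) that by simp_all
  have cfY: "context_free (pair_lang Y (\<lambda>u v. word_prod M u = word_prod M v))"
  \<comment> \<open>The leading identity keeps the image nonempty when \<open>W a\<close> is empty,
    for instance if the identity itself was spelled by the empty word.\<close>
  proof (rule context_free_pair_lang_hom[OF cf Y(1), of "\<lambda>a. \<one> # W a"])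
    show "\<one> # W y \<in> lists X" if "y \<in> Y" for y using WX(1) that Y(2) by blast
    have *: "concat (map (\<lambda>a. \<one> # W a) u) \<in> lists (carrier M) \<and> word_prod M (concat (map (\<lambda>a. \<one> # W a) u)) = word_prod M u"
      if "u \<in> lists Y" for u
      using that
    proof induction
      case (Cons a u)
      then have a: "a \<in> carrier M" using Y(2) by blast
      have "\<one> # W a \<in> lists (carrier M)" using WX(1)[OF a] lists_mono[OF XM] by blast
      moreover have "concat (map (\<lambda>a. \<one> # W a) (a # u)) = (\<one> # W a) @ concat (map (\<lambda>a. \<one> # W a) u)" by simp
      ultimately show ?case using Cons.IH WX(2)[OF a]
        by (simp only: append_in_lists_conv word_prod_append word_prod_Cons simp_thms)
    qed simp
    show "(word_prod M u = word_prod M v) =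
        (word_prod M (concat (map (\<lambda>a. \<one> # W a) u)) = word_prod M (concat (map (\<lambda>a. \<one> # W a) v)))"
      if "u \<in> lists Y" "v \<in> lists Y" for u v
      using *[OF that(1)] *[OF that(2)] by simp
  qed simp
  interpret bruck_reilly_finite M \<phi> Y n
    by unfold_locales (use Y in auto)
  show ?thesis by (rule UCF_BR_if[OF Y(1) gen context_free_val_pairs[OF cfY]])
qed

theorem UCF_BR_iff: "UCF (BR M \<phi>) \<longleftrightarrow> UCF M \<and> (\<exists>n. finite ((\<phi> ^^ n) ` carrier M))"
proof
  assume "UCF (BR M \<phi>)"
  then obtain X where X: "finite X" "X \<subseteq> carrier M"
    "\<And>m. m \<in> carrier M \<Longrightarrow> \<exists>w \<in> lists (gens X). val w = (0, m, 0)"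
    "context_free (pair_lang (gens X) (\<lambda>u v. val u = val v))"
    using UCF_BR_D by blast
  from finite_phi_pow_image[OF X(2-4)] obtain n where "finite ((\<phi> ^^ n) ` carrier M)" by blast
  with UCF_base_if[OF X] show "UCF M \<and> (\<exists>n. finite ((\<phi> ^^ n) ` carrier M))" by blast
qed (use UCF_BR_if_finite_image in blast)

end

theorem mainTheorem17:
  fixes M :: "('a, 'b) monoid_scheme" and \<phi> :: "'a \<Rightarrow> 'a"
  assumes "monoid M"
    and "\<phi> \<in> hom M M" and "\<phi> \<one>\<^bsub>M\<^esub> = \<one>\<^bsub>M\<^esub>"
  shows "UCF (BR M \<phi>) \<longleftrightarrow> UCF M \<and> (\<exists>n::nat. finite ((\<phi> ^^ n) ` carrier M))"
proof -
  interpret bruck_reilly M \<phi>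
    using assms by (simp add: bruck_reilly_def bruck_reilly_axioms_def)
  show ?thesis by (rule UCF_BR_iff)
qed

end
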